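(* Let $I_1,I_2\subset\mathbb R^2$ be two non-parallel line segments and let $$\mu=c_1\mathcal H^1\!\restriction_{I_1}+c_2\mathcal H^1\!\restriction_{I_2},\qquad c_1,c_2>0,$$ be a Borel probability measure. Then $\mu$ is a spectral measure if and only if every spectrum of $\mu$ is contained in a straight line.
   Context: $\mathcal H^1$ is one-dimensional Hausdorff measure (arc length on line segments), and $\mathcal H^1\!\restriction_{E}$ is its restriction to $E$. Line segments are non-degenerate (positive length). A Borel probability measure $\mu$ on $\mathbb R^d$ is called a spectral measure if there is a countable set $\Lambda\subset\mathbb R^d$ such that $\{e^{2\pi i\langle\lambda,x\rangle}\}_{\lambda\in\Lambda}$ is an orthonormal basis of $L^2(\mu)$; in this case $\Lambda$ is called a spectrum of $\mu$.
   Formalization: The right-hand side also requires that μ has a spectrum; otherwise "every spectrum of μ is contained in a straight line" holds vacuously for non-spectral μ and the equivalence fails (e.g. congruent perpendicular segments crossing at midpoints, c1 = c2). *)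

theory Defs
  imports "HOL-Probability.Probability"
begin

text \<open>
  One-dimensional Hausdorff (outer) measure, normalised so that it is arc length on segments.
  The boundedness condition on the covering sets is needed because
  \<^const>\<open>diameter\<close> is 0 on unbounded sets.
\<close>

definition hausdorff1_delta :: "real \<Rightarrow> 'a::metric_space set \<Rightarrow> ennreal" where
  "hausdorff1_delta \<delta> A =
     (INF U \<in> {U :: nat \<Rightarrow> 'a set. A \<subseteq> (\<Union>i. U i) \<and> (\<forall>i. bounded (U i) \<and> diameter (U i) \<le> \<delta>)}.
        \<Sum>i. ennreal (diameter (U i)))"

definition hausdorff1 :: "'a::metric_space set \<Rightarrow> ennreal" where
  "hausdorff1 A = (SUP \<delta> \<in> {0<..}. hausdorff1_delta \<delta> A)"

definition expo :: "'a::euclidean_space \<Rightarrow> 'a \<Rightarrow> complex" where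
  "expo l x = exp (2 * complex_of_real pi * \<i> * complex_of_real (l \<bullet> x))"

definition square_integrable :: "'a measure \<Rightarrow> ('a \<Rightarrow> complex) \<Rightarrow> bool" where
  "square_integrable M f \<longleftrightarrow>
     f \<in> borel_measurable M \<and> integrable M (\<lambda>x. (cmod (f x))\<^sup>2)"

text \<open>
  Orthonormality is that of the family indexed by \<open>\<Lambda>\<close>; the last conjunct says that its linear
  span is dense in the space of square integrable functions.
\<close>

definition is_spectrum :: "'a::euclidean_space measure \<Rightarrow> 'a set \<Rightarrow> bool" where
  "is_spectrum M \<Lambda> \<longleftrightarrow>
     countable \<Lambda> \<and>
     (\<forall>l\<in>\<Lambda>. \<forall>l'\<in>\<Lambda>.
        integral\<^sup>L M (\<lambda>x. expo l x * cnj (expo l' x)) = (if l = l' then 1 else 0)) \<and>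
     (\<forall>f. square_integrable M f \<longrightarrow>
        (\<forall>\<epsilon>>0. \<exists>F a. finite F \<and> F \<subseteq> \<Lambda> \<and>
           integral\<^sup>L M (\<lambda>x. (cmod (f x - (\<Sum>l\<in>F. a l * expo l x)))\<^sup>2) < \<epsilon>))"

definition is_spectral_measure :: "'a::euclidean_space measure \<Rightarrow> bool" where
  "is_spectral_measure M \<longleftrightarrow>
     sets M = sets borel \<and> prob_space M \<and> (\<exists>\<Lambda>. is_spectrum M \<Lambda>)"

end

theory Submission
  imports Defs
begin

text \<open>
  Write \<open>u\<close>, \<open>v\<close> for the direction vectors of the two segments, \<open>p1 + p2 = 1\<close> for their masses, and
  \<open>X l = l \<bullet> u\<close>, \<open>Y l = l \<bullet> v\<close> for \<open>l\<close> in a spectrum. Parseval's identity for functions supported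
  on one segment says that the \<open>X l\<close> and the \<open>Y l\<close> form tight frames of exponentials, of densities
  proportional to \<open>1 / p1\<close> and \<open>1 / p2\<close>. Orthogonality gives
  \<open>p1 * \<bar>nsinc x\<bar> = p2 * \<bar>nsinc y\<bar>\<close> for every difference \<open>(x, y)\<close> of two points, where \<open>nsinc\<close> is the
  normalised sinc function. Say \<open>p1 \<ge> p2\<close>. Then the \<open>X l\<close> are separated with gaps uniformly less
  than 1, the points lie in a neighbourhood of a monotone curve, and comparing the two densities
  gives \<open>Y / X \<longrightarrow> p2 / p1\<close> up to sign. Hence for fixed \<open>m\<close> and far away \<open>l\<close> the quantity
  \<open>\<bar>sin (pi * x)\<bar> - \<bar>sin (pi * y)\<bar>\<close> at the difference \<open>l - m\<close> is small. Since \<open>sin\<^sup>2 (pi * x) - sin\<^sup>2 (pi * y)\<close>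
  factors as \<open>sin (pi * (x + y)) * sin (pi * (x - y))\<close>, passing to limit points on the torus shows
  that \<open>X + Y\<close> or \<open>X - Y\<close> is constant modulo 1 on the whole spectrum, except when \<open>p1 = p2\<close> and
  consecutive differences tend to \<open>(1/2, 1/2)\<close>. In the first case \<open>\<bar>sin (pi * x)\<bar> = \<bar>sin (pi * y)\<bar>\<close>
  holds exactly, so each difference is integral or has slope \<open>p2 / p1\<close> up to sign, and the gap condition excludes the
  integral ones; in the exceptional case the phase in the orthogonality relation forces the
  differences to be eventually equal to \<open>(1/2, 1/2)\<close>.
\<close>

section \<open>The normalised sinc function\<close>

text \<open>Up to the factor \<open>cis (pi * t)\<close>, this is the integral of
  \<open>cis (2 * pi * (t * s))\<close> over \<open>s\<close> in the unit interval
  (\<open>integral_cis\<close>); inner products of exponentials on a segment take this form.\<close>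

definition nsinc :: "real \<Rightarrow> real" where
  "nsinc t = (if t = 0 then 1 else sin (pi * t) / (pi * t))"

lemma nsinc_0 [simp]: "nsinc 0 = 1"
  by (simp add: nsinc_def)

lemma nsinc_minus [simp]: "nsinc (- t) = nsinc t"
  by (simp add: nsinc_def)

lemma nsinc_minus_commute: "nsinc (a - b) = nsinc (b - a)"
  using nsinc_minus[of "b - a"] by simp

lemma nsinc_abs [simp]: "nsinc \<bar>t\<bar> = nsinc t"
  by (simp add: abs_if)

lemma sin_eq_nsinc: "sin (pi * t) = pi * t * nsinc t"
  by (simp add: nsinc_def)

lemma abs_nsinc_le_1: "\<bar>nsinc t\<bar> \<le> 1"
proof (cases "t = 0")
  case False
  then show ?thesis
    using abs_sin_x_le_abs_x[of "pi * t"] by (simp add: nsinc_def divide_le_eq_1)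
qed simp

lemma nsinc_sq_le_1: "(nsinc t)\<^sup>2 \<le> 1"
  using abs_nsinc_le_1[of t] by (simp add: abs_square_le_1)

lemma abs_nsinc_mult_le: "pi * \<bar>t\<bar> * \<bar>nsinc t\<bar> \<le> 1"
  using abs_sin_le_one[of "pi * t"] by (simp add: sin_eq_nsinc abs_mult)

lemma abs_nsinc_le: "\<bar>nsinc t\<bar> \<le> 1 / (pi * \<bar>t\<bar>)" if "t \<noteq> 0"
  using abs_nsinc_mult_le[of t] that by (simp add: field_simps)

lemma continuous_nsinc: "isCont nsinc t"
proof -
  have "isCont (\<lambda>t. sinc (pi * t)) t"
    by (rule isCont_o2[OF _ isCont_sinc]) (intro continuous_intros)
  moreover have "(\<lambda>t. sinc (pi * t)) = nsinc"
    by (auto simp: nsinc_def fun_eq_iff)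
  ultimately show ?thesis by simp
qed

lemma continuous_on_nsinc [continuous_intros]:
  "continuous_on S f \<Longrightarrow> continuous_on S (\<lambda>x. nsinc (f x))"
  by (rule continuous_on_compose2[of UNIV nsinc])
     (auto intro: continuous_at_imp_continuous_on continuous_nsinc)

text \<open>The derivative at \<open>x\<close> has the sign of \<open>z * cos z - sin z\<close> with
  \<open>z = pi * x\<close>. The function \<open>sin z - z * cos z\<close> vanishes at 0 and has
  derivative \<open>z * sin z\<close>, positive for \<open>z\<close> between 0 and
  \<open>pi\<close>.\<close>

lemma nsinc_strict_decreasing:
  assumes "0 \<le> a" "a < b" "b \<le> 1"
  shows "nsinc b < nsinc a"
proof -
  have sub: "z * cos z < sin z" if "0 < z" "z < pi" for z :: real
  proof -
    have "(\<lambda>z. sin z - z * cos z) 0 < (\<lambda>z. sin z - z * cos z) z"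
    proof (rule DERIV_pos_imp_increasing_open[OF that(1)])
      fix x assume "0 < x" "x < z"
      then have "x * sin x > 0"
        using that by (simp add: sin_gt_zero)
      moreover have "((\<lambda>z. sin z - z * cos z) has_real_derivative x * sin x) (at x)"
        by (auto intro!: derivative_eq_intros)
      ultimately show "\<exists>y. ((\<lambda>z. sin z - z * cos z) has_real_derivative y) (at x) \<and> 0 < y"
        by blast
    qed (auto intro!: continuous_intros)
    then show ?thesis by simp
  qed
  have neg: "\<exists>y. (nsinc has_real_derivative y) (at x) \<and> y < 0" if "a < x" "x < b" for x
  proof -
    have x: "0 < x" "x < 1" using that assms by auto
    have "((\<lambda>t. sin (pi * t) / (pi * t)) has_real_derivative
        (pi * (pi * x * cos (pi * x) - sin (pi * x)) / (pi * x)\<^sup>2)) (at x)"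
      using x by (auto intro!: derivative_eq_intros simp: power2_eq_square field_simps)
    moreover have "eventually (\<lambda>t. t \<noteq> 0) (nhds x)"
      using x by (simp add: t1_space_nhds)
    then have "eventually (\<lambda>t. sin (pi * t) / (pi * t) = nsinc t) (nhds x)"
      by eventually_elim (simp add: nsinc_def)
    ultimately have "(nsinc has_real_derivative
        (pi * (pi * x * cos (pi * x) - sin (pi * x)) / (pi * x)\<^sup>2)) (at x)"
      using DERIV_cong_ev[OF refl _ refl, THEN iffD1] by metis
    moreover have "pi * x * cos (pi * x) < sin (pi * x)"
      using x by (intro sub) auto
    then have "pi * (pi * x * cos (pi * x) - sin (pi * x)) / (pi * x)\<^sup>2 < 0"
      using x by (simp add: divide_neg_pos mult_pos_neg)
    ultimately show ?thesis by blast
  qed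
  show ?thesis
    by (rule DERIV_neg_imp_decreasing_open[OF assms(2) neg]) (auto intro!: continuous_intros)
qed

lemma nsinc_pos: "nsinc t > 0" if "\<bar>t\<bar> < 1"
proof -
  have "nsinc 1 < nsinc \<bar>t\<bar>"
    using that by (intro nsinc_strict_decreasing) auto
  then show ?thesis by (simp add: nsinc_def[of 1])
qed

lemma nsinc_antimono: "\<bar>s\<bar> \<le> \<bar>t\<bar> \<Longrightarrow> \<bar>t\<bar> \<le> 1 \<Longrightarrow> nsinc t \<le> nsinc s"
  using nsinc_strict_decreasing[of "\<bar>s\<bar>" "\<bar>t\<bar>"] by (cases "\<bar>s\<bar> = \<bar>t\<bar>") (auto, metis nsinc_abs order_refl)

lemma nsinc_half: "nsinc (1/2) = 2 / pi"
  by (simp add: nsinc_def)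

lemma nsinc_half_sq_le: "\<bar>t\<bar> \<le> 1/2 \<Longrightarrow> 4 / pi\<^sup>2 \<le> (nsinc t)\<^sup>2"
  using power_mono[OF nsinc_antimono[of t "1/2"], of 2] by (simp add: nsinc_half power_divide)

lemma abs_nsinc_less_1: "\<bar>nsinc t\<bar> < 1" if "t \<noteq> 0"
proof (cases "\<bar>t\<bar> \<le> 1")
  case True
  then show ?thesis
    using nsinc_strict_decreasing[of 0 "\<bar>t\<bar>"] nsinc_antimono[of t 1] that
    by (simp add: nsinc_def[of 1])
next
  case False
  then have "1 * 1 < pi * \<bar>t\<bar>"
    using pi_gt3 by (intro mult_strict_mono) auto
  then have "1 / (pi * \<bar>t\<bar>) < 1" by simp
  with abs_nsinc_le[OF that] show ?thesis
    by linarith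
qed

text \<open>Both \<open>(nsinc t)\<^sup>2\<close> and \<open>t\<^sup>2 * (nsinc t)\<^sup>2\<close>
  are at most 1; adding the two bounds gives a majorant with an arctangent as primitive.\<close>

lemma nsinc_sq_le_inverse: "(nsinc t)\<^sup>2 \<le> 2 / (1 + t\<^sup>2)"
proof -
  have "t\<^sup>2 * (nsinc t)\<^sup>2 \<le> 1"
  proof -
    have "(pi * \<bar>t\<bar> * \<bar>nsinc t\<bar>)\<^sup>2 \<le> 1"
      using abs_nsinc_mult_le[of t] by (simp add: abs_square_le_1)
    then have "pi\<^sup>2 * (t\<^sup>2 * (nsinc t)\<^sup>2) \<le> 1"
      by (simp add: power_mult_distrib mult.assoc)
    moreover have "1 * (t\<^sup>2 * (nsinc t)\<^sup>2) \<le> pi\<^sup>2 * (t\<^sup>2 * (nsinc t)\<^sup>2)"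
      using pi_gt3 by (intro mult_right_mono one_le_power) auto
    ultimately show ?thesis by linarith
  qed
  with nsinc_sq_le_1[of t] have "(1 + t\<^sup>2) * (nsinc t)\<^sup>2 \<le> 2"
    by (simp add: algebra_simps)
  moreover have "1 + t\<^sup>2 > 0" by (simp add: add_pos_nonneg)
  ultimately show ?thesis
    by (simp add: pos_le_divide_eq mult.commute)
qed

section \<open>Density of tight frames\<close>

text \<open>Telescoping, since \<open>1 / n\<^sup>2 \<le> 1 / (n - 1) - 1 / n\<close>.\<close>

lemma sum_inverse_square_tail:
  fixes m N :: nat
  assumes "2 \<le> m"
  shows "(\<Sum>n=m..<N. 1 / (real n)\<^sup>2) \<le> 1 / (real m - 1)"
proof (cases "m \<le> N")
  case True
  have "(\<Sum>n=m..<N. 1 / (real n)\<^sup>2) \<le> 1 / (real m - 1) - 1 / (real N - 1)"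
    using True
  proof (induction N rule: dec_induct)
    case (step N)
    have "1 / (real N)\<^sup>2 \<le> 1 / (real N - 1) - 1 / (real (Suc N) - 1)"
      using step assms by (simp add: field_simps power2_eq_square)
    with step show ?case by simp
  qed simp
  moreover have "1 / (real N - 1) \<ge> 0" using True assms by simp
  ultimately show ?thesis by linarith
qed (use assms in simp)

text \<open>The integral of the squared \<open>nsinc\<close> over the whole line, kept as an
  abstract constant: it stands on both sides whenever two point counts are compared.\<close>

definition nsinc_mass :: real where
  "nsinc_mass = (SUP L\<in>{0<..}. integral {-L..L} (\<lambda>x. (nsinc x)\<^sup>2))"

lemma nsinc_sq_integrable: "(\<lambda>x. (nsinc (f x))\<^sup>2) integrable_on {a..b}"
  if "continuous_on {a..b} f" for f :: "real \<Rightarrow> real"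
  using that by (intro integrable_continuous_real continuous_intros)

lemma integral_nsinc_sq_bdd: "bdd_above ((\<lambda>L. integral {-L..L} (\<lambda>x. (nsinc x)\<^sup>2)) ` {0<..})"
proof (rule bdd_aboveI2)
  fix L :: real assume "L \<in> {0<..}"
  then have L: "0 < L" by simp
  have "((\<lambda>x. 2 / (1 + x\<^sup>2)) has_integral (2 * arctan L - 2 * arctan (- L))) {-L..L}"
    using L by (intro fundamental_theorem_of_calculus)
      (auto intro!: derivative_eq_intros simp: has_real_derivative_iff_has_vector_derivative[symmetric] field_simps)
  then have "integral {-L..L} (\<lambda>x. (nsinc x)\<^sup>2) \<le> 2 * arctan L - 2 * arctan (- L)"
    by (intro has_integral_le[OF integrable_integral[OF nsinc_sq_integrable]])
       (auto intro: nsinc_sq_le_inverse)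
  also have "\<dots> \<le> 2 * pi" using arctan_bounded[of L] by (simp add: arctan_minus)
  finally show "integral {-L..L} (\<lambda>x. (nsinc x)\<^sup>2) \<le> 2 * pi" .
qed

lemma integral_nsinc_sq_le: "integral {a..b} (\<lambda>x. (nsinc x)\<^sup>2) \<le> nsinc_mass"
proof -
  define L where "L = \<bar>a\<bar> + \<bar>b\<bar> + 1"
  have "integral {a..b} (\<lambda>x. (nsinc x)\<^sup>2) \<le> integral {-L..L} (\<lambda>x. (nsinc x)\<^sup>2)"
    by (intro integral_subset_le nsinc_sq_integrable) (auto simp: L_def)
  also have "\<dots> \<le> nsinc_mass"
    unfolding nsinc_mass_def by (intro cSUP_upper integral_nsinc_sq_bdd) (simp add: L_def)
  finally show ?thesis .
qed

lemma nsinc_mass_approx: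
  assumes "0 < e"
  obtains L where "0 < L" "nsinc_mass - e < integral {-L..L} (\<lambda>x. (nsinc x)\<^sup>2)"
proof -
  have "nsinc_mass - e < nsinc_mass" using assms by simp
  then show ?thesis
    using that unfolding nsinc_mass_def
    by (subst (asm) less_cSUP_iff[OF _ integral_nsinc_sq_bdd]) auto
qed

lemma nsinc_mass_pos: "0 < nsinc_mass"
proof -
  have "4 / pi\<^sup>2 = integral {-1/2..1/2} (\<lambda>x::real. 4 / pi\<^sup>2)" by simp
  also have "\<dots> \<le> integral {-1/2..1/2} (\<lambda>x. (nsinc x)\<^sup>2)"
    by (intro integral_le nsinc_sq_integrable) (auto intro!: nsinc_half_sq_le)
  also have "\<dots> \<le> nsinc_mass" by (rule integral_nsinc_sq_le)
  finally show ?thesis by (rule less_le_trans[rotated]) simp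
qed

lemma integral_nsinc_sq_shift:
  "integral {a..b} (\<lambda>x. (nsinc (t - x))\<^sup>2) = integral {a - t..b - t} (\<lambda>x. (nsinc x)\<^sup>2)"
proof -
  have "integral {a..b} ((\<lambda>x. (nsinc x)\<^sup>2) \<circ> (\<lambda>x. x + - t)) = integral {a + - t..b + - t} (\<lambda>x. (nsinc x)\<^sup>2)"
    by (rule integral_shift) (intro continuous_intros)
  then show ?thesis
    by (simp add: o_def nsinc_minus_commute[of t])
qed

text \<open>On the unit interval, \<open>\<bar>nsinc (t i - x)\<bar>\<close> is the modulus of the
  inner product of the exponentials with frequencies \<open>t i\<close> and \<open>x\<close>. The
  first assumption is thus the tight frame identity with constant \<open>D\<close>, tested on the
  exponentials of all real frequencies.\<close>

locale sinc_frame =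
  fixes I :: "'i set" and t :: "'i \<Rightarrow> real" and D :: real
  assumes frame: "\<And>x. ((\<lambda>i. (nsinc (t i - x))\<^sup>2) has_sum D) I"
    and D_pos: "0 < D"
begin

lemma sum_le_D: "finite F \<Longrightarrow> F \<subseteq> I \<Longrightarrow> (\<Sum>i\<in>F. (nsinc (t i - x))\<^sup>2) \<le> D"
  by (rule finite_sum_le_has_sum[OF frame]) auto

text \<open>Each point of the window contributes at least \<open>4 / pi\<^sup>2\<close> to a sum
  bounded by \<open>D\<close>, and \<open>pi < 4\<close>.\<close>

lemma finite_card_window:
  "finite {i \<in> I. \<bar>t i - x\<bar> \<le> 1/2}" (is "finite ?W")
  and card_window: "real (card {i \<in> I. \<bar>t i - x\<bar> \<le> 1/2}) \<le> 4 * D"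
proof -
  have "card G \<le> nat \<lfloor>4 * D\<rfloor>" if G: "G \<subseteq> ?W" "finite G" for G
  proof -
    have "real (card G) * (4 / pi\<^sup>2) = (\<Sum>i\<in>G. 4 / pi\<^sup>2)" by simp
    also have "\<dots> \<le> (\<Sum>i\<in>G. (nsinc (t i - x))\<^sup>2)"
      using G by (intro sum_mono nsinc_half_sq_le) auto
    also have "\<dots> \<le> D" using G by (intro sum_le_D) auto
    finally have "real (card G) \<le> D * (pi\<^sup>2 / 4)" by (simp add: field_simps)
    also have "\<dots> \<le> D * 4"
    proof (intro mult_left_mono)
      have "pi\<^sup>2 \<le> 4\<^sup>2" using pi_less_4 by (intro power_mono) auto
      then show "pi\<^sup>2 / 4 \<le> 4" by simp
    qed (use D_pos in auto)
    finally show ?thesis by linarith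
  qed
  then have "finite ?W \<and> card ?W \<le> nat \<lfloor>4 * D\<rfloor>"
    by (rule finite_if_finite_subsets_card_bdd)
  moreover have "real (nat \<lfloor>4 * D\<rfloor>) \<le> 4 * D" using D_pos by simp
  ultimately show "finite ?W" "real (card ?W) \<le> 4 * D" by linarith+
qed

lemma finite_interval: "finite {i \<in> I. a \<le> t i \<and> t i \<le> b}"
proof (rule finite_subset)
  show "{i \<in> I. a \<le> t i \<and> t i \<le> b} \<subseteq>
      (\<Union>k\<in>{\<lfloor>a\<rfloor>..\<lceil>b\<rceil>}. {i \<in> I. \<bar>t i - of_int k\<bar> \<le> 1/2})"
  proof (safe, simp)
    fix i assume i: "i \<in> I" "a \<le> t i" "t i \<le> b"
    have "\<lfloor>a\<rfloor> \<le> round (t i)" "round (t i) \<le> \<lceil>b\<rceil>"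
      using i by (meson floor_le_round floor_mono order_trans, meson round_mono ceiling_ge_round order_trans)
    moreover have "\<bar>t i - of_int (round (t i))\<bar> \<le> 1/2"
      using of_int_round_abs_le[of "t i"] by (simp add: abs_minus_commute)
    ultimately show "\<exists>k\<in>{\<lfloor>a\<rfloor>..\<lceil>b\<rceil>}. \<bar>t i - of_int k\<bar> * 2 \<le> 1"
      by (intro bexI[of _ "round (t i)"]) auto
  qed
qed (intro finite_UN_I finite_card_window finite_atLeastAtMost_int)

text \<open>If \<open>k\<close> is the rounded distance from \<open>x\<close> to \<open>t i\<close>,
  then the term of \<open>i\<close> at \<open>x\<close> is at most \<open>1 / k\<^sup>2\<close>
  times the sum of its terms at \<open>x + k\<close> and \<open>x - k\<close>. Summing the frame
  bounds over \<open>k\<close> gives \<open>2 * D\<close> times a tail of the inverse squares,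
  uniformly in \<open>x\<close>.\<close>

lemma tail_small:
  assumes "0 < e"
  obtains L where "0 < L"
    "\<And>x G. finite G \<Longrightarrow> G \<subseteq> I \<Longrightarrow> (\<And>i. i \<in> G \<Longrightarrow> L \<le> \<bar>t i - x\<bar>) \<Longrightarrow>
       (\<Sum>i\<in>G. (nsinc (t i - x))\<^sup>2) \<le> e"
proof -
  define m :: nat where "m = nat \<lceil>2 * D / e\<rceil> + 2"
  have m: "2 \<le> m" "2 * D / e \<le> real m - 1"
    unfolding m_def by linarith+
  have "(\<Sum>i\<in>G. (nsinc (t i - x))\<^sup>2) \<le> e"
    if G: "finite G" "G \<subseteq> I" and far: "\<And>i. i \<in> G \<Longrightarrow> real m + 1 \<le> \<bar>t i - x\<bar>" for G x
  proof -
    define n where "n i = nat \<bar>round (t i - x)\<bar>" for i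
    \<comment> \<open>Exceeds every rounded distance in \<open>G\<close>, so a finite range of
      \<open>k\<close> suffices.\<close>
    define N where "N = Suc (Max (insert 0 (n ` G)))"
    define h where "h i k = ((nsinc (t i - (x + real k)))\<^sup>2 + (nsinc (t i - (x - real k)))\<^sup>2) / (real k)\<^sup>2" for i k
    have h0: "0 \<le> h i k" for i k unfolding h_def by simp
    have pt: "(nsinc (t i - x))\<^sup>2 \<le> (\<Sum>k=m..<N. h i k)" if i: "i \<in> G" for i
    proof -
      define y where "y = t i - x"
      have y: "real m + 1 \<le> \<bar>y\<bar>" using far[OF i] by (simp add: y_def)
      have ry: "\<bar>of_int (round y) - y\<bar> \<le> 1/2" by (rule of_int_round_abs_le)
      have rn: "real (n i) = \<bar>of_int (round y)\<bar>" by (simp add: n_def y_def)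
      have n1: "real (n i) \<le> 2 * \<bar>y\<bar>" "real m \<le> real (n i)"
        using rn ry y m(1) by linarith+
      have "n i < N" unfolding N_def using i G by (simp add: less_Suc_eq_le)
      then have nin: "n i \<in> {m..<N}" using n1 by simp
      have close: "\<bar>y - real (n i)\<bar> \<le> 1/2 \<or> \<bar>y + real (n i)\<bar> \<le> 1/2"
        using rn ry by linarith
      have near: "4 / pi\<^sup>2 \<le> (nsinc (y - real (n i)))\<^sup>2 + (nsinc (y + real (n i)))\<^sup>2"
        using close nsinc_half_sq_le[of "y - real (n i)"] nsinc_half_sq_le[of "y + real (n i)"]
        by (smt (verit) zero_le_power2)
      have dec: "(nsinc y)\<^sup>2 \<le> (4 / pi\<^sup>2) / (real (n i))\<^sup>2"
      proof -
        have "pi * (real (n i) / 2) * \<bar>nsinc y\<bar> \<le> pi * \<bar>y\<bar> * \<bar>nsinc y\<bar>"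
          using n1 by (intro mult_right_mono mult_left_mono) auto
        also have "\<dots> \<le> 1" by (rule abs_nsinc_mult_le)
        finally have "(pi * (real (n i) / 2) * \<bar>nsinc y\<bar>)\<^sup>2 \<le> 1"
          by (simp add: abs_square_le_1 abs_mult)
        then have "(nsinc y)\<^sup>2 * (pi\<^sup>2 * (real (n i))\<^sup>2) \<le> 4"
          by (simp add: power_mult_distrib power_divide mult.commute mult.left_commute)
        moreover have "0 < pi\<^sup>2 * (real (n i))\<^sup>2" using n1 m by simp
        ultimately have "(nsinc y)\<^sup>2 \<le> 4 / (pi\<^sup>2 * (real (n i))\<^sup>2)" by (simp only: pos_le_divide_eq)
        then show ?thesis by simp
      qed
      have sh: "t i - (x + real (n i)) = y - real (n i)" "t i - (x - real (n i)) = y + real (n i)"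
        by (simp_all add: y_def)
      have "(nsinc y)\<^sup>2 \<le> h i (n i)"
        unfolding h_def sh
        by (rule order_trans[OF dec divide_right_mono[OF near]]) simp
      also have "\<dots> \<le> (\<Sum>k=m..<N. h i k)"
        using nin h0 by (intro member_le_sum) auto
      finally show ?thesis by (simp add: y_def)
    qed
    have "(\<Sum>i\<in>G. (nsinc (t i - x))\<^sup>2) \<le> (\<Sum>i\<in>G. \<Sum>k=m..<N. h i k)"
      by (intro sum_mono pt)
    also have "\<dots> = (\<Sum>k=m..<N. \<Sum>i\<in>G. h i k)" by (rule sum.swap)
    also have "\<dots> \<le> (\<Sum>k=m..<N. (2 * D) * (1 / (real k)\<^sup>2))"
    proof (intro sum_mono)
      fix k
      have "(\<Sum>i\<in>G. h i k) = ((\<Sum>i\<in>G. (nsinc (t i - (x + real k)))\<^sup>2) + (\<Sum>i\<in>G. (nsinc (t i - (x - real k)))\<^sup>2)) / (real k)\<^sup>2"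
        by (simp add: h_def sum_divide_distrib[symmetric] sum.distrib)
      also have "\<dots> \<le> (D + D) / (real k)\<^sup>2"
        using G by (intro divide_right_mono add_mono sum_le_D) auto
      finally show "(\<Sum>i\<in>G. h i k) \<le> (2 * D) * (1 / (real k)\<^sup>2)" by simp
    qed
    also have "\<dots> = 2 * D * (\<Sum>k=m..<N. 1 / (real k)\<^sup>2)" by (simp only: sum_distrib_left)
    also have "\<dots> \<le> 2 * D * (1 / (real m - 1))"
      using m D_pos by (intro mult_left_mono sum_inverse_square_tail) auto
    also have "\<dots> \<le> e" using m assms by (simp add: field_simps)
    finally show ?thesis .
  qed
  then show ?thesis using that[of "real m + 1"] by (simp add: add_pos_nonneg)
qed

text \<open>Integrate the frame bound over \<open>{a - L..b + L}\<close>: every point in the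
  interval from \<open>a\<close> to \<open>b\<close> brings almost all of \<open>nsinc_mass\<close>,
  while the total is at most \<open>D\<close> times the length.\<close>

lemma density_upper:
  assumes "0 < e"
  obtains R where "0 < R"
    "\<And>a b. R \<le> b - a \<Longrightarrow> nsinc_mass * real (card {i \<in> I. a \<le> t i \<and> t i \<le> b}) \<le> (D + e) * (b - a)"
proof -
  define c where "c = nsinc_mass"
  \<comment> \<open>Chosen so that \<open>D * c / (c - d) = D + e / 2\<close>; the other half of
    \<open>e\<close> pays for the two margins of length \<open>L\<close>.\<close>
  define d where "d = c * e / (2 * D + e)"
  have c: "0 < c" unfolding c_def by (rule nsinc_mass_pos)
  have d: "0 < d" using c assms D_pos by (simp add: d_def)
  then obtain L where L: "0 < L" "c - d < integral {-L..L} (\<lambda>x. (nsinc x)\<^sup>2)"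
    using nsinc_mass_approx unfolding c_def by metis
  have cd: "c - d = c * (2 * D) / (2 * D + e)"
    using assms D_pos by (simp add: d_def field_simps)
  have cd0: "c - d > 0" unfolding cd using assms D_pos c by simp
  define R where "R = 2 * L * (2 * D + e) / e"
  have "c * real (card {i \<in> I. a \<le> t i \<and> t i \<le> b}) \<le> (D + e) * (b - a)" if R: "R \<le> b - a" for a b
  proof -
    let ?F = "{i \<in> I. a \<le> t i \<and> t i \<le> b}"
    have "0 \<le> R" using L assms D_pos unfolding R_def by simp
    with R have ab: "a \<le> b" by linarith
    have "real (card ?F) * (c - d) = (\<Sum>i\<in>?F. c - d)" by simp
    also have "\<dots> \<le> (\<Sum>i\<in>?F. integral {a - L..b + L} (\<lambda>x. (nsinc (t i - x))\<^sup>2))"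
    proof (intro sum_mono)
      fix i assume i: "i \<in> ?F"
      have "c - d \<le> integral {-L..L} (\<lambda>x. (nsinc x)\<^sup>2)" using L by simp
      also have "\<dots> \<le> integral {a - L - t i..b + L - t i} (\<lambda>x. (nsinc x)\<^sup>2)"
        using i by (intro integral_subset_le nsinc_sq_integrable) (auto intro: continuous_intros)
      finally show "c - d \<le> integral {a - L..b + L} (\<lambda>x. (nsinc (t i - x))\<^sup>2)"
        by (simp add: integral_nsinc_sq_shift)
    qed
    also have "\<dots> = integral {a - L..b + L} (\<lambda>x. \<Sum>i\<in>?F. (nsinc (t i - x))\<^sup>2)"
      by (rule integral_sum[symmetric]) (auto intro!: finite_interval nsinc_sq_integrable continuous_intros)
    also have "\<dots> \<le> integral {a - L..b + L} (\<lambda>x. D)"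
      by (intro integral_le integrable_sum nsinc_sq_integrable)
         (auto intro!: finite_interval continuous_intros sum_le_D)
    also have "\<dots> = D * (b - a + 2 * L)" using ab L by (simp add: algebra_simps)
    finally have "real (card ?F) * (c * (2 * D)) \<le> D * (b - a + 2 * L) * (2 * D + e)"
      unfolding cd using assms D_pos by (simp add: field_simps)
    then have "2 * D * (c * real (card ?F)) \<le> 2 * D * ((b - a + 2 * L) * (D + e / 2))"
      by (simp add: algebra_simps)
    then have "c * real (card ?F) \<le> (b - a + 2 * L) * (D + e / 2)"
      using D_pos by simp
    also have "\<dots> \<le> (D + e) * (b - a)"
    proof -
      have "2 * L * (2 * D + e) \<le> (b - a) * e"
        using R assms unfolding R_def by (simp only: pos_divide_le_eq)
      then show ?thesis by (simp add: algebra_simps)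
    qed
    finally show ?thesis .
  qed
  moreover have "R > 0" unfolding R_def using L assms D_pos by simp
  ultimately show ?thesis using that c_def by blast
qed

text \<open>Integrate over \<open>{a + L..b - L}\<close>: there the points outside the interval from
  \<open>a\<close> to \<open>b\<close> contribute at most \<open>e / 2\<close> to the frame sum, and
  each point inside adds at most \<open>nsinc_mass\<close> to the integral.\<close>

lemma density_lower:
  assumes "0 < e"
  obtains R where "0 < R"
    "\<And>a b. R \<le> b - a \<Longrightarrow> (D - e) * (b - a) \<le> nsinc_mass * real (card {i \<in> I. a \<le> t i \<and> t i \<le> b})"
proof -
  define c where "c = nsinc_mass"
  have c: "0 < c" unfolding c_def by (rule nsinc_mass_pos)
  obtain L where L: "0 < L" "\<And>x G. finite G \<Longrightarrow> G \<subseteq> I \<Longrightarrow> (\<And>i. i \<in> G \<Longrightarrow> L \<le> \<bar>t i - x\<bar>) \<Longrightarrow>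
       (\<Sum>i\<in>G. (nsinc (t i - x))\<^sup>2) \<le> e / 2"
    using tail_small[of "e/2"] assms by auto
  define R where "R = 2 * L + 4 * L * D / e"
  have "0 \<le> 4 * L * D / e" using L(1) assms D_pos by (intro divide_nonneg_pos mult_nonneg_nonneg) auto
  then have R2: "2 * L \<le> R" "4 * L * D / e \<le> R" unfolding R_def using L(1) by auto
  have "(D - e) * (b - a) \<le> c * real (card {i \<in> I. a \<le> t i \<and> t i \<le> b})" if R: "R \<le> b - a" for a b
  proof -
    let ?F = "{i \<in> I. a \<le> t i \<and> t i \<le> b}"
    have "a + 2 * L \<le> b" using R R2 by simp
    then have ab: "a + L \<le> b - L" by simp
    have inner: "D - e / 2 \<le> (\<Sum>i\<in>?F. (nsinc (t i - x))\<^sup>2)" if x: "x \<in> {a + L..b - L}" for x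
    proof -
      have "D \<le> (\<Sum>i\<in>?F. (nsinc (t i - x))\<^sup>2) + e / 2"
      proof (rule has_sum_le_finite_sums[OF frame[of x]])
        fix G assume G: "finite G" "G \<subseteq> I"
        have "(\<Sum>i\<in>G. (nsinc (t i - x))\<^sup>2) = (\<Sum>i\<in>G \<inter> ?F. (nsinc (t i - x))\<^sup>2) + (\<Sum>i\<in>G - ?F. (nsinc (t i - x))\<^sup>2)"
          using G by (intro sum.Int_Diff)
        also have "\<dots> \<le> (\<Sum>i\<in>?F. (nsinc (t i - x))\<^sup>2) + e / 2"
        proof (rule add_mono)
          show "(\<Sum>i\<in>G \<inter> ?F. (nsinc (t i - x))\<^sup>2) \<le> (\<Sum>i\<in>?F. (nsinc (t i - x))\<^sup>2)"
            by (rule sum_mono2[OF finite_interval]) auto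
          have "L \<le> \<bar>t i - x\<bar>" if "i \<in> G - ?F" for i
            using that G x by (cases "a \<le> t i") auto
          then show "(\<Sum>i\<in>G - ?F. (nsinc (t i - x))\<^sup>2) \<le> e / 2"
            using G by (intro L(2)) auto
        qed
        finally show "(\<Sum>i\<in>G. (nsinc (t i - x))\<^sup>2) \<le> (\<Sum>i\<in>?F. (nsinc (t i - x))\<^sup>2) + e / 2" .
      qed
      then show ?thesis by simp
    qed
    have "(D - e / 2) * (b - a - 2 * L) = integral {a + L..b - L} (\<lambda>x. D - e / 2)"
      using ab by (simp add: algebra_simps)
    also have "\<dots> \<le> integral {a + L..b - L} (\<lambda>x. \<Sum>i\<in>?F. (nsinc (t i - x))\<^sup>2)"
      by (intro integral_le integrable_sum nsinc_sq_integrable inner)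
         (auto intro!: finite_interval continuous_intros)
    also have "\<dots> = (\<Sum>i\<in>?F. integral {a + L..b - L} (\<lambda>x. (nsinc (t i - x))\<^sup>2))"
      by (rule integral_sum) (auto intro!: finite_interval nsinc_sq_integrable continuous_intros)
    also have "\<dots> \<le> (\<Sum>i\<in>?F. c)"
      unfolding integral_nsinc_sq_shift c_def by (intro sum_mono integral_nsinc_sq_le)
    finally have "(D - e / 2) * (b - a - 2 * L) \<le> c * real (card ?F)" by (simp add: mult.commute)
    moreover have "(D - e) * (b - a) \<le> (D - e / 2) * (b - a - 2 * L)"
    proof -
      have "4 * L * D / e \<le> b - a" using R R2 by simp
      then have "2 * L * D \<le> e / 2 * (b - a)" using assms by (simp add: field_simps)
      moreover have "0 \<le> e * L" using L(1) assms by simp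
      ultimately show ?thesis by (simp add: algebra_simps)
    qed
    ultimately show ?thesis by linarith
  qed
  moreover have "R > 0" using L(1) R2 by simp
  ultimately show ?thesis using that c_def by blast
qed

end

section \<open>Gaps in a separated tight frame\<close>

lemma nsinc_shift:
  assumes "t \<noteq> 0" "t \<noteq> 1"
  shows "nsinc (t - 1) = - nsinc t * (t / (t - 1))"
  using assms by (simp add: nsinc_def right_diff_distrib sin_diff field_simps)

lemma nsinc_near_1:
  assumes "0 < t" "t < 1"
  shows "0 \<le> nsinc t" "nsinc t \<le> (1 - t) / t"
proof -
  show "0 \<le> nsinc t" using nsinc_pos[of t] assms by simp
  have "sin (pi * t) = sin (pi * (1 - t))"
    by (simp add: right_diff_distrib sin_diff)
  also have "\<dots> \<le> pi * (1 - t)"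
    using assms by (intro sin_x_le_x) auto
  finally show "nsinc t \<le> (1 - t) / t"
    using assms by (simp add: nsinc_def field_simps)
qed

context sinc_frame
begin

text \<open>Put \<open>y j = t j - t i\<close>. By \<open>nsinc_shift\<close>, the relation
  \<open>shift\<close> at \<open>t i\<close> says that the squares of \<open>nsinc (y j)\<close>,
  weighted by \<open>y j / (y j - 1)\<close>, cancel. The weight is negative only for
  \<open>y j\<close> between 0 and 1. Without a point up to distance \<open>g\<close>, at most one
  such point remains, too close to 1 to balance the positive rest, which is of size at least
  \<open>c * (D - 1)\<close> up to a small error.\<close>

lemma gap:
  assumes shift: "\<And>x. ((\<lambda>i. nsinc (t i - x) * nsinc (t i - x - 1)) has_sum 0) I"
    and sep: "0 < r" "\<And>i j. i \<in> I \<Longrightarrow> j \<in> I \<Longrightarrow> i \<noteq> j \<Longrightarrow> r \<le> \<bar>t i - t j\<bar>"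
    and D: "1 < D"
  obtains g where "0 < g" "g < 1" "\<And>i. i \<in> I \<Longrightarrow> \<exists>j\<in>I. t i < t j \<and> t j \<le> t i + g"
proof -
  \<comment> \<open>\<open>q\<close> is the frame sum left after removal of \<open>i\<close> itself,
    and \<open>c\<close> bounds the weight \<open>y / (y - 1)\<close> from below for
    \<open>y \<le> - r\<close> and for \<open>y > 1\<close>.\<close>
  define q c where "q = D - 1" and "c = r / (1 + r)"
  have q: "0 < q" using D by (simp add: q_def)
  have c: "0 < c" "c \<le> 1" using sep(1) by (auto simp: c_def)
  \<comment> \<open>The bound \<open>r / 2\<close> leaves room for at most one point between
    distances \<open>g\<close> and 1; the other two make the loss \<open>w + c * w\<^sup>2\<close>
    at that point smaller than \<open>c * q\<close>.\<close>
  define w where "w = min (min 1 (r / 2)) (c * q / 4)"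
  have w: "0 < w" "w \<le> 1" "w \<le> r / 2" "w \<le> c * q / 4"
    using q c sep(1) by (auto simp: w_def)
  have small: "w + c * w\<^sup>2 < c * q"
  proof -
    have "c * w\<^sup>2 \<le> 1 * w"
      unfolding power2_eq_square using w c by (intro mult_mono mult_left_le_one_le) auto
    moreover have "0 < c * q" using c q by simp
    ultimately show ?thesis using w by linarith
  qed
  define g where "g = 1 / (1 + w)"
  have g: "0 < g" "g < 1" "1 - g < r" "(1 - g) / g = w"
  proof -
    show "0 < g" "g < 1" using w by (auto simp: g_def)
    show *: "(1 - g) / g = w" using w by (simp add: g_def field_simps)
    have "1 - g = w * g" using * \<open>0 < g\<close> by (simp add: field_simps)
    also have "\<dots> \<le> w * 1" using w \<open>g < 1\<close> by (intro mult_left_mono) auto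
    finally show "1 - g < r" using w sep(1) by linarith
  qed
  have "\<exists>j\<in>I. t i < t j \<and> t j \<le> t i + g" if i: "i \<in> I" for i
  proof (rule ccontr)
    assume no: "\<not> ?thesis"
    define y where "y j = t j - t i" for j
    define S where "S = {j \<in> I. g < y j \<and> y j < 1}"
    have S: "finite S" "card S \<le> 1"
    proof -
      have eq: "j = k" if "j \<in> S" "k \<in> S" for j k
        using that sep(2)[of j k] g unfolding S_def y_def by fastforce
      show fin: "finite S"
        by (rule finite_subset[OF _ finite_interval[of "t i" "t i + 1"]])
           (use g in \<open>auto simp: S_def y_def\<close>)
      show "card S \<le> 1"
        using eq by (simp add: card_le_Suc0_iff_eq[OF fin])
    qed
    have loc: "y j \<le> - r \<or> y j \<ge> 1 \<or> j \<in> S" if "j \<in> I - {i}" for j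
      using sep(2)[of i j] that i no sep(1) unfolding S_def y_def by force
    \<comment> \<open>Termwise comparison. Summed over all points other than \<open>i\<close>, the
      right-hand sides give \<open>- (c * q)\<close>, whereas the left-hand sides lose at most
      \<open>w + c * w\<^sup>2\<close>.\<close>
    have pt: "(if j \<in> S then - (w + c * w\<^sup>2) else 0)
        \<le> - (nsinc (y j) * nsinc (y j - 1)) - c * (nsinc (y j))\<^sup>2" if j: "j \<in> I - {i}" for j
    proof -
      have h: "- (nsinc z * nsinc (z - 1)) = (nsinc z)\<^sup>2 * (z / (z - 1))" if "z \<noteq> 0" "z \<noteq> 1" for z
        using nsinc_shift[OF that] by (simp add: power2_eq_square)
      consider "j \<in> S" | "y j \<le> - r" | "y j = 1" | "y j > 1" "j \<notin> S"
        using loc[OF j] by fastforce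
      then show ?thesis
      proof cases
        case 1
        define z where "z = (1 - y j) / y j"
        have yj: "0 < y j" "y j < 1" using 1 g by (auto simp: S_def)
        have z: "0 < z" "z \<le> w"
        proof -
          show "0 < z" using yj by (simp add: z_def)
          have "(1 - y j) / y j \<le> (1 - g) / g"
            using 1 g yj by (intro frac_le) (auto simp: S_def)
          then show "z \<le> w" using g by (simp add: z_def)
        qed
        have s: "(nsinc (y j))\<^sup>2 \<le> z\<^sup>2"
          using nsinc_near_1[OF yj] by (intro power_mono) (auto simp: z_def)
        have "(nsinc (y j))\<^sup>2 / z \<le> z\<^sup>2 / z"
          using s z by (intro divide_right_mono) auto
        then have "(nsinc (y j))\<^sup>2 / z \<le> w" using z by (simp add: power2_eq_square)
        moreover have "(nsinc (y j))\<^sup>2 \<le> w\<^sup>2" using s z power_mono[of z w 2] by linarith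
        then have "c * (nsinc (y j))\<^sup>2 \<le> c * w\<^sup>2" using c by simp
        moreover have "y j / (y j - 1) = - (1 / z)"
          using yj by (simp add: z_def field_simps)
        then have "- (nsinc (y j) * nsinc (y j - 1)) = - ((nsinc (y j))\<^sup>2 / z)"
          using h[of "y j"] yj by simp
        ultimately show ?thesis using 1 by simp
      next
        case 2
        have "c \<le> y j / (y j - 1)"
          using 2 sep(1) unfolding c_def by (simp add: field_simps)
        then have "c * (nsinc (y j))\<^sup>2 \<le> (y j / (y j - 1)) * (nsinc (y j))\<^sup>2"
          by (intro mult_right_mono) auto
        moreover have "j \<notin> S" using 2 g sep(1) by (auto simp: S_def)
        ultimately show ?thesis using h[of "y j"] 2 sep(1) by (simp add: mult.commute)
      next
        case 3
        then have "j \<notin> S" by (auto simp: S_def)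
        with 3 show ?thesis by (simp add: nsinc_def)
      next
        case 4
        have "1 \<le> y j / (y j - 1)" using 4 by (simp add: field_simps)
        then have "c * (nsinc (y j))\<^sup>2 \<le> (y j / (y j - 1)) * (nsinc (y j))\<^sup>2"
          using c by (intro mult_right_mono) auto
        then show ?thesis using h[of "y j"] 4 by (simp add: mult.commute)
      qed
    qed
    have s1: "((\<lambda>j. (nsinc (y j))\<^sup>2) has_sum D - 1) (I - {i})"
      using has_sum_Diff[OF frame[of "t i"], of "{i}" 1] i by (simp add: y_def has_sum_finite_iff)
    have s2: "((\<lambda>j. nsinc (y j) * nsinc (y j - 1)) has_sum 0) (I - {i})"
      using has_sum_Diff[OF shift[of "t i"], of "{i}" 0] i
      by (simp add: y_def has_sum_finite_iff nsinc_def)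
    have "((\<lambda>j. - (nsinc (y j) * nsinc (y j - 1)) + (- (c * (nsinc (y j))\<^sup>2))) has_sum (- 0 + - (c * (D - 1)))) (I - {i})"
      by (intro has_sum_add has_sum_uminusI has_sum_cmult_right s1 s2)
    then have s3: "((\<lambda>j. - (nsinc (y j) * nsinc (y j - 1)) - c * (nsinc (y j))\<^sup>2) has_sum - (c * q)) (I - {i})"
      by (simp add: q_def)
    have "((\<lambda>j. if j \<in> S then - (w + c * w\<^sup>2) else 0) has_sum (\<Sum>j\<in>S. - (w + c * w\<^sup>2))) (I - {i})"
    proof (rule has_sum_finite_neutralI[OF S(1)])
      show "S \<subseteq> I - {i}" using g by (auto simp: S_def y_def)
    qed auto
    from has_sum_mono[OF this s3 pt]
    have "c * q \<le> real (card S) * (w + c * w\<^sup>2)"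
      by (simp add: q_def right_diff_distrib distrib_left)
    also have "\<dots> \<le> 1 * (w + c * w\<^sup>2)"
      using S w c by (intro mult_right_mono) auto
    finally show False using small by simp
  qed
  then show ?thesis using that g by blast
qed

end

section \<open>Frames coupled by the orthogonality relation\<close>

text \<open>\<open>shiftX\<close> is the polarised frame identity for the frequencies
  \<open>x\<close> and \<open>x + 1\<close>, whose exponentials are orthogonal on the unit interval.
  In \<open>orth\<close>, the two segments contribute one summand each, and \<alpha> and \<beta> are
  the coordinates of the vector joining the midpoints of the segments.\<close>

locale biframe =
  fixes I :: "'i set" and X Y :: "'i \<Rightarrow> real" and p1 p2 \<alpha> \<beta> :: real
  assumes p: "0 < p2" "p2 \<le> p1" "p1 + p2 = 1"
    and frameX: "\<And>x. ((\<lambda>i. (nsinc (X i - x))\<^sup>2) has_sum 1 / p1) I"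
    and shiftX: "\<And>x. ((\<lambda>i. nsinc (X i - x) * nsinc (X i - x - 1)) has_sum 0) I"
    and frameY: "\<And>y. ((\<lambda>i. (nsinc (Y i - y))\<^sup>2) has_sum 1 / p2) I"
    and orth: "\<And>i j. i \<in> I \<Longrightarrow> j \<in> I \<Longrightarrow> i \<noteq> j \<Longrightarrow>
      p1 * nsinc (X i - X j)
        + cis (2 * pi * (\<alpha> * (X i - X j) + \<beta> * (Y i - Y j))) * (p2 * nsinc (Y i - Y j)) = 0"
begin

lemma p1_pos: "0 < p1" using p by simp

sublocale X: sinc_frame I X "1 / p1"
  by unfold_locales (use frameX p1_pos in auto)

sublocale Y: sinc_frame I Y "1 / p2"
  by unfold_locales (use frameY p in auto)

lemma abs_orth:
  assumes "i \<in> I" "j \<in> I" "i \<noteq> j"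
  shows "p1 * \<bar>nsinc (X i - X j)\<bar> = p2 * \<bar>nsinc (Y i - Y j)\<bar>"
proof -
  have "complex_of_real (p1 * nsinc (X i - X j))
      = - (cis (2 * pi * (\<alpha> * (X i - X j) + \<beta> * (Y i - Y j))) * of_real (p2 * nsinc (Y i - Y j)))"
    using orth[OF assms] by (simp add: eq_neg_iff_add_eq_0)
  then have "cmod (complex_of_real (p1 * nsinc (X i - X j)))
      = cmod (cis (2 * pi * (\<alpha> * (X i - X j) + \<beta> * (Y i - Y j))) * of_real (p2 * nsinc (Y i - Y j)))"
    by (metis norm_minus_cancel)
  then show ?thesis
    using p p1_pos by (simp add: norm_mult abs_mult)
qed

text \<open>If both differences were below \<open>c\<close>, both sincs would be positive and the
  phase less than a quarter turn, so the real part of \<open>orth\<close> could not vanish.\<close>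

lemma separated_pair:
  obtains c where "0 < c" "c \<le> 1"
    "\<And>i j. i \<in> I \<Longrightarrow> j \<in> I \<Longrightarrow> i \<noteq> j \<Longrightarrow> \<bar>X i - X j\<bar> < c \<Longrightarrow> c \<le> \<bar>Y i - Y j\<bar>"
proof -
  define c where "c = 1 / (4 * (\<bar>\<alpha>\<bar> + \<bar>\<beta>\<bar> + 1))"
  have c: "0 < c" "c \<le> 1" "(\<bar>\<alpha>\<bar> + \<bar>\<beta>\<bar>) * c < 1/4"
    by (auto simp: c_def field_simps add_pos_nonneg)
  have "c \<le> \<bar>Y i - Y j\<bar>" if ij: "i \<in> I" "j \<in> I" "i \<noteq> j" and Xc: "\<bar>X i - X j\<bar> < c" for i j
  proof (rule ccontr)
    assume "\<not> ?thesis"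
    then have Yc: "\<bar>Y i - Y j\<bar> < c" by simp
    define \<theta> where "\<theta> = \<alpha> * (X i - X j) + \<beta> * (Y i - Y j)"
    have "\<bar>\<theta>\<bar> \<le> \<bar>\<alpha>\<bar> * \<bar>X i - X j\<bar> + \<bar>\<beta>\<bar> * \<bar>Y i - Y j\<bar>"
      unfolding \<theta>_def by (metis abs_mult abs_triangle_ineq)
    also have "\<dots> \<le> \<bar>\<alpha>\<bar> * c + \<bar>\<beta>\<bar> * c"
      using Xc Yc by (intro add_mono mult_left_mono) auto
    finally have "\<bar>\<theta>\<bar> < 1/4" using c by (simp add: algebra_simps)
    then have "2 * pi * \<bar>\<theta>\<bar> < 2 * pi * (1/4)" by (intro mult_strict_left_mono) auto
    then have "\<bar>2 * pi * \<theta>\<bar> < pi / 2" by (simp add: abs_mult)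
    then have "0 < cos (2 * pi * \<theta>)"
      by (intro cos_gt_zero_pi) linarith+
    moreover have "0 < nsinc (X i - X j)" "0 < nsinc (Y i - Y j)"
      using Xc Yc c by (auto intro!: nsinc_pos)
    ultimately have "0 < p1 * nsinc (X i - X j) + cos (2 * pi * \<theta>) * (p2 * nsinc (Y i - Y j))"
      using p p1_pos by (intro add_pos_pos mult_pos_pos)
    moreover have "Re (p1 * nsinc (X i - X j)
        + cis (2 * pi * \<theta>) * (p2 * nsinc (Y i - Y j))) = 0"
      using orth[OF ij] by (simp only: \<theta>_def) simp
    ultimately show False by simp
  qed
  with c that show ?thesis by blast
qed

text \<open>Since \<open>p1 \<ge> p2\<close>, a tiny \<open>X\<close>-difference forces a tiny \<open>Y\<close>-difference.\<close>

lemma separated_X: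
  obtains r where "0 < r" "\<And>i j. i \<in> I \<Longrightarrow> j \<in> I \<Longrightarrow> i \<noteq> j \<Longrightarrow> r \<le> \<bar>X i - X j\<bar>"
proof -
  obtain c where c: "0 < c" "c \<le> 1"
    "\<And>i j. i \<in> I \<Longrightarrow> j \<in> I \<Longrightarrow> i \<noteq> j \<Longrightarrow> \<bar>X i - X j\<bar> < c \<Longrightarrow> c \<le> \<bar>Y i - Y j\<bar>"
    using separated_pair by metis
  \<comment> \<open>A bound below 1 for \<open>\<bar>nsinc y\<bar>\<close> when
    \<open>\<bar>y\<bar> \<ge> c\<close>: monotonicity serves up to 1, the decay
    \<open>1 / (pi * \<bar>y\<bar>)\<close> beyond.\<close>
  define s where "s = max (nsinc c) (1 / pi)"
  have s: "s < 1" "0 \<le> s"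
    using abs_nsinc_less_1[of c] c(1) pi_gt3 by (auto simp: s_def le_max_iff_disj)
  have sY: "\<bar>nsinc y\<bar> \<le> s" if "c \<le> \<bar>y\<bar>" for y
  proof (cases "\<bar>y\<bar> \<le> 1")
    case True
    then have "nsinc y \<le> nsinc c" using that c by (intro nsinc_antimono) auto
    moreover have "0 \<le> nsinc y"
      using True nsinc_antimono[of y 1] by (simp add: nsinc_def[of 1])
    ultimately show ?thesis by (simp add: s_def)
  next
    case False
    have "\<bar>nsinc y\<bar> \<le> 1 / (pi * \<bar>y\<bar>)" using False by (intro abs_nsinc_le) auto
    also have "\<dots> \<le> 1 / (pi * 1)" using False by (intro divide_left_mono mult_left_mono) auto
    finally show ?thesis by (simp add: s_def)
  qed
  have "eventually (\<lambda>x. s < nsinc x) (nhds 0)"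
    using order_tendstoD(1)[OF continuous_nsinc[of 0, unfolded isCont_def tendsto_at_iff_tendsto_nhds], of s] s
    by simp
  then obtain d where d: "0 < d" "\<And>x. \<bar>x\<bar> < d \<Longrightarrow> s < nsinc x"
    by (auto simp: eventually_nhds_metric dist_real_def)
  have "min c d \<le> \<bar>X i - X j\<bar>" if ij: "i \<in> I" "j \<in> I" "i \<noteq> j" for i j
  proof (rule ccontr)
    assume "\<not> ?thesis"
    then have "\<bar>nsinc (Y i - Y j)\<bar> \<le> s" "s < nsinc (X i - X j)"
      using c(3)[OF ij] d(2) by (auto intro!: sY)
    then have "p2 * \<bar>nsinc (Y i - Y j)\<bar> < p1 * \<bar>nsinc (X i - X j)\<bar>"
      using p p1_pos s by (intro le_less_trans[OF mult_right_mono mult_strict_left_mono]) auto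
    then show False using abs_orth[OF ij] by simp
  qed
  then show ?thesis using that[of "min c d"] c d by auto
qed

lemma gap_X:
  obtains g where "0 < g" "g < 1" "\<And>i. i \<in> I \<Longrightarrow> \<exists>j\<in>I. X i < X j \<and> X j \<le> X i + g"
proof -
  obtain r where "0 < r" "\<And>i j. i \<in> I \<Longrightarrow> j \<in> I \<Longrightarrow> i \<noteq> j \<Longrightarrow> r \<le> \<bar>X i - X j\<bar>"
    using separated_X by metis
  moreover have "1 < 1 / p1" using p p1_pos by (simp add: field_simps)
  ultimately show ?thesis using X.gap[OF shiftX] that by metis
qed

text \<open>Reduces the case where \<open>Y\<close> decreases along \<open>X\<close> to the
  increasing one.\<close>

lemma reflect_Y: "biframe I X (\<lambda>i. - Y i) p1 p2 \<alpha> (- \<beta>)"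
proof
  show "((\<lambda>i. (nsinc (- Y i - y))\<^sup>2) has_sum 1 / p2) I" for y
    using frameY[of "- y"] nsinc_minus[of "Y i + y" for i] by (simp add: minus_diff_commute)
  show "p1 * nsinc (X i - X j) + cis (2 * pi * (\<alpha> * (X i - X j) + - \<beta> * (- Y i - - Y j)))
      * (p2 * nsinc (- Y i - - Y j)) = 0" if "i \<in> I" "j \<in> I" "i \<noteq> j" for i j
    using orth[OF that] nsinc_minus_commute[of "Y j" "Y i"] by (simp add: algebra_simps)
qed (use p frameX shiftX in auto)

end

text \<open>\<open>nxt\<close> picks some point within distance \<open>g\<close> to the right, not
  necessarily the nearest. Its orbits are paths whose \<open>X\<close>-steps lie between
  \<open>r\<close> and \<open>g\<close>.\<close>

locale stepped_biframe = biframe +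
  fixes r g :: real and nxt :: "'a \<Rightarrow> 'a"
  assumes r: "0 < r" and g: "g < 1"
    and sepX: "\<And>i j. i \<in> I \<Longrightarrow> j \<in> I \<Longrightarrow> i \<noteq> j \<Longrightarrow> r \<le> \<bar>X i - X j\<bar>"
    and nxt: "\<And>i. i \<in> I \<Longrightarrow> nxt i \<in> I" "\<And>i. i \<in> I \<Longrightarrow> X i < X (nxt i)"
      "\<And>i. i \<in> I \<Longrightarrow> X (nxt i) \<le> X i + g"
begin

section \<open>Paths with short steps\<close>

lemma nxt_ge: "i \<in> I \<Longrightarrow> X i + r \<le> X (nxt i)"
  using sepX[of "nxt i" i] nxt[of i] by fastforce

lemma funpow_nxt_in: "i \<in> I \<Longrightarrow> (nxt ^^ n) i \<in> I"
  by (induction n) (auto intro: nxt)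

lemma funpow_nxt_ge: "i \<in> I \<Longrightarrow> X i + real n * r \<le> X ((nxt ^^ n) i)"
proof (induction n)
  case (Suc n)
  then show ?case
    using nxt_ge[OF funpow_nxt_in[OF Suc.prems, of n]] by (simp add: algebra_simps)
qed simp

lemma funpow_nxt_le: "i \<in> I \<Longrightarrow> X ((nxt ^^ n) i) \<le> X i + real n"
proof (induction n)
  case (Suc n)
  then show ?case
    using nxt(3)[OF funpow_nxt_in[OF Suc.prems, of n]] g by simp
qed simp

lemma unbounded: "i \<in> I \<Longrightarrow> \<exists>j\<in>I. b < X j"
proof -
  assume i: "i \<in> I"
  obtain n :: nat where "(b - X i) / r < real n" using reals_Archimedean2 by blast
  then have "b < X i + real n * r" using r by (simp add: field_simps)
  then show ?thesis using funpow_nxt_ge[OF i, of n] funpow_nxt_in[OF i, of n] by force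
qed

definition step_bound :: real where
  "step_bound = p2 / (pi * p1 * nsinc g)"

lemma g_pos: "i \<in> I \<Longrightarrow> 0 < g"
  using nxt(2,3)[of i] by linarith

lemma X_step_nsinc:
  assumes "i \<in> I" "\<bar>d\<bar> \<le> g"
  shows "0 < nsinc g" "nsinc g \<le> nsinc d"
  using g_pos[OF assms(1)] g assms(2) by (auto intro!: nsinc_pos nsinc_antimono)

text \<open>The \<open>X\<close>-difference keeps its sinc at least \<open>nsinc g > 0\<close>, so
  \<open>abs_orth\<close> bounds \<open>\<bar>nsinc (Y i - Y j)\<bar>\<close> from below, while this
  decays like \<open>1 / (pi * \<bar>Y i - Y j\<bar>)\<close>.\<close>

lemma Y_step:
  assumes ij: "i \<in> I" "j \<in> I" and d: "\<bar>X i - X j\<bar> \<le> g"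
  shows "\<bar>Y i - Y j\<bar> \<le> step_bound"
proof (cases "i = j")
  case True
  then show ?thesis using X_step_nsinc[OF assms(1,3)] p p1_pos by (simp add: step_bound_def)
next
  case False
  note n = X_step_nsinc[OF assms(1,3)]
  have "\<bar>Y i - Y j\<bar> * (pi * p1 * nsinc g) \<le> \<bar>Y i - Y j\<bar> * (pi * p1 * \<bar>nsinc (X i - X j)\<bar>)"
    using n p1_pos by (intro mult_left_mono) auto
  also have "\<dots> = p2 * (pi * \<bar>Y i - Y j\<bar> * \<bar>nsinc (Y i - Y j)\<bar>)"
    using abs_orth[OF ij False] by (simp add: mult.assoc mult.left_commute)
  also have "\<dots> \<le> p2 * 1" using p by (intro mult_left_mono abs_nsinc_mult_le) auto
  finally show ?thesis
    using n p1_pos by (simp add: step_bound_def pos_le_divide_eq)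
qed

text \<open>\<open>abs_orth\<close> multiplied by \<open>pi\<close> and both distances: a form
  without denominators, valid also when a difference vanishes.\<close>

lemma sin_ratio:
  assumes "i \<in> I" "j \<in> I" "i \<noteq> j"
  shows "p2 * \<bar>X i - X j\<bar> * \<bar>sin (pi * (Y i - Y j))\<bar> = p1 * \<bar>Y i - Y j\<bar> * \<bar>sin (pi * (X i - X j))\<bar>"
proof -
  have "p2 * \<bar>X i - X j\<bar> * \<bar>sin (pi * (Y i - Y j))\<bar>
      = pi * \<bar>X i - X j\<bar> * \<bar>Y i - Y j\<bar> * (p2 * \<bar>nsinc (Y i - Y j)\<bar>)"
    by (simp add: sin_eq_nsinc abs_mult)
  also have "\<dots> = pi * \<bar>X i - X j\<bar> * \<bar>Y i - Y j\<bar> * (p1 * \<bar>nsinc (X i - X j)\<bar>)"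
    by (simp only: abs_orth[OF assms])
  also have "\<dots> = p1 * \<bar>Y i - Y j\<bar> * \<bar>sin (pi * (X i - X j))\<bar>"
    by (simp add: sin_eq_nsinc abs_mult)
  finally show ?thesis .
qed

text \<open>Were \<open>X k\<close> far from \<open>X i\<close> but \<open>Y k\<close> close to \<open>Y i\<close>, then \<open>Y k\<close> would be close to an
  integer translate of every \<open>Y\<close>-value on the path from \<open>i\<close>, which varies by non-integers.\<close>

lemma Y_close_imp_X_close:
  obtains M where "0 < M"
    "\<And>i k. i \<in> I \<Longrightarrow> k \<in> I \<Longrightarrow> \<bar>Y i - Y k\<bar> \<le> C \<Longrightarrow> \<bar>X i - X k\<bar> \<le> M"
proof -
  \<comment> \<open>\<open>K + 1\<close> points are more than a \<open>Y\<close>-window of radius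
    1/2 can hold, and \<open>K\<close> steps shorter than \<open>d\<close> do not leave that window.
    Hence one of the first \<open>K\<close> steps changes \<open>Y\<close> by at least
    \<open>d\<close>.\<close>
  define K :: nat where "K = nat \<lceil>4 * (1 / p2)\<rceil> + 1"
  have K: "4 * (1 / p2) < real K + 1" "0 < K" unfolding K_def by linarith+
  define d where "d = 1 / (2 * real K)"
  define s where "s = pi * d * (p1 / p2) * nsinc g"
  define B where "B = 2 * (\<bar>C\<bar> + (real K + 1) * step_bound) * (p1 / p2)"
  \<comment> \<open>Leaves room for \<open>K\<close> steps in \<open>X\<close> and for the distance
    that makes the sines small. The conditional keeps \<open>M\<close> positive for empty
    \<open>I\<close>, where nothing bounds \<open>g\<close> from below.\<close>
  define M where "M = real K + 2 + (if 0 < nsinc g then \<bar>B\<bar> / s + 1 else 0)"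
  have "\<bar>X i - X k\<bar> \<le> M" if i: "i \<in> I" and k: "k \<in> I" and Yc: "\<bar>Y i - Y k\<bar> \<le> C" for i k
  proof (rule ccontr)
    assume far: "\<not> ?thesis"
    have ng: "0 < nsinc g" using X_step_nsinc[of i 0] i g_pos[OF i] by simp
    have d: "0 < d" using K by (simp add: d_def)
    have s: "0 < s" unfolding s_def using ng d p p1_pos by simp
    define J where "J n = (nxt ^^ n) i" for n
    have J: "J n \<in> I" for n unfolding J_def using funpow_nxt_in i by simp
    have Jstep: "\<bar>X (J (Suc n)) - X (J n)\<bar> \<le> g" "J (Suc n) \<noteq> J n" for n
      using nxt[OF J[of n]] by (auto simp: J_def)
    have Ystep: "\<bar>Y (J (Suc n)) - Y (J n)\<bar> \<le> step_bound" for n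
      by (intro Y_step J Jstep)
    have sb: "0 \<le> step_bound" using Ystep[of 0] by linarith
    have Ydist: "\<bar>Y (J n) - Y i\<bar> \<le> real n * step_bound" for n
    proof (induction n)
      case (Suc n)
      with Ystep[of n] show ?case by (simp add: algebra_simps)
    qed (simp add: J_def)
    have "\<exists>n<K. d \<le> \<bar>Y (J (Suc n)) - Y (J n)\<bar>"
    proof (rule ccontr)
      assume no: "\<not> ?thesis"
      have Yn: "\<bar>Y (J n) - Y i\<bar> \<le> real n * d" if "n \<le> K" for n
        using that
      proof (induction n)
        case (Suc n)
        then have "\<bar>Y (J n) - Y i\<bar> \<le> real n * d" "\<bar>Y (J (Suc n)) - Y (J n)\<bar> < d"
          using no by (auto simp: not_le Suc_le_eq)
        then show ?case by (simp add: algebra_simps)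
      qed (simp add: J_def)
      have "inj_on J {..K}"
      proof (rule inj_onI)
        have "X (J n) < X (J (Suc n))" for n
          using nxt(2)[OF J[of n]] by (simp add: J_def)
        then have mono: "strict_mono (\<lambda>n. X (J n))" by (simp add: strict_mono_Suc_iff)
        show "m = n" if "J m = J n" for m n
          using strict_mono_eq[OF mono, of m n] that by simp
      qed
      then have "card (J ` {..K}) = K + 1" by (simp add: card_image)
      moreover have "J ` {..K} \<subseteq> {k \<in> I. \<bar>Y k - Y i\<bar> \<le> 1/2}"
      proof safe
        fix n assume n: "n \<le> K"
        have "real n * d \<le> real K * d" using n d by (intro mult_right_mono) auto
        also have "\<dots> = 1/2" using K by (simp add: d_def)
        finally show "\<bar>Y (J n) - Y i\<bar> \<le> 1/2" using Yn[OF n] by linarith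
      qed (rule J)
      then have "card (J ` {..K}) \<le> card {k \<in> I. \<bar>Y k - Y i\<bar> \<le> 1/2}"
        by (intro card_mono Y.finite_card_window)
      ultimately show False using Y.card_window[of "Y i"] K by linarith
    qed
    then obtain n where n: "n < K" "d \<le> \<bar>Y (J (Suc n)) - Y (J n)\<bar>" by blast
    have big: "s \<le> \<bar>sin (pi * (Y (J (Suc n)) - Y (J n)))\<bar>"
    proof -
      have "nsinc g \<le> \<bar>nsinc (X (J (Suc n)) - X (J n))\<bar>"
        using X_step_nsinc(2)[OF i Jstep(1)[of n]] by linarith
      then have "p1 * nsinc g \<le> p1 * \<bar>nsinc (X (J (Suc n)) - X (J n))\<bar>"
        using p1_pos by simp
      then have "(p1 / p2) * nsinc g \<le> \<bar>nsinc (Y (J (Suc n)) - Y (J n))\<bar>"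
        using abs_orth[OF J J Jstep(2)[of n]] p by (simp add: field_simps)
      then have "(pi * d) * ((p1 / p2) * nsinc g)
          \<le> (pi * \<bar>Y (J (Suc n)) - Y (J n)\<bar>) * \<bar>nsinc (Y (J (Suc n)) - Y (J n))\<bar>"
        using n d ng p p1_pos by (intro mult_mono mult_left_mono) auto
      then show ?thesis by (simp add: s_def sin_eq_nsinc abs_mult mult.assoc)
    qed
    \<comment> \<open>The first \<open>K + 1\<close> points of the path are far from
      \<open>k\<close> in \<open>X\<close> but at bounded distance in \<open>Y\<close>, so
      \<open>sin_ratio\<close> makes the sine small. Applied at both ends of the step found above,
      this contradicts \<open>big\<close>.\<close>
    have small: "\<bar>sin (pi * (Y (J m) - Y k))\<bar> < s / 2" if m: "m \<le> K" for m
    proof -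
      have "\<bar>X (J m) - X i\<bar> \<le> real K"
        using funpow_nxt_le[OF i, of m] funpow_nxt_ge[OF i, of m] r m unfolding J_def
        by (smt (verit) mult_nonneg_nonneg of_nat_0_le_iff of_nat_mono)
      then have Xfar: "\<bar>B\<bar> / s + 1 < \<bar>X (J m) - X k\<bar>"
        using far ng unfolding M_def by auto
      moreover have "0 \<le> \<bar>B\<bar> / s" using s by simp
      ultimately have X0: "0 < \<bar>X (J m) - X k\<bar>" by linarith
      have ne: "J m \<noteq> k" using X0 by auto
      have "real m * step_bound \<le> (real K + 1) * step_bound" using m sb by (intro mult_right_mono) auto
      then have Yb: "\<bar>Y (J m) - Y k\<bar> \<le> \<bar>C\<bar> + (real K + 1) * step_bound"
        using Ydist[of m] Yc by linarith
      have "\<bar>X (J m) - X k\<bar> * \<bar>sin (pi * (Y (J m) - Y k))\<bar>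
          = (p1 / p2) * (\<bar>Y (J m) - Y k\<bar> * \<bar>sin (pi * (X (J m) - X k))\<bar>)"
        using sin_ratio[OF J k ne] p by (simp add: field_simps)
      also have "\<dots> \<le> (p1 / p2) * ((\<bar>C\<bar> + (real K + 1) * step_bound) * 1)"
        using Yb sb p p1_pos by (intro mult_left_mono mult_mono) auto
      also have "\<dots> = B / 2" using p by (simp add: B_def field_simps)
      also have "\<dots> < (s / 2) * \<bar>X (J m) - X k\<bar>"
      proof -
        have "\<bar>B\<bar> / s < \<bar>X (J m) - X k\<bar>" using Xfar by linarith
        then have "\<bar>B\<bar> < \<bar>X (J m) - X k\<bar> * s" using s by (simp only: pos_divide_less_eq)
        then show ?thesis by (simp add: mult.commute)
      qed
      finally show ?thesis using X0 by (simp add: mult.commute)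
    qed
    have "\<bar>sin (u - v)\<bar> \<le> \<bar>sin u\<bar> + \<bar>sin v\<bar>" for u v :: real
    proof -
      have "\<bar>sin (u - v)\<bar> \<le> \<bar>sin u\<bar> * \<bar>cos v\<bar> + \<bar>cos u\<bar> * \<bar>sin v\<bar>"
        unfolding sin_diff by (metis abs_mult abs_triangle_ineq4)
      also have "\<dots> \<le> \<bar>sin u\<bar> * 1 + 1 * \<bar>sin v\<bar>"
        by (intro add_mono mult_left_mono mult_right_mono) auto
      finally show ?thesis by simp
    qed
    from this[of "pi * (Y (J (Suc n)) - Y k)" "pi * (Y (J n) - Y k)"]
    have "\<bar>sin (pi * (Y (J (Suc n)) - Y (J n)))\<bar>
        \<le> \<bar>sin (pi * (Y (J (Suc n)) - Y k))\<bar> + \<bar>sin (pi * (Y (J n) - Y k))\<bar>"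
      by (simp add: algebra_simps)
    with big small[of n] small[of "Suc n"] n show False by simp
  qed
  moreover have "0 < M"
  proof -
    have "0 \<le> \<bar>B\<bar> / s" if "0 < nsinc g"
      unfolding s_def d_def using that p p1_pos by simp
    then show ?thesis unfolding M_def by (auto simp: add_pos_nonneg add_nonneg_pos)
  qed
  ultimately show ?thesis using that by blast
qed

text \<open>A discrete continuity argument: each application of \<open>nxt\<close> brings the left
  end closer to \<open>j\<close> by at least \<open>r\<close>, until one last step of length at most
  \<open>g\<close> remains.\<close>

lemma chain:
  assumes ij: "i \<in> I" "j \<in> I" "X i \<le> X j"
    and step: "\<And>a b. a \<in> I \<Longrightarrow> b \<in> I \<Longrightarrow> X i \<le> X a \<Longrightarrow> X a < X b \<Longrightarrow> X b \<le> X j \<Longrightarrow> X b \<le> X a + g \<Longrightarrow> P a = P b"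
  shows "P i = P j"
proof -
  obtain n :: nat where "(X j - X i) / r < real n" using reals_Archimedean2 by blast
  then have "X j - X i \<le> real n * r" using r by (simp add: field_simps)
  from this ij step show ?thesis
  proof (induction n arbitrary: i)
    case 0
    then have "X i = X j" by simp
    then have "i = j" using sepX[of i j] 0 r by fastforce
    then show ?case by simp
  next
    case (Suc n)
    show ?case
    proof (cases "X j \<le> X i + g")
      case True
      show ?thesis
      proof (cases "X i = X j")
        case True
        then have "i = j" using sepX[of i j] Suc.prems r by fastforce
        then show ?thesis by simp
      next
        case False
        then show ?thesis using Suc.prems True by (intro Suc.prems(5)) auto
      qed
    next
      case False
      have n: "nxt i \<in> I" "X i + r \<le> X (nxt i)" "X i < X (nxt i)" "X (nxt i) \<le> X i + g"
        using Suc.prems(2) nxt nxt_ge by auto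
      have "P i = P (nxt i)" using n False Suc.prems by (intro Suc.prems(5)) auto
      also have "\<dots> = P j"
        using n False Suc.prems(1-4) by (intro Suc.IH Suc.prems(5)) (auto simp: algebra_simps)
      finally show ?thesis .
    qed
  qed
qed

text \<open>Beyond \<open>X\<close>-distance \<open>M\<close> the \<open>Y\<close>-values differ by
  more than any step can change, so moving either end point along a path by \<open>chain\<close>
  never reverses their order.\<close>

lemma orientation:
  obtains M b where "0 < M"
    "\<And>i j. i \<in> I \<Longrightarrow> j \<in> I \<Longrightarrow> M < X j - X i \<Longrightarrow> (Y i < Y j \<longleftrightarrow> b) \<and> Y i \<noteq> Y j"
proof -
  obtain M where M: "0 < M"
    "\<And>i k. i \<in> I \<Longrightarrow> k \<in> I \<Longrightarrow> \<bar>Y i - Y k\<bar> \<le> \<bar>step_bound\<bar> \<Longrightarrow> \<bar>X i - X k\<bar> \<le> M"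
    using Y_close_imp_X_close[of "\<bar>step_bound\<bar>"] by blast
  have far: "\<bar>step_bound\<bar> < \<bar>Y i - Y j\<bar>" if "i \<in> I" "j \<in> I" "M < X j - X i" for i j
    using M(2)[OF that(1,2)] that(3) by force
  have up: "(Y i < Y j) = (Y i < Y k)"
    if "i \<in> I" "j \<in> I" "k \<in> I" "M < X j - X i" "X j \<le> X k" for i j k
  proof (rule chain)
    fix a b assume ab: "a \<in> I" "b \<in> I" "X j \<le> X a" "X a < X b" "X b \<le> X a + g"
    have "\<bar>Y a - Y b\<bar> \<le> step_bound" using ab by (intro Y_step) auto
    moreover have "\<bar>step_bound\<bar> < \<bar>Y i - Y a\<bar>" "\<bar>step_bound\<bar> < \<bar>Y i - Y b\<bar>"
      using ab that by (auto intro!: far)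
    ultimately show "(Y i < Y a) = (Y i < Y b)" by linarith
  qed (use that in auto)
  have down: "(Y i < Y k) = (Y j < Y k)"
    if "i \<in> I" "j \<in> I" "k \<in> I" "M < X k - X j" "X i \<le> X j" for i j k
  proof (rule chain)
    fix a b assume ab: "a \<in> I" "b \<in> I" "X b \<le> X j" "X a < X b" "X b \<le> X a + g"
    have "\<bar>Y a - Y b\<bar> \<le> step_bound" using ab by (intro Y_step) auto
    moreover have "\<bar>step_bound\<bar> < \<bar>Y a - Y k\<bar>" "\<bar>step_bound\<bar> < \<bar>Y b - Y k\<bar>"
      using ab that by (auto intro!: far)
    ultimately show "(Y a < Y k) = (Y b < Y k)" by linarith
  qed (use that in auto)
  have same: "(Y i < Y j) = (Y i' < Y j')"
    if ij: "i \<in> I" "j \<in> I" "M < X j - X i" "i' \<in> I" "j' \<in> I" "M < X j' - X i'" for i j i' j'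
  proof -
    \<comment> \<open>A common right end point far beyond all four points, through which the two
      pairs are compared.\<close>
    obtain k where k: "k \<in> I" "\<bar>X j\<bar> + \<bar>X j'\<bar> + \<bar>X i\<bar> + \<bar>X i'\<bar> + M < X k"
      using unbounded[OF ij(1)] by blast
    have "(Y i < Y j) = (Y i < Y k)" using ij k M(1) by (intro up) auto
    also have "\<dots> = (Y i' < Y k)"
    proof (cases "X i \<le> X i'")
      case True
      then show ?thesis using ij k M(1) by (intro down) auto
    next
      case False
      then show ?thesis using ij k M(1) by (intro down[symmetric]) auto
    qed
    also have "\<dots> = (Y i' < Y j')" using ij k M(1) by (intro up[symmetric]) auto
    finally show ?thesis .
  qed
  define b where "b \<longleftrightarrow> (\<exists>i\<in>I. \<exists>j\<in>I. M < X j - X i \<and> Y i < Y j)"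
  have "(Y i < Y j \<longleftrightarrow> b) \<and> Y i \<noteq> Y j" if "i \<in> I" "j \<in> I" "M < X j - X i" for i j
  proof
    show "Y i < Y j \<longleftrightarrow> b"
    proof
      assume "Y i < Y j"
      then show b unfolding b_def using that by blast
    next
      assume b
      then obtain i' j' where "i' \<in> I" "j' \<in> I" "M < X j' - X i'" "Y i' < Y j'"
        unfolding b_def by blast
      then show "Y i < Y j" using same[OF that] by simp
    qed
    show "Y i \<noteq> Y j" using far[OF that] by auto
  qed
  with M(1) that show ?thesis by blast
qed

end

section \<open>Asymptotic slope\<close>

text \<open>Turns two one-sided comparisons into a relative error of \<open>8 * d\<close>; the bound
  \<open>d \<le> 1/8\<close> absorbs the quadratic terms.\<close>

lemma squeeze_ratio:
  fixes d u w :: real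
  assumes "0 < d" "d \<le> 1/8" "0 \<le> w"
    and "(1 - d) * u \<le> (1 + d) * ((1 + d) * w)"
    and "(1 - d) * ((1 - d) * w) \<le> (1 + d) * u"
  shows "\<bar>u - w\<bar> \<le> 8 * d * w"
proof -
  have dd: "d * d \<le> d * (1/8)" using assms by (intro mult_left_mono) auto
  have "(1 + d) * (1 + d) \<le> (1 - d) * (1 + 8 * d)"
    using dd assms(1) by (simp add: algebra_simps)
  then have "(1 + d) * (1 + d) * w \<le> (1 - d) * (1 + 8 * d) * w"
    using assms(3) by (rule mult_right_mono)
  with assms(4) have "(1 - d) * u \<le> (1 - d) * ((1 + 8 * d) * w)" by (simp only: mult.assoc)
  then have up: "u \<le> (1 + 8 * d) * w" using assms by (subst (asm) mult_le_cancel_left_pos) auto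
  have "(1 + d) * (1 - 8 * d) \<le> (1 - d) * (1 - d)"
    using dd assms(1) by (simp add: algebra_simps)
  then have "(1 + d) * (1 - 8 * d) * w \<le> (1 - d) * (1 - d) * w"
    using assms(3) by (rule mult_right_mono)
  with assms(5) have "(1 + d) * ((1 - 8 * d) * w) \<le> (1 + d) * u" by (simp only: mult.assoc)
  then have "(1 - 8 * d) * w \<le> u" using assms by (subst (asm) mult_le_cancel_left_pos) auto
  with up show ?thesis by (simp add: algebra_simps abs_le_iff)
qed

section \<open>Limit points on the torus\<close>

lemma cmod_cis_diff: "cmod (cis (2 * pi * a) - cis (2 * pi * b)) = 2 * \<bar>sin (pi * (a - b))\<bar>"
proof -
  have "(cmod (cis (2 * pi * a) - cis (2 * pi * b)))\<^sup>2
      = (cos (2 * pi * a) - cos (2 * pi * b))\<^sup>2 + (sin (2 * pi * a) - sin (2 * pi * b))\<^sup>2"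
    by (simp add: cmod_power2)
  also have "\<dots> = ((cos (2 * pi * a))\<^sup>2 + (sin (2 * pi * a))\<^sup>2) + ((cos (2 * pi * b))\<^sup>2 + (sin (2 * pi * b))\<^sup>2)
      - 2 * (cos (2 * pi * a) * cos (2 * pi * b) + sin (2 * pi * a) * sin (2 * pi * b))"
    by (simp add: power2_eq_square algebra_simps)
  also have "\<dots> = 2 - 2 * cos (2 * pi * a - 2 * pi * b)"
    by (simp add: cos_diff)
  also have "2 * pi * a - 2 * pi * b = 2 * (pi * (a - b))" by (simp add: algebra_simps)
  also have "2 - 2 * cos (2 * (pi * (a - b))) = (2 * \<bar>sin (pi * (a - b))\<bar>)\<^sup>2"
    by (simp only: cos_double_sin power_mult_distrib power2_abs) simp
  finally show ?thesis by (rule power2_eq_imp_eq) auto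
qed

lemma sin_sum_diff: "sin (pi * (x + y)) * sin (pi * (x - y)) = (sin (pi * x))\<^sup>2 - (sin (pi * y))\<^sup>2"
proof -
  have "sin (pi * (x + y)) * sin (pi * (x - y))
      = (sin (pi * x))\<^sup>2 * (cos (pi * y))\<^sup>2 - (cos (pi * x))\<^sup>2 * (sin (pi * y))\<^sup>2"
    by (simp add: distrib_left right_diff_distrib sin_add sin_diff power2_eq_square algebra_simps)
  then show ?thesis by (simp add: cos_squared_eq algebra_simps)
qed

text \<open>Along a subsequence, the pairs \<open>(p, q)\<close> at \<open>n\<close> and
  \<open>n + 1\<close> converge to limits with \<open>qa \<noteq> qb\<close>. Every point agrees
  with each limit in one coordinate; applied to points approaching the second limit, this gives
  \<open>pa = pb\<close>. A point with another \<open>p\<close>-value would need both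
  \<open>qa\<close> and \<open>qb\<close> as its \<open>q\<close>-value.\<close>

lemma torus_alternative_aux:
  fixes p q :: "'i \<Rightarrow> complex" and a :: "nat \<Rightarrow> 'i"
  assumes bdd: "\<And>i. cmod (p i) \<le> 1" "\<And>i. cmod (q i) \<le> 1"
    and a: "\<And>n. a n \<in> I"
    and lim: "\<And>i. i \<in> I \<Longrightarrow> (\<lambda>n. (p (a n) - p i) * (q (a n) - q i)) \<longlonglongrightarrow> 0"
    and not: "\<not> (\<lambda>n. q (a (Suc n)) - q (a n)) \<longlonglongrightarrow> 0"
  shows "\<forall>i\<in>I. \<forall>j\<in>I. p i = p j"
proof -
  obtain e where e: "0 < e" "\<And>N. \<exists>n\<ge>N. e \<le> cmod (q (a (Suc n)) - q (a n))"
    using not unfolding LIMSEQ_iff by (auto simp: not_less)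
  have "infinite {n. e \<le> cmod (q (a (Suc n)) - q (a n))}"
    unfolding infinite_nat_iff_unbounded_le using e(2) by blast
  from infinite_enumerate[OF this] obtain s :: "nat \<Rightarrow> nat"
    where s: "strict_mono s" "\<And>n. e \<le> cmod (q (a (Suc (s n))) - q (a (s n)))"
    by blast
  \<comment> \<open>Four bounded sequences packed into one, so that a single subsequence serves all
    of them.\<close>
  define z where "z n = ((p (a (s n)), q (a (s n))), (p (a (Suc (s n))), q (a (Suc (s n)))))" for n
  have "norm (z n) \<le> 4" for n
  proof -
    have "norm (z n) \<le> norm (p (a (s n)), q (a (s n))) + norm (p (a (Suc (s n))), q (a (Suc (s n))))"
      unfolding z_def by (rule norm_Pair_le)
    also have "\<dots> \<le> (cmod (p (a (s n))) + cmod (q (a (s n)))) + (cmod (p (a (Suc (s n)))) + cmod (q (a (Suc (s n)))))"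
      by (intro add_mono norm_Pair_le)
    also have "\<dots> \<le> (1 + 1) + (1 + 1)" by (intro add_mono bdd)
    finally show ?thesis by simp
  qed
  then have "bounded (range z)" by (auto simp: bounded_iff)
  then obtain l t where l: "strict_mono t" "(z \<circ> t) \<longlonglongrightarrow> l"
    using bounded_imp_convergent_subsequence by blast
  obtain pa qa pb qb where l_eq: "l = ((pa, qa), (pb, qb))" by (metis surj_pair)
  define u where "u = s \<circ> t"
  have u: "strict_mono u" using s l by (auto simp: u_def intro: strict_mono_o)
  have L: "(\<lambda>n. p (a (u n))) \<longlonglongrightarrow> pa" "(\<lambda>n. q (a (u n))) \<longlonglongrightarrow> qa"
    "(\<lambda>n. p (a (Suc (u n)))) \<longlonglongrightarrow> pb" "(\<lambda>n. q (a (Suc (u n)))) \<longlonglongrightarrow> qb"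
    using tendsto_fst[OF tendsto_fst[OF l(2)]] tendsto_snd[OF tendsto_fst[OF l(2)]]
      tendsto_fst[OF tendsto_snd[OF l(2)]] tendsto_snd[OF tendsto_snd[OF l(2)]]
    by (simp_all add: z_def u_def l_eq)
  have "e \<le> cmod (qb - qa)"
    by (rule Lim_bounded2[OF tendsto_norm[OF tendsto_diff[OF L(4) L(2)]], of 0])
       (auto simp: u_def intro: s(2))
  then have ne: "qa \<noteq> qb" using e(1) by auto
  have A: "(pa - p i) * (qa - q i) = 0" if "i \<in> I" for i
  proof (rule LIMSEQ_unique)
    show "(\<lambda>n. (p (a (u n)) - p i) * (q (a (u n)) - q i)) \<longlonglongrightarrow> 0"
      using LIMSEQ_subseq_LIMSEQ[OF lim[OF that] u] by (simp add: o_def)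
  qed (intro tendsto_mult tendsto_diff tendsto_const L)
  have B: "(pb - p i) * (qb - q i) = 0" if "i \<in> I" for i
  proof (rule LIMSEQ_unique)
    have "strict_mono (\<lambda>n. Suc (u n))" using u by (simp add: strict_mono_def)
    from LIMSEQ_subseq_LIMSEQ[OF lim[OF that] this]
    show "(\<lambda>n. (p (a (Suc (u n))) - p i) * (q (a (Suc (u n))) - q i)) \<longlonglongrightarrow> 0"
      by (simp add: o_def)
  qed (intro tendsto_mult tendsto_diff tendsto_const L)
  \<comment> \<open>The alternative \<open>A\<close> at members of the sequence itself, followed by
    passage to the limit, relates the two limit points.\<close>
  have "(\<lambda>n. (pa - p (a (Suc (u n)))) * (qa - q (a (Suc (u n))))) \<longlonglongrightarrow> (pa - pb) * (qa - qb)"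
    by (intro tendsto_mult tendsto_diff tendsto_const L)
  then have "(\<lambda>n::nat. 0) \<longlonglongrightarrow> (pa - pb) * (qa - qb)" by (simp only: A a)
  then have "(pa - pb) * (qa - qb) = 0" by (rule LIMSEQ_unique[OF _ tendsto_const])
  then have "pa = pb" using ne by simp
  have "p i = pa" if "i \<in> I" for i
  proof -
    have "pa = p i \<or> qa = q i" "pb = p i \<or> qb = q i" using A[OF that] B[OF that] by simp_all
    then show ?thesis using ne \<open>pa = pb\<close> by metis
  qed
  then show ?thesis by simp
qed

lemma torus_alternative:
  fixes p q :: "'i \<Rightarrow> complex" and a :: "nat \<Rightarrow> 'i"
  assumes bdd: "\<And>i. cmod (p i) \<le> 1" "\<And>i. cmod (q i) \<le> 1"
    and a: "\<And>n. a n \<in> I"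
    and lim: "\<And>i. i \<in> I \<Longrightarrow> (\<lambda>n. (p (a n) - p i) * (q (a n) - q i)) \<longlonglongrightarrow> 0"
  obtains "\<forall>i\<in>I. \<forall>j\<in>I. p i = p j" | "\<forall>i\<in>I. \<forall>j\<in>I. q i = q j"
  | "(\<lambda>n. p (a (Suc n)) - p (a n)) \<longlonglongrightarrow> 0" "(\<lambda>n. q (a (Suc n)) - q (a n)) \<longlonglongrightarrow> 0"
proof -
  have lim': "(\<lambda>n. (q (a n) - q i) * (p (a n) - p i)) \<longlonglongrightarrow> 0" if "i \<in> I" for i
    using lim[OF that] by (simp only: mult.commute)
  show ?thesis
    using torus_alternative_aux[OF bdd a lim] torus_alternative_aux[OF bdd(2) bdd(1) a lim'] that
    by blast
qed

text \<open>On a nonempty compact set, \<open>h\<close> has a positive minimum, which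
  \<open>h (z n)\<close> eventually undercuts.\<close>

lemma eventually_notin_compact:
  fixes h :: "'a::metric_space \<Rightarrow> real" and z :: "nat \<Rightarrow> 'a"
  assumes "compact S" "continuous_on S h" "\<And>x. x \<in> S \<Longrightarrow> 0 < h x" "(\<lambda>n. h (z n)) \<longlonglongrightarrow> 0"
  shows "eventually (\<lambda>n. z n \<notin> S) sequentially"
proof (cases "S = {}")
  case False
  then obtain x where x: "x \<in> S" "\<And>y. y \<in> S \<Longrightarrow> h x \<le> h y"
    using continuous_attains_inf[OF assms(1) _ assms(2)] by blast
  have "eventually (\<lambda>n. h (z n) < h x) sequentially"
    using order_tendstoD(2)[OF assms(4)] assms(3)[OF x(1)] by blast
  then show ?thesis by eventually_elim (use x(2) in force)
qed simp

section \<open>Points along an increasing curve\<close>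

locale oriented_biframe = stepped_biframe +
  fixes M :: real
  assumes M_pos: "0 < M"
    and oriented: "\<And>i j. i \<in> I \<Longrightarrow> j \<in> I \<Longrightarrow> M < X j - X i \<Longrightarrow> Y i < Y j"
begin

text \<open>The points with \<open>Y\<close>-value between \<open>Y i\<close> and \<open>Y j\<close>
  are counted twice. Their number follows the density of \<open>Y\<close>; by orientation, they also
  fill the \<open>X\<close>-interval up to margins of bounded length. Equating the counts gives
  \<open>y / p2\<close> close to \<open>x / p1\<close>.\<close>

lemma ratio:
  assumes i: "i \<in> I" and e: "0 < e"
  obtains B where "0 < B"
    "\<And>j. j \<in> I \<Longrightarrow> B \<le> X j - X i \<Longrightarrow> \<bar>p1 * (Y j - Y i) - p2 * (X j - X i)\<bar> \<le> e * (p2 * (X j - X i))"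
proof -
  define d where "d = min (e / 8) (1 / 8)"
  have d: "0 < d" "d \<le> 1/8" "8 * d \<le> e" using e by (auto simp: d_def)
  have d1: "0 < d / p1" "0 < d / p2" using d p p1_pos by auto
  obtain R1 where R1: "0 < R1" "\<And>a b. R1 \<le> b - a \<Longrightarrow>
      nsinc_mass * real (card {i \<in> I. a \<le> X i \<and> X i \<le> b}) \<le> (1 / p1 + d / p1) * (b - a)"
    using X.density_upper[OF d1(1)] by blast
  obtain R2 where R2: "0 < R2" "\<And>a b. R2 \<le> b - a \<Longrightarrow>
      (1 / p1 - d / p1) * (b - a) \<le> nsinc_mass * real (card {i \<in> I. a \<le> X i \<and> X i \<le> b})"
    using X.density_lower[OF d1(1)] by blast
  obtain R3 where R3: "0 < R3" "\<And>a b. R3 \<le> b - a \<Longrightarrow>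
      nsinc_mass * real (card {i \<in> I. a \<le> Y i \<and> Y i \<le> b}) \<le> (1 / p2 + d / p2) * (b - a)"
    using Y.density_upper[OF d1(2)] by blast
  obtain R4 where R4: "0 < R4" "\<And>a b. R4 \<le> b - a \<Longrightarrow>
      (1 / p2 - d / p2) * (b - a) \<le> nsinc_mass * real (card {i \<in> I. a \<le> Y i \<and> Y i \<le> b})"
    using Y.density_lower[OF d1(2)] by blast
  obtain M' where M': "0 < M'"
    "\<And>i k. i \<in> I \<Longrightarrow> k \<in> I \<Longrightarrow> \<bar>Y i - Y k\<bar> \<le> R3 + R4 \<Longrightarrow> \<bar>X i - X k\<bar> \<le> M'"
    using Y_close_imp_X_close[of "R3 + R4"] by blast
  \<comment> \<open>The summand \<open>M'\<close> makes the \<open>Y\<close>-distance exceed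
    \<open>R3\<close> and \<open>R4\<close>, so that the \<open>Y\<close>-densities apply; the last
    one makes the margins at most \<open>d * x\<close>.\<close>
  define B where "B = 2 * M + 3 + R1 + R2 + M' + (2 * M + 2) / d"
  have Md: "0 < (2 * M + 2) / d" using d M_pos by simp
  have "\<bar>p1 * (Y j - Y i) - p2 * (X j - X i)\<bar> \<le> e * (p2 * (X j - X i))"
    if j: "j \<in> I" and far: "B \<le> X j - X i" for j
  proof -
    define x y where "x = X j - X i" and "y = Y j - Y i"
    have x: "2 * M + 3 \<le> x" "R1 \<le> x" "R2 + 2 * M + 2 \<le> x" "M' < x" "(2 * M + 2) / d \<le> x"
      using far M_pos R1(1) R2(1) M'(1) Md unfolding B_def x_def by linarith+
    have y0: "0 < y" using oriented[OF i j] x M_pos unfolding x_def y_def by linarith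
    have y: "R3 \<le> y" "R4 \<le> y"
      using M'(2)[OF i j] x(4) y0 R3(1) R4(1) unfolding x_def y_def by force+
    let ?N = "{k \<in> I. Y i \<le> Y k \<and> Y k \<le> Y j}"
    have upper: "nsinc_mass * real (card ?N) \<le> (1 / p1 + d / p1) * (x + 2 * M)"
    proof -
      have "?N \<subseteq> {k \<in> I. X i - M \<le> X k \<and> X k \<le> X j + M}"
        using oriented[OF _ i] oriented[OF j] by fastforce
      then have "nsinc_mass * real (card ?N) \<le> nsinc_mass * real (card {k \<in> I. X i - M \<le> X k \<and> X k \<le> X j + M})"
        using nsinc_mass_pos by (intro mult_left_mono) (auto intro!: card_mono X.finite_interval)
      also have "\<dots> \<le> (1 / p1 + d / p1) * (X j + M - (X i - M))"
        using x M_pos by (intro R1) (auto simp: x_def)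
      finally show ?thesis by (simp add: x_def algebra_simps)
    qed
    \<comment> \<open>The margin \<open>M + 1\<close> instead of \<open>M\<close> supplies the
      strict inequality that \<open>oriented\<close> demands.\<close>
    have lower: "(1 / p1 - d / p1) * (x - (2 * M + 2)) \<le> nsinc_mass * real (card ?N)"
    proof -
      have "(1 / p1 - d / p1) * (X j - M - 1 - (X i + M + 1))
          \<le> nsinc_mass * real (card {k \<in> I. X i + M + 1 \<le> X k \<and> X k \<le> X j - M - 1})"
        using x by (intro R2) (auto simp: x_def)
      also have "{k \<in> I. X i + M + 1 \<le> X k \<and> X k \<le> X j - M - 1} \<subseteq> ?N"
      proof safe
        fix k assume "k \<in> I" "X i + M + 1 \<le> X k" "X k \<le> X j - M - 1"
        then show "Y i \<le> Y k" "Y k \<le> Y j" using oriented[OF i, of k] oriented[OF _ j, of k] by linarith+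
      qed
      then have "nsinc_mass * real (card {k \<in> I. X i + M + 1 \<le> X k \<and> X k \<le> X j - M - 1}) \<le> nsinc_mass * real (card ?N)"
        using nsinc_mass_pos by (intro mult_left_mono) (auto intro!: card_mono Y.finite_interval)
      finally show ?thesis by (simp add: x_def algebra_simps)
    qed
    have Yupper: "nsinc_mass * real (card ?N) \<le> (1 / p2 + d / p2) * y"
      using R3(2)[of "Y j" "Y i"] y by (simp add: y_def)
    have Ylower: "(1 / p2 - d / p2) * y \<le> nsinc_mass * real (card ?N)"
      using R4(2)[of "Y j" "Y i"] y by (simp add: y_def)
    have "2 * M + 2 \<le> x * d" using x(5) d by (simp only: pos_divide_le_eq)
    then have Mx: "2 * M \<le> d * x" "2 * M + 2 \<le> d * x" by (auto simp: mult.commute)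
    have "\<bar>y / p2 - x / p1\<bar> \<le> 8 * d * (x / p1)"
    proof (rule squeeze_ratio)
      have "(1 - d) * (y / p2) = (1 / p2 - d / p2) * y" using p by (simp add: field_simps)
      also have "\<dots> \<le> (1 / p1 + d / p1) * (x + 2 * M)" using Ylower upper by linarith
      also have "\<dots> \<le> (1 / p1 + d / p1) * (x + d * x)"
        using Mx d1 p1_pos by (intro mult_left_mono add_left_mono) (auto intro: add_nonneg_nonneg)
      also have "\<dots> = (1 + d) * ((1 + d) * (x / p1))" using p1_pos by (simp add: field_simps)
      finally show "(1 - d) * (y / p2) \<le> (1 + d) * ((1 + d) * (x / p1))" .
      have "(1 - d) * ((1 - d) * (x / p1)) = (1 / p1 - d / p1) * (x - d * x)"
        using p1_pos by (simp add: field_simps)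
      also have "\<dots> \<le> (1 / p1 - d / p1) * (x - (2 * M + 2))"
        using Mx d p1_pos by (intro mult_left_mono diff_left_mono) (auto simp: divide_right_mono)
      also have "\<dots> \<le> (1 / p2 + d / p2) * y" using Yupper lower by linarith
      also have "\<dots> = (1 + d) * (y / p2)" using p by (simp add: field_simps)
      finally show "(1 - d) * ((1 - d) * (x / p1)) \<le> (1 + d) * (y / p2)" .
    qed (use d x M_pos p1_pos in auto)
    then have "(p1 * p2) * \<bar>y / p2 - x / p1\<bar> \<le> (p1 * p2) * (8 * d * (x / p1))"
      using p p1_pos by (intro mult_left_mono) auto
    also have "\<dots> = (8 * d) * (p2 * x)" using p1_pos by simp
    also have "\<dots> \<le> e * (p2 * x)" using d p x M_pos by (intro mult_right_mono) auto
    also have "(p1 * p2) * \<bar>y / p2 - x / p1\<bar> = \<bar>(p1 * p2) * (y / p2 - x / p1)\<bar>"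
      using p p1_pos by (simp add: abs_mult)
    also have "(p1 * p2) * (y / p2 - x / p1) = p1 * y - p2 * x"
      using p p1_pos by (simp add: field_simps)
    finally show ?thesis by (simp add: x_def y_def)
  qed
  moreover have "0 < B" unfolding B_def using M_pos R1 R2 M' Md by linarith
  ultimately show ?thesis using that by blast
qed

text \<open>The product equals \<open>(sin (pi * x))\<^sup>2 - (sin (pi * y))\<^sup>2\<close>. By
  \<open>sin_ratio\<close> the two sines differ in modulus by the factor
  \<open>\<rho> = p1 * y / (p2 * x)\<close>, which \<open>ratio\<close> keeps close to 1.\<close>

lemma sin_product_small:
  assumes i: "i \<in> I" and e: "0 < e"
  obtains B where "0 < B"
    "\<And>j. j \<in> I \<Longrightarrow> B \<le> X j - X i \<Longrightarrow>
       \<bar>sin (pi * ((X j + Y j) - (X i + Y i))) * sin (pi * ((X j - Y j) - (X i - Y i)))\<bar> \<le> e"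
proof -
  define d where "d = min 1 (e / 3)"
  have d: "0 < d" "d \<le> 1" "3 * d \<le> e" using e by (auto simp: d_def)
  obtain B where B: "0 < B"
    "\<And>j. j \<in> I \<Longrightarrow> B \<le> X j - X i \<Longrightarrow> \<bar>p1 * (Y j - Y i) - p2 * (X j - X i)\<bar> \<le> d * (p2 * (X j - X i))"
    using ratio[OF i d(1)] by blast
  have "\<bar>sin (pi * ((X j + Y j) - (X i + Y i))) * sin (pi * ((X j - Y j) - (X i - Y i)))\<bar> \<le> e"
    if j: "j \<in> I" and far: "B \<le> X j - X i" for j
  proof -
    define x y where "x = X j - X i" and "y = Y j - Y i"
    have x: "0 < x" using far B(1) by (simp add: x_def)
    define \<rho> where "\<rho> = p1 * y / (p2 * x)"
    have "\<bar>p1 * y - p2 * x\<bar> \<le> d * (p2 * x)" using B(2)[OF j far] by (simp add: x_def y_def)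
    moreover have "p1 * y - p2 * x = (\<rho> - 1) * (p2 * x)"
      using p x by (simp add: \<rho>_def field_simps)
    ultimately have "\<bar>\<rho> - 1\<bar> * (p2 * x) \<le> d * (p2 * x)" using p x by (simp add: abs_mult)
    then have \<rho>: "\<bar>\<rho> - 1\<bar> \<le> d" using p x by simp
    have "p2 * x * \<bar>sin (pi * y)\<bar> = p1 * \<bar>y\<bar> * \<bar>sin (pi * x)\<bar>"
      using sin_ratio[OF j i] x by (auto simp: x_def y_def)
    then have "\<bar>sin (pi * y)\<bar> = \<bar>\<rho>\<bar> * \<bar>sin (pi * x)\<bar>"
      using p p1_pos x by (simp add: \<rho>_def abs_mult field_simps)
    then have "(sin (pi * y))\<^sup>2 = \<rho>\<^sup>2 * (sin (pi * x))\<^sup>2"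
      by (metis abs_mult power2_abs power_mult_distrib)
    then have "(sin (pi * x))\<^sup>2 - (sin (pi * y))\<^sup>2 = ((1 - \<rho>) * (1 + \<rho>)) * (sin (pi * x))\<^sup>2"
      by (simp add: power2_eq_square algebra_simps)
    then have "\<bar>(sin (pi * x))\<^sup>2 - (sin (pi * y))\<^sup>2\<bar> = \<bar>(1 - \<rho>) * (1 + \<rho>)\<bar> * (sin (pi * x))\<^sup>2"
      by (simp add: abs_mult)
    also have "\<dots> \<le> \<bar>(1 - \<rho>) * (1 + \<rho>)\<bar> * 1"
      by (intro mult_left_mono) (auto simp: abs_square_le_1)
    also have "\<dots> \<le> d * 3"
    proof -
      have "\<bar>1 - \<rho>\<bar> \<le> d" "\<bar>1 + \<rho>\<bar> \<le> 3" using \<rho> d by linarith+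
      then have "\<bar>1 - \<rho>\<bar> * \<bar>1 + \<rho>\<bar> \<le> d * 3" using d by (intro mult_mono) auto
      then show ?thesis by (simp add: abs_mult)
    qed
    finally have "\<bar>sin (pi * (x + y)) * sin (pi * (x - y))\<bar> \<le> e" using d by (simp add: sin_sum_diff)
    then show ?thesis by (simp add: x_def y_def algebra_simps)
  qed
  with B(1) that show ?thesis by blast
qed

text \<open>For points more than \<open>M\<close> apart, \<open>sin_ratio\<close> leaves two
  options: equal values of \<open>L\<close>, or an integral \<open>X\<close>-difference. Two
  distinct values of \<open>L\<close> would force all distant points into one class of
  \<open>X\<close> modulo 1, but a step of \<open>nxt\<close> has length strictly between 0 and
  1.\<close>

lemma collinear_if_sines_agree:
  assumes agree: "\<And>i j. i \<in> I \<Longrightarrow> j \<in> I \<Longrightarrow> \<bar>sin (pi * (X i - X j))\<bar> = \<bar>sin (pi * (Y i - Y j))\<bar>"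
    and ij: "i \<in> I" "j \<in> I"
  shows "p1 * Y i - p2 * X i = p1 * Y j - p2 * X j"
proof (rule ccontr)
  define L where "L i = p1 * Y i - p2 * X i" for i
  assume "p1 * Y i - p2 * X i \<noteq> p1 * Y j - p2 * X j"
  then have Lij: "L i \<noteq> L j" by (simp add: L_def)
  have pair: "L b = L a \<or> X b - X a \<in> \<int>" if ab: "a \<in> I" "b \<in> I" "M < X b - X a" for a b
  proof (rule disjCI)
    assume "X b - X a \<notin> \<int>"
    then have "sin (pi * (X b - X a)) \<noteq> 0"
      using sin_times_pi_eq_0[of "X b - X a"] by (simp add: mult.commute)
    moreover have "a \<noteq> b" using ab M_pos by auto
    then have "p2 * \<bar>X b - X a\<bar> * \<bar>sin (pi * (X b - X a))\<bar> = p1 * \<bar>Y b - Y a\<bar> * \<bar>sin (pi * (X b - X a))\<bar>"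
      using sin_ratio[OF ab(2,1)] agree[OF ab(2,1)] by simp
    ultimately have "p2 * \<bar>X b - X a\<bar> = p1 * \<bar>Y b - Y a\<bar>" by simp
    moreover have "Y a < Y b" using oriented ab by blast
    ultimately show "L b = L a" using ab M_pos by (simp add: L_def algebra_simps)
  qed
  have nonint: "X (nxt k) - X k \<notin> \<int>" if "k \<in> I" for k
  proof
    assume "X (nxt k) - X k \<in> \<int>"
    moreover have "0 < X (nxt k) - X k" "X (nxt k) - X k < 1" using nxt(2,3)[OF that] g by auto
    ultimately show False by (auto elim!: Ints_cases)
  qed
  have no: False if k: "k \<in> I" and all: "\<And>l. l \<in> I \<Longrightarrow> B < X l \<Longrightarrow> X l - X k \<in> \<int>" for k B
  proof -
    obtain l where l: "l \<in> I" "B < X l" using unbounded[OF k] by blast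
    have "X (nxt l) - X k \<in> \<int>" using l nxt[OF l(1)] by (intro all) auto
    then have "(X (nxt l) - X k) - (X l - X k) \<in> \<int>" using all[OF l] by (rule Ints_diff)
    then show False using nonint[OF l(1)] by simp
  qed
  define B where "B = \<bar>X i\<bar> + \<bar>X j\<bar> + M"
  have fari: "L l = L i \<or> X l - X i \<in> \<int>" and farj: "L l = L j \<or> X l - X j \<in> \<int>"
    if "l \<in> I" "B < X l" for l
    using pair[OF ij(1) that(1)] pair[OF ij(2) that(1)] that(2) by (auto simp: B_def)
  show False
  proof (cases "X i - X j \<in> \<int>")
    case True
    have "X l - X i \<in> \<int>" if l: "l \<in> I" "B < X l" for l
    proof -
      have "X l - X j - (X i - X j) \<in> \<int>" if "X l - X j \<in> \<int>" using that True by (rule Ints_diff)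
      then show ?thesis using fari[OF l] farj[OF l] Lij by auto
    qed
    with no[OF ij(1)] show False by blast
  next
    case False
    show False
    proof (cases "\<exists>l\<in>I. B < X l \<and> L l = L i")
      case True
      then obtain l where l: "l \<in> I" "B < X l" "L l = L i" by blast
      then have lj: "X l - X j \<in> \<int>" using farj Lij by force
      have "X m - X j \<in> \<int>" if m: "m \<in> I" "X l + M < X m" for m
      proof -
        have Bm: "B < X m" using m l M_pos by linarith
        \<comment> \<open>Otherwise \<open>m\<close> has integral \<open>X\<close>-difference both
          to \<open>i\<close> and to \<open>l\<close>. As \<open>l\<close> has one to
          \<open>j\<close>, the difference of \<open>X i\<close> and \<open>X j\<close> would be
          integral too.\<close>
        have "L m = L i"
        proof (rule ccontr)
          assume ne: "L m \<noteq> L i"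
          then have Z: "X m - X i \<in> \<int>" "X m - X l \<in> \<int>"
            using fari[OF m(1) Bm] pair[OF l(1) m(1)] l(3) m(2) by auto
          then have "(X m - X l) + (X l - X j) - (X m - X i) \<in> \<int>"
            by (intro Ints_diff[OF Ints_add[OF Z(2) lj] Z(1)])
          then show False using \<open>X i - X j \<notin> \<int>\<close> by simp
        qed
        then show ?thesis using farj[OF m(1) Bm] Lij by auto
      qed
      with no[OF ij(2)] show False by blast
    next
      case False
      with no[OF ij(1)] fari show False by blast
    qed
  qed
qed

end

section \<open>Collinearity\<close>

context oriented_biframe
begin

text \<open>Vanishes exactly when the sum and the difference of the coordinates are both
  integers.\<close>

definition near_zero :: "real \<times> real \<Rightarrow> real" where
  "near_zero z = \<bar>sin (pi * (fst z + snd z))\<bar> + \<bar>sin (pi * (fst z - snd z))\<bar>"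

text \<open>Since \<open>2 * x\<close> is an integer strictly between 0 and 2,
  \<open>x = 1/2\<close>. Then \<open>y\<close> is half an odd integer, its sine has modulus 1, and
  the sinc relation becomes \<open>p1 * 2 * \<bar>y\<bar> = p2\<close>; as
  \<open>\<bar>y\<bar> \<ge> 1/2\<close> and \<open>p2 \<le> p1\<close>, equality holds
  throughout.\<close>

lemma near_zero_eq_0:
  assumes "r \<le> x" "x \<le> g" "p1 * \<bar>nsinc x\<bar> = p2 * \<bar>nsinc y\<bar>" "near_zero (x, y) \<le> 0"
  shows "x = 1/2" "\<bar>y\<bar> = 1/2" "p1 = p2"
proof -
  have "sin (pi * (x + y)) = 0" "sin (pi * (x - y)) = 0"
    using assms(4) by (auto simp: near_zero_def add_nonneg_eq_0_iff)
  then have Z: "x + y \<in> \<int>" "x - y \<in> \<int>"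
    using sin_times_pi_eq_0 by (metis mult.commute)+
  have x: "0 < x" "x < 1" using assms r g by auto
  have "(x + y) + (x - y) \<in> \<int>" using Z by (rule Ints_add)
  then obtain k where k: "(x + y) + (x - y) = of_int k" by (rule Ints_cases)
  with x have "0 < real_of_int k" "real_of_int k < 2" by linarith+
  then have "k = 1" by linarith
  then show x_half: "x = 1/2" using k by simp
  obtain m where m: "x + y = of_int m" using Z(1) by (rule Ints_cases)
  then have ym: "y = of_int m - 1/2" using x_half by simp
  then have y_ge: "1/2 \<le> \<bar>y\<bar>"
    by (cases "m \<le> 0") (auto simp: abs_if)
  have "sin (pi * y) = - cos (pi * of_int m)"
    by (simp add: ym right_diff_distrib sin_diff)
  moreover have "sin (pi * of_int m) = 0"
    using sin_times_pi_eq_0[of "of_int m"] by (simp add: mult.commute)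
  then have "(cos (pi * of_int m))\<^sup>2 = 1"
    using sin_cos_squared_add[of "pi * of_int m"] by simp
  then have "\<bar>cos (pi * of_int m)\<bar> = 1" by (auto simp: power2_eq_1_iff)
  ultimately have "\<bar>sin (pi * y)\<bar> = 1" by simp
  then have "pi * (\<bar>y\<bar> * \<bar>nsinc y\<bar>) = 1" by (simp add: sin_eq_nsinc abs_mult)
  moreover have s: "p2 * \<bar>nsinc y\<bar> = p1 * (2 / pi)"
    using assms(3) x_half by (simp add: nsinc_half)
  have "p2 * (pi * (\<bar>y\<bar> * \<bar>nsinc y\<bar>)) = pi * \<bar>y\<bar> * (p2 * \<bar>nsinc y\<bar>)" by simp
  then have "p2 * (pi * (\<bar>y\<bar> * \<bar>nsinc y\<bar>)) = p1 * 2 * \<bar>y\<bar>" unfolding s by simp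
  ultimately have e: "p1 * 2 * \<bar>y\<bar> = p2" by simp
  have "p1 * 2 * \<bar>y\<bar> \<ge> p1 * 2 * (1/2)" using y_ge p1_pos by (intro mult_left_mono) auto
  then show pp: "p1 = p2" using e p by simp
  then show "\<bar>y\<bar> = 1/2" using e p by simp
qed

text \<open>Compactness forces \<open>p1 = p2\<close> and steps tending to 1/2 in modulus. The sinc
  relation and the phase then make the steps eventually equal to (1/2, 1/2), so the orbit ends in an
  arithmetic progression with which every other point is compared.\<close>

lemma collinear_if_steps_vanish:
  fixes a :: "nat \<Rightarrow> 'a"
  assumes a: "\<And>n. a n \<in> I" "\<And>n. a (Suc n) = nxt (a n)"
    and lim: "(\<lambda>n. sin (pi * ((X (a (Suc n)) + Y (a (Suc n))) - (X (a n) + Y (a n))))) \<longlonglongrightarrow> 0"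
      "(\<lambda>n. sin (pi * ((X (a (Suc n)) - Y (a (Suc n))) - (X (a n) - Y (a n))))) \<longlonglongrightarrow> 0"
    and ij: "i \<in> I" "j \<in> I"
  shows "Y i - X i = Y j - X j"
proof -
  define x y where "x n = X (a (Suc n)) - X (a n)" and "y n = Y (a (Suc n)) - Y (a n)" for n
  have ne: "a (Suc n) \<noteq> a n" for n using nxt(2)[OF a(1)[of n]] a(2)[of n] by auto
  have xb: "r \<le> x n" "x n \<le> g" for n
    using nxt_ge[OF a(1)[of n]] nxt(3)[OF a(1)[of n]] by (auto simp: x_def a(2))
  have yb: "\<bar>y n\<bar> \<le> step_bound" for n
    unfolding y_def using xb[of n] r by (intro Y_step a) (auto simp: x_def)
  have xy: "p1 * \<bar>nsinc (x n)\<bar> = p2 * \<bar>nsinc (y n)\<bar>" for n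
    unfolding x_def y_def by (intro abs_orth a ne)
  have nz: "(\<lambda>n. near_zero (x n, y n)) \<longlonglongrightarrow> 0"
    using tendsto_add[OF tendsto_rabs[OF lim(1)] tendsto_rabs[OF lim(2)]]
    by (simp add: near_zero_def x_def y_def algebra_simps)
  \<comment> \<open>The admissible steps that stay at least \<open>e\<close> away from 1/2 in one of
    the moduli; \<open>K 0\<close> contains all steps.\<close>
  define K where "K e = ({r..g} \<times> {- step_bound..step_bound})
    \<inter> {z. p1 * \<bar>nsinc (fst z)\<bar> = p2 * \<bar>nsinc (snd z)\<bar>}
    \<inter> {z. e \<le> max \<bar>fst z - 1/2\<bar> \<bar>\<bar>snd z\<bar> - 1/2\<bar>}" for e :: real
  have K: "compact (K e)" for e
    unfolding K_def
    by (intro compact_Int_closed compact_Times compact_Icc closed_Collect_eq closed_Collect_le continuous_intros)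
  have cont: "continuous_on S near_zero" for S
    unfolding near_zero_def by (intro continuous_intros)
  have inK: "(x n, y n) \<in> K e \<longleftrightarrow> e \<le> max \<bar>x n - 1/2\<bar> \<bar>\<bar>y n\<bar> - 1/2\<bar>" for n e
  proof -
    have "(x n, y n) \<in> {r..g} \<times> {- step_bound..step_bound}"
      using xb[of n] yb[of n] by (simp add: abs_le_iff minus_le_iff)
    then show ?thesis unfolding K_def by (simp only: Int_iff mem_Collect_eq fst_conv snd_conv xy) simp
  qed
  have mem_K: "r \<le> fst z" "fst z \<le> g" "p1 * \<bar>nsinc (fst z)\<bar> = p2 * \<bar>nsinc (snd z)\<bar>"
    "e \<le> max \<bar>fst z - 1/2\<bar> \<bar>\<bar>snd z\<bar> - 1/2\<bar>" if "z \<in> K e" for z e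
    using that unfolding K_def by (simp_all only: Int_iff mem_Collect_eq mem_Times_iff atLeastAtMost_iff)
  have p_eq: "p1 = p2"
  proof (rule ccontr)
    assume "p1 \<noteq> p2"
    then have "0 < near_zero z" if "z \<in> K 0" for z
      using near_zero_eq_0(3)[OF mem_K(1,2,3)[OF that]] by (metis prod.collapse not_le)
    from eventually_notin_compact[OF K[of 0] cont this nz]
    have "eventually (\<lambda>n. False) sequentially" by (simp add: inK le_max_iff_disj)
    then show False by simp
  qed
  have near: "eventually (\<lambda>n. \<bar>x n - 1/2\<bar> < e \<and> \<bar>\<bar>y n\<bar> - 1/2\<bar> < e) sequentially" if e: "0 < e" for e
  proof -
    have "0 < near_zero z" if z: "z \<in> K e" for z
    proof (rule ccontr)
      assume "\<not> ?thesis"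
      then have "near_zero (fst z, snd z) \<le> 0" by simp
      from near_zero_eq_0(1,2)[OF mem_K(1,2,3)[OF z] this] mem_K(4)[OF z] e
      show False by simp
    qed
    from eventually_notin_compact[OF K[of e] cont this nz]
    show ?thesis by (simp add: inK not_le)
  qed
  define s where "s = \<bar>\<alpha> + \<beta>\<bar>"
  have s: "0 \<le> s" by (simp add: s_def)
  \<comment> \<open>The bound 1/10 controls sums of two consecutive steps; the other one makes an
    integer of modulus at most \<open>s * (2 * e)\<close> vanish.\<close>
  define e where "e = min (1/10) (1 / (4 * (s + 1)))"
  have e: "0 < e" "e \<le> 1/10" "s * (2 * e) < 1"
  proof -
    show "0 < e" "e \<le> 1/10" using s by (auto simp: e_def)
    have "e \<le> 1 / (4 * (s + 1))" by (simp add: e_def)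
    then have "e * (4 * (s + 1)) \<le> 1" using s by (subst (asm) pos_le_divide_eq) auto
    then show "s * (2 * e) < 1" using s \<open>0 < e\<close> by (simp add: algebra_simps)
  qed
  obtain N where N: "\<And>n. N \<le> n \<Longrightarrow> \<bar>x n - 1/2\<bar> < e" "\<And>n. N \<le> n \<Longrightarrow> \<bar>\<bar>y n\<bar> - 1/2\<bar> < e"
    using near[OF e(1)] by (auto simp: eventually_sequentially)
  have x_abs_y: "x n = \<bar>y n\<bar>" if n: "N \<le> n" for n
  proof -
    have b: "0 \<le> x n" "x n \<le> 1" "\<bar>y n\<bar> \<le> 1" using N(1,2)[OF n] e(2) by linarith+
    have "\<bar>nsinc (x n)\<bar> = \<bar>nsinc (y n)\<bar>" using xy[of n] p_eq p by simp
    moreover have "0 < nsinc (x n)" "0 < nsinc (y n)" using N(1,2)[OF n] e(2) by (auto intro!: nsinc_pos)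
    ultimately have "nsinc (x n) = nsinc \<bar>y n\<bar>" by simp
    then show ?thesis
      using nsinc_strict_decreasing[of "x n" "\<bar>y n\<bar>"] nsinc_strict_decreasing[of "\<bar>y n\<bar>" "x n"] b
      by (cases "x n" "\<bar>y n\<bar>" rule: linorder_cases) auto
  qed
  \<comment> \<open>Opposite signs would give a double step with \<open>x2\<close> near 1 and
    \<open>y2\<close> near 0, whose sincs cannot have equal modulus.\<close>
  have sign: "0 < y (Suc n) \<longleftrightarrow> 0 < y n" if n: "N \<le> n" for n
  proof (rule ccontr)
    assume opp: "\<not> ?thesis"
    define x2 y2 where "x2 = X (a (Suc (Suc n))) - X (a n)" and "y2 = Y (a (Suc (Suc n))) - Y (a n)"
    have x2: "8/10 \<le> x2"
      using N(1)[OF n] N(1)[of "Suc n"] n e(2) by (simp add: x2_def x_def)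
    have y2: "\<bar>y2\<bar> \<le> 1/2"
    proof -
      have "y2 = y (Suc n) + y n" by (simp add: y2_def y_def)
      then show ?thesis using N(2)[OF n] N(2)[of "Suc n"] n e(2) opp by linarith
    qed
    have "a (Suc (Suc n)) \<noteq> a n" using x2 by (auto simp: x2_def)
    then have "\<bar>nsinc x2\<bar> = \<bar>nsinc y2\<bar>"
      using abs_orth[OF a(1) a(1), of "Suc (Suc n)" n] p_eq p by (simp add: x2_def y2_def)
    moreover have "2 / pi \<le> \<bar>nsinc y2\<bar>"
      using nsinc_antimono[of y2 "1/2"] y2 by (simp add: nsinc_half)
    moreover have "\<bar>nsinc x2\<bar> < 2 / pi"
    proof -
      have "\<bar>nsinc x2\<bar> \<le> 1 / (pi * x2)" using abs_nsinc_le[of x2] x2 by simp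
      also have "\<dots> \<le> 1 / (pi * (8/10))" using x2 by (intro divide_left_mono mult_left_mono) auto
      also have "\<dots> < 2 / pi" by (simp add: field_simps)
      finally show ?thesis .
    qed
    ultimately show False by simp
  qed
  have y_pos: "0 < y n" if "N \<le> n" for n
  proof -
    \<comment> \<open>Otherwise \<open>Y\<close> would never rise along the orbit while
      \<open>X\<close> grows beyond \<open>M\<close>, against \<open>oriented\<close>.\<close>
    have "0 < y N"
    proof (rule ccontr)
      assume neg: "\<not> 0 < y N"
      have neg': "y (N + k) \<le> 0" for k
      proof (induction k)
        case (Suc k)
        then show ?case using sign[of "N + k"] by simp
      qed (use neg in simp)
      have dec: "Y (a (N + k)) \<le> Y (a N)" for k
      proof (induction k)
        case (Suc k)
        then show ?case using neg'[of k] by (simp add: y_def)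
      qed simp
      have inc: "real k * r \<le> X (a (N + k)) - X (a N)" for k
      proof (induction k)
        case (Suc k)
        then show ?case using xb(1)[of "N + k"] by (simp add: x_def algebra_simps)
      qed simp
      obtain k :: nat where "M / r < real k" using reals_Archimedean2 by blast
      then have "M < real k * r" using r by (simp add: field_simps)
      then have "M < X (a (N + k)) - X (a N)" using inc[of k] by linarith
      then show False using oriented[OF a(1) a(1), of "N + k" N] dec[of k] by force
    qed
    with that show ?thesis by (induction n rule: dec_induct) (auto simp: sign)
  qed
  have y_eq: "y n = x n" if "N \<le> n" for n using x_abs_y[OF that] y_pos[OF that] by simp
  have phase: "cis (2 * pi * ((\<alpha> + \<beta>) * x n)) = - 1" if n: "N \<le> n" for n
  proof -
    have "0 < nsinc (x n)" using N(1)[OF n] e(2) by (intro nsinc_pos) linarith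
    moreover have "(1 + cis (2 * pi * (\<alpha> * x n + \<beta> * x n))) * (p1 * nsinc (x n)) = 0"
    proof -
      have "p1 * nsinc (x n) + cis (2 * pi * (\<alpha> * x n + \<beta> * y n)) * (p2 * nsinc (y n)) = 0"
        using orth[OF a(1) a(1) ne[of n]] by (simp only: x_def y_def)
      then show ?thesis unfolding y_eq[OF n] p_eq by (simp add: distrib_right)
    qed
    ultimately have "1 + cis (2 * pi * (\<alpha> * x n + \<beta> * x n)) = 0"
      using p1_pos unfolding mult_eq_0_iff by simp
    then show ?thesis by (simp only: distrib_right add_eq_0_iff)
  qed
  \<comment> \<open>By \<open>phase\<close>, the product of \<open>\<alpha> + \<beta>\<close> and
    \<open>x n - x N\<close> is an integer, hence 0 by the choice of \<open>e\<close>; and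
    \<open>\<alpha> + \<beta> \<noteq> 0\<close>, because \<open>cis 0\<close> is not -1.\<close>
  have x_const: "x n = x N" if n: "N \<le> n" for n
  proof -
    have "cis (2 * pi * ((\<alpha> + \<beta>) * x n)) - cis (2 * pi * ((\<alpha> + \<beta>) * x N)) = 0"
      using phase[OF n] phase[of N] by simp
    then have "sin (pi * ((\<alpha> + \<beta>) * x n - (\<alpha> + \<beta>) * x N)) = 0"
      using cmod_cis_diff[of "(\<alpha> + \<beta>) * x n" "(\<alpha> + \<beta>) * x N"] by simp
    then have "(\<alpha> + \<beta>) * x n - (\<alpha> + \<beta>) * x N \<in> \<int>"
      using sin_times_pi_eq_0 by (metis mult.commute)
    then obtain k where k: "(\<alpha> + \<beta>) * (x n - x N) = of_int k"
      by (metis Ints_cases right_diff_distrib)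
    have "\<bar>(\<alpha> + \<beta>) * (x n - x N)\<bar> \<le> s * (2 * e)"
      unfolding abs_mult s_def using N(1)[OF n] N(1)[of N] by (intro mult_left_mono) auto
    then have "k = 0" using k e(3) by simp
    moreover have "\<alpha> + \<beta> \<noteq> 0"
    proof
      assume "\<alpha> + \<beta> = 0"
      then show False using phase[of N] by simp
    qed
    ultimately show ?thesis using k by simp
  qed
  have "x N = 1/2"
  proof (rule ccontr)
    assume "x N \<noteq> 1/2"
    then have "0 < \<bar>x N - 1/2\<bar>" by simp
    from near[OF this] obtain N' where "\<And>n. N' \<le> n \<Longrightarrow> \<bar>x n - 1/2\<bar> < \<bar>x N - 1/2\<bar>"
      unfolding eventually_sequentially by blast
    from this[of "max N N'"] x_const[of "max N N'"] show False by simp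
  qed
  then have steps: "x n = 1/2" "y n = 1/2" if "N \<le> n" for n
    using x_const[OF that] y_eq[OF that] by auto
  have prog: "X (a (N + k)) = X (a N) + real k / 2" "Y (a (N + k)) = Y (a N) + real k / 2" for k
  proof (induction k)
    case (Suc k)
    { case 1 then show ?case using Suc.IH(1) steps(1)[of "N + k"] by (simp add: x_def field_simps) }
    { case 2 then show ?case using Suc.IH(2) steps(2)[of "N + k"] by (simp add: y_def field_simps) }
  qed auto
  have "X (a N) - X k = Y (a N) - Y k" if k: "k \<in> I" for k
  proof -
    define u v where "u = X (a N) - X k" and "v = Y (a N) - Y k"
    obtain m :: nat where m: "\<bar>u\<bar> + \<bar>v\<bar> < real m" using reals_Archimedean2 by blast
    have rel: "(u + real n / 2) * \<bar>sin (pi * (v + real n / 2))\<bar> = (v + real n / 2) * \<bar>sin (pi * (u + real n / 2))\<bar>"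
      if n: "2 * m \<le> n" for n
    proof -
      have pos: "0 < u + real n / 2" "0 < v + real n / 2"
        using m n by (auto simp: abs_if split: if_splits)
      then have "a (N + n) \<noteq> k" using prog(1)[of n] by (auto simp: u_def)
      then show ?thesis
        using sin_ratio[OF a(1) k, of "N + n"] pos p_eq p by (simp add: prog u_def v_def algebra_simps)
    qed
    have even: "\<bar>sin (pi * (w + real (2 * l) / 2))\<bar> = \<bar>sin (pi * w)\<bar>" for w :: real and l :: nat
      by (simp add: distrib_left sin_add abs_mult)
    have odd: "\<bar>sin (pi * (w + real (2 * l + 1) / 2))\<bar> = \<bar>cos (pi * w)\<bar>" for w :: real and l :: nat
    proof -
      have "pi * (w + real (2 * l + 1) / 2) = (pi * w + pi / 2) + pi * real l" by (simp add: field_simps)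
      then have "\<bar>sin (pi * (w + real (2 * l + 1) / 2))\<bar> = \<bar>sin (pi * w + pi / 2)\<bar>"
        by (simp only: sin_add[of _ "pi * real l"]) (simp add: abs_mult)
      then show ?thesis by (simp add: sin_add)
    qed
    \<comment> \<open>Advancing the progression by two steps adds 1 to \<open>h\<close> and
      preserves the moduli of the sines. Subtracting the relations gives \<open>A = B\<close>, hence
      \<open>(u - v) * A = 0\<close>. Even and odd positions supply the sine and the cosine of
      \<open>pi * v\<close> for \<open>A\<close>, which are not both 0.\<close>
    have lin: "(u - v) * A = 0" if "(u + h) * A = (v + h) * B" "(u + h + 1) * A = (v + h + 1) * B" for A B h :: real
    proof -
      have "A = B" using that by (simp add: algebra_simps)
      with that(1) show ?thesis by (simp add: algebra_simps)
    qed
    have halves: "real (2 * m) / 2 = real m" "real (2 * Suc m) / 2 = real m + 1"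
      "real (2 * m + 1) / 2 = real m + 1/2" "real (2 * Suc m + 1) / 2 = real m + 1/2 + 1"
      by simp_all
    have "(u - v) * \<bar>sin (pi * v)\<bar> = 0"
      using rel[of "2 * m"] rel[of "2 * Suc m"] unfolding even unfolding halves add.assoc[symmetric]
      by (intro lin[of "real m" _ "\<bar>sin (pi * u)\<bar>"]) simp_all
    moreover have "(u - v) * \<bar>cos (pi * v)\<bar> = 0"
      using rel[of "2 * m + 1"] rel[of "2 * Suc m + 1"] unfolding odd unfolding halves add.assoc[symmetric]
      by (intro lin[of "real m + 1/2" _ "\<bar>cos (pi * u)\<bar>"]) (simp_all add: add.assoc)
    ultimately have "u = v"
      using sin_cos_squared_add[of "pi * v"] by (cases "u = v") auto
    then show ?thesis by (simp add: u_def v_def)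
  qed
  from this[OF ij(1)] this[OF ij(2)] show ?thesis by simp
qed

lemma collinear:
  obtains k where "\<And>i j. i \<in> I \<Longrightarrow> j \<in> I \<Longrightarrow> Y i - Y j = k * (X i - X j)"
proof (cases "I = {}")
  case False
  note * = that
  from False obtain i0 where i0: "i0 \<in> I" by blast
  define a where "a n = (nxt ^^ n) i0" for n
  have a: "\<And>n. a n \<in> I" "\<And>n. a (Suc n) = nxt (a n)"
    using funpow_nxt_in[OF i0] by (auto simp: a_def)
  \<comment> \<open>\<open>X + Y\<close> and \<open>X - Y\<close> modulo 1 as points of the unit
    circle; by \<open>PQ\<close>, their chord lengths are the sines estimated in
    \<open>sin_product_small\<close>.\<close>
  define P Q where "P i = cis (2 * pi * (X i + Y i))" and "Q i = cis (2 * pi * (X i - Y i))" for i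
  have PQ: "cmod (P i - P j) = 2 * \<bar>sin (pi * ((X i + Y i) - (X j + Y j)))\<bar>"
    "cmod (Q i - Q j) = 2 * \<bar>sin (pi * ((X i - Y i) - (X j - Y j)))\<bar>" for i j
    unfolding P_def Q_def by (rule cmod_cis_diff)+
  have lim: "(\<lambda>n. (P (a n) - P i) * (Q (a n) - Q i)) \<longlonglongrightarrow> 0" if i: "i \<in> I" for i
  proof (rule LIMSEQ_I)
    fix e :: real assume "0 < e"
    then have "0 < e / 8" by simp
    then obtain B where B: "\<And>j. j \<in> I \<Longrightarrow> B \<le> X j - X i \<Longrightarrow>
       \<bar>sin (pi * ((X j + Y j) - (X i + Y i))) * sin (pi * ((X j - Y j) - (X i - Y i)))\<bar> \<le> e / 8"
      using sin_product_small[OF i] by blast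
    obtain N :: nat where "(B + X i - X i0) / r < real N" using reals_Archimedean2 by blast
    then have N: "B + X i - X i0 < real N * r" using r by (simp add: field_simps)
    have "norm ((P (a n) - P i) * (Q (a n) - Q i) - 0) < e" if n: "N \<le> n" for n
    proof -
      have "real N * r \<le> real n * r" using n r by simp
      then have "B \<le> X (a n) - X i" using funpow_nxt_ge[OF i0, of n] N by (simp add: a_def)
      from B[OF a(1) this] \<open>0 < e\<close> show ?thesis by (simp add: norm_mult PQ abs_mult)
    qed
    then show "\<exists>N. \<forall>n\<ge>N. norm ((P (a n) - P i) * (Q (a n) - Q i) - 0) < e" by blast
  qed
  have agree: thesis
    if alt: "(\<forall>i\<in>I. \<forall>j\<in>I. P i = P j) \<or> (\<forall>i\<in>I. \<forall>j\<in>I. Q i = Q j)"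
  proof -
    have sines: "\<bar>sin (pi * (X i - X j))\<bar> = \<bar>sin (pi * (Y i - Y j))\<bar>" if ij: "i \<in> I" "j \<in> I" for i j
    proof -
      have "cmod (P i - P j) = 0 \<or> cmod (Q i - Q j) = 0"
        using alt ij by auto
      then have "sin (pi * ((X i - X j) + (Y i - Y j))) * sin (pi * ((X i - X j) - (Y i - Y j))) = 0"
        unfolding PQ by (auto simp: algebra_simps)
      then have "(sin (pi * (X i - X j)))\<^sup>2 = (sin (pi * (Y i - Y j)))\<^sup>2"
        by (simp add: sin_sum_diff)
      then show ?thesis by (simp add: power2_eq_iff abs_eq_iff)
    qed
    have "Y i - Y j = (p2 / p1) * (X i - X j)" if ij: "i \<in> I" "j \<in> I" for i j
    proof -
      have "p1 * Y i - p2 * X i = p1 * Y j - p2 * X j"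
        using sines ij by (rule collinear_if_sines_agree)
      then show ?thesis using p1_pos by (simp add: field_simps)
    qed
    then show thesis by (rule *)
  qed
  show ?thesis
  proof (rule torus_alternative[of P Q a I, OF _ _ a(1) lim])
    show "cmod (P i) \<le> 1" "cmod (Q i) \<le> 1" for i by (simp_all add: P_def Q_def)
    show thesis if "\<forall>i\<in>I. \<forall>j\<in>I. P i = P j" using that by (intro agree disjI1)
    show thesis if "\<forall>i\<in>I. \<forall>j\<in>I. Q i = Q j" using that by (intro agree disjI2)
  next
    assume l: "(\<lambda>n. P (a (Suc n)) - P (a n)) \<longlonglongrightarrow> 0" "(\<lambda>n. Q (a (Suc n)) - Q (a n)) \<longlonglongrightarrow> 0"
    have "(\<lambda>n. \<bar>sin (pi * ((X (a (Suc n)) + Y (a (Suc n))) - (X (a n) + Y (a n))))\<bar>) \<longlonglongrightarrow> 0"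
      "(\<lambda>n. \<bar>sin (pi * ((X (a (Suc n)) - Y (a (Suc n))) - (X (a n) - Y (a n))))\<bar>) \<longlonglongrightarrow> 0"
      using tendsto_mult_right_zero[OF tendsto_norm_zero[OF l(1)], of "1/2"]
        tendsto_mult_right_zero[OF tendsto_norm_zero[OF l(2)], of "1/2"]
      by (simp_all only: PQ) simp_all
    then have "Y i - X i = Y j - X j" if "i \<in> I" "j \<in> I" for i j
      unfolding tendsto_rabs_zero_iff by (rule collinear_if_steps_vanish[of a, OF a _ _ that])
    then show ?thesis by (intro *[of 1]) (simp add: algebra_simps)
  qed
qed (use that in blast)

end

text \<open>If \<open>Y\<close> decreases along \<open>X\<close>, the reflected frame is oriented,
  and the slope found for it changes sign.\<close>

lemma (in stepped_biframe) collinear: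
  obtains k where "\<And>i j. i \<in> I \<Longrightarrow> j \<in> I \<Longrightarrow> Y i - Y j = k * (X i - X j)"
proof -
  obtain M b where M: "0 < M"
    "\<And>i j. i \<in> I \<Longrightarrow> j \<in> I \<Longrightarrow> M < X j - X i \<Longrightarrow> (Y i < Y j \<longleftrightarrow> b) \<and> Y i \<noteq> Y j"
    using orientation by blast
  show ?thesis
  proof (cases b)
    case True
    interpret oriented_biframe I X Y p1 p2 \<alpha> \<beta> r g nxt M
      by unfold_locales (use M True in auto)
    show ?thesis using collinear that by blast
  next
    case False
    interpret R: biframe I X "\<lambda>i. - Y i" p1 p2 \<alpha> "- \<beta>" by (rule reflect_Y)
    have rev: "- Y i < - Y j" if "i \<in> I" "j \<in> I" "M < X j - X i" for i j
      using M(2)[OF that] False by linarith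
    interpret R: oriented_biframe I X "\<lambda>i. - Y i" p1 p2 \<alpha> "- \<beta>" r g nxt M
      by unfold_locales (fact r g sepX nxt M(1) rev)+
    obtain k where k: "\<And>i j. i \<in> I \<Longrightarrow> j \<in> I \<Longrightarrow> - Y i - - Y j = k * (X i - X j)"
      using R.collinear by blast
    have "Y i - Y j = (- k) * (X i - X j)" if "i \<in> I" "j \<in> I" for i j
      unfolding mult_minus_left k[OF that, symmetric] by simp
    then show ?thesis by (rule that)
  qed
qed

lemma (in biframe) collinear:
  obtains k where "\<And>i j. i \<in> I \<Longrightarrow> j \<in> I \<Longrightarrow> Y i - Y j = k * (X i - X j)"
proof -
  obtain r where r: "0 < r" "\<And>i j. i \<in> I \<Longrightarrow> j \<in> I \<Longrightarrow> i \<noteq> j \<Longrightarrow> r \<le> \<bar>X i - X j\<bar>"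
    using separated_X by blast
  obtain g where g: "0 < g" "g < 1" "\<And>i. i \<in> I \<Longrightarrow> \<exists>j\<in>I. X i < X j \<and> X j \<le> X i + g"
    using gap_X by blast
  obtain nxt where nxt: "\<And>i. i \<in> I \<Longrightarrow> nxt i \<in> I \<and> X i < X (nxt i) \<and> X (nxt i) \<le> X i + g"
    using g(3) by metis
  interpret stepped_biframe I X Y p1 p2 \<alpha> \<beta> r g nxt
    by unfold_locales (use r g nxt in auto)
  show ?thesis using collinear that by blast
qed

section \<open>Arc length on two segments\<close>

text \<open>Sets of a cover are arbitrary, so their preimages on the parameter line need not be
  Borel; enclosing intervals are.\<close>

lemma subset_interval_of_diameter:
  fixes V :: "real set"
  assumes "\<And>s t. s \<in> V \<Longrightarrow> t \<in> V \<Longrightarrow> \<bar>s - t\<bar> \<le> d"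
  obtains l where "V \<subseteq> {l..l + d}"
proof (cases "V = {}")
  case False
  then obtain s0 where s0: "s0 \<in> V" by blast
  have bdd: "bdd_below V"
    by (rule bdd_belowI[of _ "s0 - d"]) (use assms s0 in fastforce)
  have "V \<subseteq> {Inf V..Inf V + d}"
  proof
    fix t assume t: "t \<in> V"
    have "t - d \<le> Inf V" using assms[OF t] False by (intro cInf_greatest) fastforce+
    moreover have "Inf V \<le> t" by (rule cInf_lower[OF t bdd])
    ultimately show "t \<in> {Inf V..Inf V + d}" by simp
  qed
  then show ?thesis by (rule that)
qed (use that in blast)

lemma hausdorff1_mono:
  assumes "A \<subseteq> B"
  shows "hausdorff1 A \<le> hausdorff1 B"
  unfolding hausdorff1_def hausdorff1_delta_def
  by (intro SUP_mono' INF_superset_mono) (use assms in auto)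

text \<open>A cover of the image pulls back to intervals of length diameter over
  \<open>norm u\<close>, and countable subadditivity of Lebesgue measure applies. The estimate holds
  for covers of mesh 1, and the supremum over \<delta> is at least as large.\<close>

lemma hausdorff1_image_ge:
  fixes a u :: "'a::euclidean_space"
  assumes S: "S \<in> sets borel" and u: "u \<noteq> 0"
  shows "ennreal (norm u) * emeasure lborel S \<le> hausdorff1 ((\<lambda>s. a + s *\<^sub>R u) ` S)"
proof -
  define \<gamma> where "\<gamma> s = a + s *\<^sub>R u" for s
  have "ennreal (norm u) * emeasure lborel S \<le> hausdorff1_delta 1 (\<gamma> ` S)"
    unfolding hausdorff1_delta_def
  proof (rule INF_greatest)
    fix U assume "U \<in> {U :: nat \<Rightarrow> 'a set. \<gamma> ` S \<subseteq> (\<Union>i. U i) \<and> (\<forall>i. bounded (U i) \<and> diameter (U i) \<le> 1)}"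
    then have U: "\<gamma> ` S \<subseteq> (\<Union>i. U i)" "\<And>i. bounded (U i)" by auto
    define d where "d i = diameter (U i) / norm u" for i
    have d0: "0 \<le> d i" for i using diameter_ge_0[OF U(2)] by (simp add: d_def)
    have "\<exists>l. {s. \<gamma> s \<in> U i} \<subseteq> {l..l + d i}" for i
    proof -
      have "\<bar>s - t\<bar> \<le> d i" if "s \<in> {s. \<gamma> s \<in> U i}" "t \<in> {s. \<gamma> s \<in> U i}" for s t
      proof -
        have "dist (\<gamma> s) (\<gamma> t) \<le> diameter (U i)"
          using that by (intro diameter_bounded_bound U) auto
        moreover have "dist (\<gamma> s) (\<gamma> t) = \<bar>s - t\<bar> * norm u"
          by (simp add: \<gamma>_def dist_norm scaleR_diff_left[symmetric])
        ultimately show ?thesis using u by (simp add: d_def pos_le_divide_eq)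
      qed
      then show ?thesis using subset_interval_of_diameter[of "{s. \<gamma> s \<in> U i}" "d i"] by blast
    qed
    then obtain l where l: "\<And>i. {s. \<gamma> s \<in> U i} \<subseteq> {l i..l i + d i}" by metis
    have "S \<subseteq> (\<Union>i. {l i..l i + d i})" using U(1) l by blast
    then have "emeasure lborel S \<le> emeasure lborel (\<Union>i. {l i..l i + d i})"
      by (intro emeasure_mono) auto
    also have "\<dots> \<le> (\<Sum>i. emeasure lborel {l i..l i + d i})"
      by (intro emeasure_subadditive_countably) auto
    also have "\<dots> = (\<Sum>i. ennreal (d i))" using d0 by simp
    finally have "ennreal (norm u) * emeasure lborel S \<le> ennreal (norm u) * (\<Sum>i. ennreal (d i))"
      by (intro mult_left_mono) auto
    also have "\<dots> = (\<Sum>i. ennreal (norm u) * ennreal (d i))" by simp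
    also have "\<dots> = (\<Sum>i. ennreal (diameter (U i)))"
      using u d0 by (simp add: ennreal_mult[symmetric]) (simp add: d_def)
    finally show "ennreal (norm u) * emeasure lborel S \<le> (\<Sum>i. ennreal (diameter (U i)))" .
  qed
  also have "\<dots> \<le> hausdorff1 (\<gamma> ` S)"
    unfolding hausdorff1_def by (rule SUP_upper) simp
  finally show ?thesis by (simp add: \<gamma>_def[abs_def])
qed

text \<open>Cutting the segment into sufficiently many equal pieces gives admissible covers whose
  diameters add up to at most its length.\<close>

lemma hausdorff1_segment_le:
  fixes a b :: "'a::euclidean_space"
  shows "hausdorff1 (closed_segment a b) \<le> ennreal (norm (b - a))"
  unfolding hausdorff1_def
proof (rule SUP_least)
  fix \<delta> :: real assume "\<delta> \<in> {0<..}"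
  then have \<delta>: "0 < \<delta>" by simp
  define L where "L = norm (b - a)"
  obtain n :: nat where n\<delta>: "L / \<delta> < real n" using reals_Archimedean2 by blast
  have "0 \<le> L / \<delta>" using \<delta> by (simp add: L_def)
  then have n0: "0 < real n" using n\<delta> by simp
  have "L < real n * \<delta>" using n\<delta> \<delta> by (simp only: pos_divide_less_eq)
  then have n: "0 < n" "L / real n \<le> \<delta>" using n0 by (simp_all add: pos_divide_le_eq mult.commute)
  define U where "U i = (if i < n then (\<lambda>s. a + s *\<^sub>R (b - a)) ` {real i / n..(real i + 1) / n} else {})" for i
  have dU: "bounded (U i)" "diameter (U i) \<le> (if i < n then L / n else 0)" for i
  proof -
    have dist: "dist x y \<le> L / n" if xy: "x \<in> U i" "y \<in> U i" and i: "i < n" for x y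
    proof -
      have "U i = (\<lambda>s. a + s *\<^sub>R (b - a)) ` {real i / n..(real i + 1) / n}" using i by (simp add: U_def)
      with xy obtain s t where st: "x = a + s *\<^sub>R (b - a)" "y = a + t *\<^sub>R (b - a)"
        and "s \<in> {real i / n..(real i + 1) / n}" "t \<in> {real i / n..(real i + 1) / n}"
        by blast
      then have bounds: "real i / n \<le> s" "s \<le> (real i + 1) / n" "real i / n \<le> t" "t \<le> (real i + 1) / n"
        by simp_all
      have "(real i + 1) / n = real i / n + 1 / n" by (simp add: add_divide_distrib)
      then have "\<bar>s - t\<bar> \<le> 1 / n" using bounds by linarith
      then have "\<bar>s - t\<bar> * L \<le> 1 / n * L" by (intro mult_right_mono) (auto simp: L_def)
      moreover have "dist x y = \<bar>s - t\<bar> * L"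
        by (simp add: st dist_norm scaleR_diff_left[symmetric] L_def)
      ultimately show ?thesis by simp
    qed
    show "bounded (U i)"
      unfolding U_def by (auto intro!: compact_imp_bounded compact_continuous_image continuous_intros)
    show "diameter (U i) \<le> (if i < n then L / n else 0)"
    proof (cases "i < n")
      case True
      then show ?thesis using dist[OF _ _ True]
        by (auto intro!: diameter_le simp: dist_norm L_def)
    qed (simp add: U_def)
  qed
  have "closed_segment a b \<subseteq> (\<Union>i. U i)"
  proof
    fix x assume "x \<in> closed_segment a b"
    then obtain s where s: "x = a + s *\<^sub>R (b - a)" "0 \<le> s" "s \<le> 1"
      by (auto simp: in_segment algebra_simps)
    \<comment> \<open>At the end point \<open>s = 1\<close> the floor would yield \<open>n\<close>,
      the index of an empty piece.\<close>
    define i where "i = (if s = 1 then n - 1 else nat \<lfloor>s * n\<rfloor>)"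
    have "i < n \<and> real i \<le> s * n \<and> s * n \<le> real i + 1"
    proof (cases "s = 1")
      case True
      then show ?thesis using n(1) by (simp add: i_def of_nat_diff)
    next
      case False
      then have "s * real n < 1 * real n" using s n(1) by (intro mult_strict_right_mono) auto
      moreover have "0 \<le> s * n" using s by simp
      ultimately show ?thesis using False unfolding i_def by (simp add: nat_less_iff floor_less_iff)
    qed
    then have "s \<in> {real i / n..(real i + 1) / n}" "i < n"
      using n(1) by (auto simp: field_simps)
    then have "x \<in> U i" using s by (auto simp: U_def)
    then show "x \<in> (\<Union>i. U i)" by blast
  qed
  moreover have "diameter (U i) \<le> \<delta>" for i
    using dU(2)[of i] n(2) \<delta> by (auto split: if_splits)
  ultimately have "hausdorff1_delta \<delta> (closed_segment a b) \<le> (\<Sum>i. ennreal (diameter (U i)))"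
    unfolding hausdorff1_delta_def using dU(1) by (intro INF_lower) auto
  also have "\<dots> = (\<Sum>i<n. ennreal (diameter (U i)))"
    by (rule suminf_finite) (auto simp: U_def)
  also have "\<dots> \<le> (\<Sum>i<n. ennreal (L / n))"
  proof (intro sum_mono ennreal_leI)
    show "diameter (U i) \<le> L / n" if "i \<in> {..<n}" for i using that dU(2)[of i] by simp
  qed
  also have "\<dots> = ennreal (norm (b - a))"
    using n(1) by (simp add: ennreal_of_nat_eq_real_of_nat ennreal_mult[symmetric] L_def)
  finally show "hausdorff1_delta \<delta> (closed_segment a b) \<le> ennreal (norm (b - a))" .
qed

text \<open>The inequalities for a set and for its complement add up to equal total masses, so
  neither can be strict.\<close>

lemma prob_measure_eqI_le:
  assumes "prob_space M" "prob_space N" "sets M = sets N"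
    and le: "\<And>A. A \<in> sets M \<Longrightarrow> emeasure N A \<le> emeasure M A"
  shows "M = N"
proof (rule measure_eqI)
  fix A assume A: "A \<in> sets M"
  interpret M: prob_space M by fact
  interpret N: prob_space N by fact
  have sp: "space M = space N" by (rule sets_eq_imp_space_eq) fact
  have le': "N.prob B \<le> M.prob B" if "B \<in> sets M" for B
    using le[OF that] by (simp add: M.emeasure_eq_measure N.emeasure_eq_measure)
  have "N.prob (space N - A) \<le> M.prob (space M - A)" using le'[OF sets.compl_sets[OF A]] sp by simp
  then have "M.prob A \<le> N.prob A" using A assms(3) by (simp add: M.prob_compl N.prob_compl)
  with le'[OF A] show "emeasure M A = emeasure N A"
    by (simp add: M.emeasure_eq_measure N.emeasure_eq_measure)
qed (fact assms(3))

section \<open>The measure as a push-forward from the line\<close>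

definition two_segment_density :: "real \<Rightarrow> real \<Rightarrow> real \<Rightarrow> real" where
  "two_segment_density p1 p2 s = p1 * indicator {0..1} s + p2 * indicator {1<..2} s"

text \<open>The first segment is run through up to parameter 1, the second one from there to 2;
  outside this range \<open>two_segment_density\<close> vanishes.\<close>

definition two_segment_curve :: "'a::real_vector \<Rightarrow> 'a \<Rightarrow> 'a \<Rightarrow> 'a \<Rightarrow> real \<Rightarrow> 'a" where
  "two_segment_curve a u b v s = (if s \<le> 1 then a + s *\<^sub>R u else b + (s - 1) *\<^sub>R v)"

lemma two_segment_curve_measurable [measurable]:
  "two_segment_curve a u b v \<in> borel_measurable borel"
  for a :: "'a::euclidean_space"
  unfolding two_segment_curve_def[abs_def] by measurable

lemma two_segment_density_measurable [measurable]:
  "two_segment_density p1 p2 \<in> borel_measurable borel"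
  unfolding two_segment_density_def[abs_def] by measurable

text \<open>The measure on the right is dominated by \<open>\<mu>\<close> and has at least its total mass, so no upper
  bound for the Hausdorff measure of Borel pieces is needed, only that of a whole segment.\<close>

lemma two_segment_distr:
  fixes a b u v :: "'a::euclidean_space" and \<mu> :: "'a measure"
  assumes uv: "u \<noteq> 0" "v \<noteq> 0" and c: "0 < c1" "0 < c2"
    and sets: "sets \<mu> = sets borel" and prob: "prob_space \<mu>"
    and \<mu>: "\<And>E. E \<in> sets borel \<Longrightarrow> emeasure \<mu> E =
      ennreal c1 * hausdorff1 (E \<inter> closed_segment a (a + u)) + ennreal c2 * hausdorff1 (E \<inter> closed_segment b (b + v))"
  shows "c1 * norm u + c2 * norm v = 1"
    and "\<mu> = distr (density lborel (two_segment_density (c1 * norm u) (c2 * norm v))) borel (two_segment_curve a u b v)"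
proof -
  define p1 p2 where "p1 = c1 * norm u" and "p2 = c2 * norm v"
  have p: "0 < p1" "0 < p2" using c uv by (auto simp: p1_def p2_def)
  let ?g = "two_segment_curve a u b v"
  define \<nu> where "\<nu> = distr (density lborel (two_segment_density p1 p2)) borel ?g"
  \<comment> \<open>The base point \<open>b - v\<close> accounts for the second segment starting at
    parameter 1.\<close>
  have \<nu>: "emeasure \<nu> E = ennreal p1 * emeasure lborel ({0..1} \<inter> {s. a + s *\<^sub>R u \<in> E})
      + ennreal p2 * emeasure lborel ({1<..2} \<inter> {s. (b - v) + s *\<^sub>R v \<in> E})"
    if E: "E \<in> sets borel" for E
  proof -
    have [measurable]: "E \<in> sets borel" by fact
    have [measurable]: "?g -` E \<in> sets borel"
      by (rule measurable_sets_borel[OF two_segment_curve_measurable E])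
    have "emeasure \<nu> E = emeasure (density lborel (two_segment_density p1 p2)) (?g -` E)"
      unfolding \<nu>_def by (subst emeasure_distr) auto
    also have "\<dots> = (\<integral>\<^sup>+s. ennreal (two_segment_density p1 p2 s) * indicator (?g -` E) s \<partial>lborel)"
      by (subst emeasure_density) auto
    also have "\<dots> = (\<integral>\<^sup>+s. ennreal p1 * indicator ({0..1} \<inter> {s. a + s *\<^sub>R u \<in> E}) s
        + ennreal p2 * indicator ({1<..2} \<inter> {s. (b - v) + s *\<^sub>R v \<in> E}) s \<partial>lborel)"
      by (intro nn_integral_cong)
         (auto simp: two_segment_density_def two_segment_curve_def indicator_def algebra_simps)
    also have "\<dots> = ennreal p1 * emeasure lborel ({0..1} \<inter> {s. a + s *\<^sub>R u \<in> E})
      + ennreal p2 * emeasure lborel ({1<..2} \<inter> {s. (b - v) + s *\<^sub>R v \<in> E})"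
      by (subst nn_integral_add) (auto simp: nn_integral_cmult)
    finally show ?thesis .
  qed
  have le: "emeasure \<nu> E \<le> emeasure \<mu> E" if E: "E \<in> sets borel" for E
  proof -
    have [measurable]: "E \<in> sets borel" by fact
    have 1: "ennreal p1 * emeasure lborel ({0..1} \<inter> {s. a + s *\<^sub>R u \<in> E})
        \<le> ennreal c1 * hausdorff1 (E \<inter> closed_segment a (a + u))"
    proof -
      have "ennreal (norm u) * emeasure lborel ({0..1} \<inter> {s. a + s *\<^sub>R u \<in> E})
          \<le> hausdorff1 ((\<lambda>s. a + s *\<^sub>R u) ` ({0..1} \<inter> {s. a + s *\<^sub>R u \<in> E}))"
        by (rule hausdorff1_image_ge[OF _ uv(1)]) measurable
      also have "\<dots> \<le> hausdorff1 (E \<inter> closed_segment a (a + u))"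
      proof (rule hausdorff1_mono, safe)
        fix s :: real assume "s \<in> {0..1}"
        then show "a + s *\<^sub>R u \<in> closed_segment a (a + u)"
          unfolding in_segment by (intro exI[of _ s]) (auto simp: algebra_simps)
      qed
      finally show ?thesis
        using c by (simp add: p1_def ennreal_mult mult.assoc mult_left_mono)
    qed
    have 2: "ennreal p2 * emeasure lborel ({1<..2} \<inter> {s. (b - v) + s *\<^sub>R v \<in> E})
        \<le> ennreal c2 * hausdorff1 (E \<inter> closed_segment b (b + v))"
    proof -
      have "ennreal (norm v) * emeasure lborel ({1<..2} \<inter> {s. (b - v) + s *\<^sub>R v \<in> E})
          \<le> hausdorff1 ((\<lambda>s. (b - v) + s *\<^sub>R v) ` ({1<..2} \<inter> {s. (b - v) + s *\<^sub>R v \<in> E}))"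
        by (rule hausdorff1_image_ge[OF _ uv(2)]) measurable
      also have "\<dots> \<le> hausdorff1 (E \<inter> closed_segment b (b + v))"
      proof (rule hausdorff1_mono, safe)
        fix s :: real assume "s \<in> {1<..2}"
        then show "(b - v) + s *\<^sub>R v \<in> closed_segment b (b + v)"
          unfolding in_segment by (intro exI[of _ "s - 1"]) (auto simp: algebra_simps scaleR_2)
      qed
      finally show ?thesis
        using c by (simp add: p2_def ennreal_mult mult.assoc mult_left_mono)
    qed
    show ?thesis unfolding \<nu>[OF E] \<mu>[OF E] by (rule add_mono[OF 1 2])
  qed
  interpret \<mu>: prob_space \<mu> by fact
  have sp: "space \<mu> = UNIV" using sets_eq_imp_space_eq[OF sets] by simp
  have \<nu>1: "emeasure \<nu> UNIV = ennreal (p1 + p2)"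
    using \<nu>[of UNIV] p by simp
  \<comment> \<open>This gives \<open>1 \<le> p1 + p2\<close>; the reverse inequality comes from the
    domination \<open>le\<close>.\<close>
  have "emeasure \<mu> UNIV \<le> ennreal c1 * ennreal (norm u) + ennreal c2 * ennreal (norm v)"
    using \<mu>[of UNIV] hausdorff1_segment_le[of a "a + u"] hausdorff1_segment_le[of b "b + v"]
    by (simp add: add_mono mult_left_mono)
  also have "\<dots> = ennreal (p1 + p2)"
    using c by (simp add: p1_def p2_def ennreal_mult)
  finally have "1 \<le> ennreal (p1 + p2)" using \<mu>.emeasure_space_1 sp by simp
  moreover have "ennreal (p1 + p2) \<le> 1"
    using le[of UNIV] \<nu>1 \<mu>.emeasure_space_1 sp by simp
  ultimately have "ennreal (p1 + p2) = ennreal 1" unfolding ennreal_1 by (rule antisym[rotated])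
  then have p12: "p1 + p2 = 1" using p by (subst (asm) ennreal_inj) auto
  then show "c1 * norm u + c2 * norm v = 1" by (simp add: p1_def p2_def)
  have "prob_space \<nu>"
    by (rule prob_spaceI) (use \<nu>1 p12 in \<open>simp add: \<nu>_def\<close>)
  then have "\<mu> = \<nu>"
    using le sets by (intro prob_measure_eqI_le prob) (auto simp: \<nu>_def)
  then show "\<mu> = distr (density lborel (two_segment_density (c1 * norm u) (c2 * norm v))) borel ?g"
    by (simp add: \<nu>_def p1_def p2_def)
qed

lemma two_segment_integral:
  fixes a b u v :: "'a::euclidean_space" and f :: "'a \<Rightarrow> complex"
  assumes p: "0 < p1" "0 < p2"
    and f[measurable]: "f \<in> borel_measurable borel" and bdd: "\<And>x. cmod (f x) \<le> B"
  shows "integral\<^sup>L (distr (density lborel (two_segment_density p1 p2)) borel (two_segment_curve a u b v)) f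
    = p1 * (LINT s:{0..1}|lborel. f (a + s *\<^sub>R u)) + p2 * (LINT s:{0..1}|lborel. f (b + s *\<^sub>R v))"
proof -
  let ?g = "two_segment_curve a u b v"
  have int1: "integrable lborel (\<lambda>s. indicator {l..r} s *\<^sub>R f (c + s *\<^sub>R w))" for c w :: 'a and l r :: real
    using bdd by (intro integrableI_bounded_set_indicator[where B = B]) (auto simp: emeasure_lborel_Icc_eq)
  have int2: "integrable lborel (\<lambda>s. indicator {1<..2} s *\<^sub>R f (b + (s - 1) *\<^sub>R v))"
    using bdd by (intro integrableI_bounded_set_indicator[where B = B]) auto
  have "integral\<^sup>L (distr (density lborel (two_segment_density p1 p2)) borel ?g) f
      = (LINT s|density lborel (two_segment_density p1 p2). f (?g s))"
    by (rule integral_distr) auto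
  also have "\<dots> = (LINT s|lborel. two_segment_density p1 p2 s *\<^sub>R f (?g s))"
    by (rule integral_density) (use p in \<open>auto simp: two_segment_density_def\<close>)
  also have "\<dots> = (LINT s|lborel. p1 * (indicator {0..1} s *\<^sub>R f (a + s *\<^sub>R u))
      + p2 * (indicator {1<..2} s *\<^sub>R f (b + (s - 1) *\<^sub>R v)))"
    by (intro Bochner_Integration.integral_cong)
       (auto simp: two_segment_density_def two_segment_curve_def indicator_def scaleR_conv_of_real)
  also have "\<dots> = p1 * (LINT s|lborel. indicator {0..1} s *\<^sub>R f (a + s *\<^sub>R u))
      + p2 * (LINT s|lborel. indicator {1<..2} s *\<^sub>R f (b + (s - 1) *\<^sub>R v))"
    by (subst Bochner_Integration.integral_add)
       (intro integrable_mult_right int1 int2, intro integrable_mult_right int1 int2,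
        simp only: integral_mult_right_zero)
  also have "(LINT s|lborel. indicator {1<..2} s *\<^sub>R f (b + (s - 1) *\<^sub>R v))
      = (LINT s|lborel. indicator {1<..2} (1 + s) *\<^sub>R f (b + s *\<^sub>R v))"
    using lborel_integral_real_affine[of 1 "\<lambda>s. indicator {1<..2} s *\<^sub>R f (b + (s - 1) *\<^sub>R v)" 1] by simp
  \<comment> \<open>The shifted interval \<open>{0<..1}\<close> lacks only the point 0.\<close>
  also have "\<dots> = (LINT s|lborel. indicator {0..1} s *\<^sub>R f (b + s *\<^sub>R v))"
  proof (rule integral_cong_AE)
    show "AE s in lborel. indicator {1<..2} (1 + s) *\<^sub>R f (b + s *\<^sub>R v) = indicator {0..1} s *\<^sub>R f (b + s *\<^sub>R v)"
      using AE_lborel_singleton[of "0::real"] by eventually_elim (auto simp: indicator_def)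
  qed auto
  finally show ?thesis by (simp add: set_lebesgue_integral_def)
qed

section \<open>Parseval's identity for a spectrum\<close>

lemma expo_eq_cis: "expo l x = cis (2 * pi * (l \<bullet> x))"
  by (simp add: expo_def cis_conv_exp mult_ac)

lemma expo_measurable [measurable]: "expo l \<in> borel_measurable borel"
  for l :: "'a::euclidean_space"
  unfolding expo_def[abs_def] by measurable

lemma cmod_expo [simp]: "cmod (expo l x) = 1"
  by (simp add: expo_eq_cis)

text \<open>An explicit primitive; factoring out the half-angle phase turns
  \<open>cis (2 * pi * z) - 1\<close> into a multiple of \<open>sin (pi * z)\<close>.\<close>

lemma integral_cis:
  "(LINT s:{0..1}|lborel. cis (2 * pi * (z * s))) = cis (pi * z) * nsinc z"
proof (cases "z = 0")
  case True
  then show ?thesis by (simp add: set_lebesgue_integral_def)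
next
  case False
  define F where "F s = cis (2 * pi * (z * s)) / (2 * pi * \<i> * z)" for s
  have F: "(F has_vector_derivative cis (2 * pi * (z * s))) (at s within {0..1})" for s
  proof -
    have "((\<lambda>s. exp (of_real s * (2 * pi * \<i> * z))) has_vector_derivative
        (exp (of_real s * (2 * pi * \<i> * z)) * (2 * pi * \<i> * z))) (at s within {0..1})"
      by (rule has_vector_derivative_real_field) (auto intro!: derivative_eq_intros)
    from has_vector_derivative_divide[OF this, of "2 * pi * \<i> * z"]
    show ?thesis
      using False unfolding F_def cis_conv_exp by (simp add: mult_ac)
  qed
  have "has_bochner_integral lborel (\<lambda>s. indicator {0..1} s *\<^sub>R cis (2 * pi * (z * s))) (F 1 - F 0)"
    by (rule has_bochner_integral_FTC_Icc[OF _ F])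
       (auto intro!: continuous_intros)
  then have "(LINT s:{0..1}|lborel. cis (2 * pi * (z * s))) = F 1 - F 0"
    unfolding set_lebesgue_integral_def by (rule has_bochner_integral_integral_eq)
  also have "\<dots> = (cis (2 * pi * z) - 1) / (2 * pi * \<i> * z)"
    by (simp add: F_def diff_divide_distrib)
  also have "cis (2 * pi * z) - 1 = cis (pi * z) * (2 * \<i> * sin (pi * z))"
  proof -
    have "cis (2 * pi * z) = cis (pi * z) * cis (pi * z)" by (simp add: cis_mult mult.assoc)
    moreover have "1 = cis (pi * z) * cis (- (pi * z))" by (simp add: cis_mult)
    moreover have "cis (pi * z) - cis (- (pi * z)) = 2 * \<i> * sin (pi * z)"
      by (simp add: complex_eq_iff)
    ultimately show ?thesis by (metis right_diff_distrib)
  qed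
  also have "\<dots> / (2 * pi * \<i> * z) = cis (pi * z) * nsinc z"
    using False by (simp add: nsinc_def)
  finally show ?thesis .
qed

context prob_space
begin

lemma integrable_bounded:
  fixes f :: "'a \<Rightarrow> complex"
  assumes "f \<in> borel_measurable M" "\<And>x. cmod (f x) \<le> B"
  shows "integrable M f"
  by (rule integrable_const_bound[of _ B]) (use assms in auto)

end

text \<open>Orthonormality lets one complete the square in the error of a finite combination
  (\<open>id\<close>). The coefficients \<open>h\<close> yield Bessel's inequality, and the density
  of the span brings finite sums arbitrarily close to \<open>N\<close>.\<close>

lemma spectrum_parseval:
  fixes f :: "'a::euclidean_space \<Rightarrow> complex"
  assumes prob: "prob_space \<mu>" and sets: "sets \<mu> = sets borel" and spec: "is_spectrum \<mu> \<Lambda>"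
    and f: "f \<in> borel_measurable borel" and bdd: "\<And>x. cmod (f x) \<le> B"
  shows "((\<lambda>l. (cmod (LINT x|\<mu>. f x * cnj (expo l x)))\<^sup>2) has_sum (LINT x|\<mu>. (cmod (f x))\<^sup>2)) \<Lambda>"
proof -
  interpret prob_space \<mu> by fact
  have B: "0 \<le> B" using norm_ge_zero order_trans bdd by blast
  have [measurable]: "cnj \<in> borel_measurable borel"
    by (intro borel_measurable_continuous_onI continuous_intros)
  have [measurable]: "f \<in> borel_measurable \<mu>" "\<And>l. expo l \<in> borel_measurable \<mu>"
    using f sets expo_measurable by (simp_all cong: measurable_cong_sets)
  define h where "h l = (LINT x|\<mu>. f x * cnj (expo l x))" for l
  define N where "N = (LINT x|\<mu>. (cmod (f x))\<^sup>2)"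
  have id: "(LINT x|\<mu>. (cmod (f x - (\<Sum>l\<in>F. a l * expo l x)))\<^sup>2)
      = N - (\<Sum>l\<in>F. (cmod (h l))\<^sup>2) + (\<Sum>l\<in>F. (cmod (a l - h l))\<^sup>2)"
    if F: "finite F" "F \<subseteq> \<Lambda>" for F a
  proof -
    have i1: "integrable \<mu> (\<lambda>x. f x * cnj (f x))"
      by (rule integrable_bounded[of _ "B * B"])
         (use bdd B in \<open>auto simp: norm_mult intro!: mult_mono\<close>)
    have i2: "integrable \<mu> (\<lambda>x. f x * cnj (expo l x))" for l
      by (rule integrable_bounded[of _ B]) (use bdd in \<open>auto simp: norm_mult\<close>)
    have i3: "integrable \<mu> (\<lambda>x. cnj (f x) * expo l x)" for l
      by (rule integrable_bounded[of _ B]) (use bdd in \<open>auto simp: norm_mult\<close>)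
    have i4: "integrable \<mu> (\<lambda>x. expo l x * cnj (expo l' x))" for l l'
      by (rule integrable_bounded[of _ 1]) (auto simp: norm_mult)
    have h': "(LINT x|\<mu>. cnj (f x) * expo l x) = cnj (h l)" for l
      unfolding h_def using Bochner_Integration.integral_cnj[of \<mu> "\<lambda>x. f x * cnj (expo l x)"] by simp
    have "complex_of_real (LINT x|\<mu>. (cmod (f x - (\<Sum>l\<in>F. a l * expo l x)))\<^sup>2)
        = (LINT x|\<mu>. (f x - (\<Sum>l\<in>F. a l * expo l x)) * cnj (f x - (\<Sum>l\<in>F. a l * expo l x)))"
      by (simp only: integral_complex_of_real[symmetric] complex_norm_square)
    also have "\<dots> = (LINT x|\<mu>. f x * cnj (f x) - (\<Sum>l\<in>F. cnj (a l) * (f x * cnj (expo l x)))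
        - (\<Sum>l\<in>F. a l * (cnj (f x) * expo l x))
        + (\<Sum>l\<in>F. \<Sum>l'\<in>F. (a l * cnj (a l')) * (expo l x * cnj (expo l' x))))"
    proof (intro Bochner_Integration.integral_cong refl)
      fix x
      let ?S = "\<Sum>l\<in>F. a l * expo l x"
      have "(f x - ?S) * cnj (f x - ?S) = f x * cnj (f x) - f x * cnj ?S - cnj (f x) * ?S + ?S * cnj ?S"
        by (simp add: algebra_simps)
      moreover have "f x * cnj ?S = (\<Sum>l\<in>F. cnj (a l) * (f x * cnj (expo l x)))"
        by (simp add: sum_distrib_left mult_ac)
      moreover have "cnj (f x) * ?S = (\<Sum>l\<in>F. a l * (cnj (f x) * expo l x))"
        by (simp add: sum_distrib_left mult_ac)
      moreover have "?S * cnj ?S = (\<Sum>l\<in>F. \<Sum>l'\<in>F. (a l * cnj (a l')) * (expo l x * cnj (expo l' x)))"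
        by (simp add: sum_product mult_ac)
      ultimately show "(f x - ?S) * cnj (f x - ?S)
          = f x * cnj (f x) - (\<Sum>l\<in>F. cnj (a l) * (f x * cnj (expo l x)))
            - (\<Sum>l\<in>F. a l * (cnj (f x) * expo l x))
            + (\<Sum>l\<in>F. \<Sum>l'\<in>F. (a l * cnj (a l')) * (expo l x * cnj (expo l' x)))"
        by (simp only:)
    qed
    also have "\<dots> = (LINT x|\<mu>. f x * cnj (f x)) - (\<Sum>l\<in>F. cnj (a l) * h l)
        - (\<Sum>l\<in>F. a l * cnj (h l))
        + (\<Sum>l\<in>F. \<Sum>l'\<in>F. (a l * cnj (a l')) * (LINT x|\<mu>. expo l x * cnj (expo l' x)))"
      by (simp add: i1 i2 i3 i4 h' flip: h_def)
    also have "(\<Sum>l\<in>F. \<Sum>l'\<in>F. (a l * cnj (a l')) * (LINT x|\<mu>. expo l x * cnj (expo l' x)))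
        = (\<Sum>l\<in>F. \<Sum>l'\<in>F. if l = l' then a l * cnj (a l) else 0)"
      using spec F unfolding is_spectrum_def by (intro sum.cong refl) (auto simp: subset_iff)
    also have "\<dots> = (\<Sum>l\<in>F. a l * cnj (a l))" using F by simp
    also have "(LINT x|\<mu>. f x * cnj (f x)) = complex_of_real N"
      by (simp only: N_def integral_complex_of_real[symmetric] complex_norm_square)
    also have "complex_of_real N - (\<Sum>l\<in>F. cnj (a l) * h l) - (\<Sum>l\<in>F. a l * cnj (h l)) + (\<Sum>l\<in>F. a l * cnj (a l))
        = complex_of_real N - (\<Sum>l\<in>F. h l * cnj (h l)) + (\<Sum>l\<in>F. (a l - h l) * cnj (a l - h l))"
      by (simp add: algebra_simps sum.distrib sum_subtractf)
    also have "\<dots> = complex_of_real (N - (\<Sum>l\<in>F. (cmod (h l))\<^sup>2) + (\<Sum>l\<in>F. (cmod (a l - h l))\<^sup>2))"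
      by (simp only: of_real_add of_real_diff of_real_sum complex_norm_square)
    finally show ?thesis by (simp only: of_real_eq_iff)
  qed
  have bessel: "(\<Sum>l\<in>F. (cmod (h l))\<^sup>2) \<le> N" if F: "finite F" "F \<subseteq> \<Lambda>" for F
  proof -
    have "0 \<le> (LINT x|\<mu>. (cmod (f x - (\<Sum>l\<in>F. h l * expo l x)))\<^sup>2)" by simp
    then show ?thesis using id[OF F, of h] by simp
  qed
  have sq: "square_integrable \<mu> f"
    unfolding square_integrable_def
  proof
    show "integrable \<mu> (\<lambda>x. (cmod (f x))\<^sup>2)"
      by (rule integrable_const_bound[of _ "B\<^sup>2"]) (use bdd in \<open>auto intro!: power_mono\<close>)
  qed simp
  have approx: "\<exists>F. finite F \<and> F \<subseteq> \<Lambda> \<and> N - \<epsilon> < (\<Sum>l\<in>F. (cmod (h l))\<^sup>2)" if \<epsilon>: "0 < \<epsilon>" for \<epsilon>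
  proof -
    have "\<forall>\<epsilon>>0. \<exists>F a. finite F \<and> F \<subseteq> \<Lambda> \<and> (LINT x|\<mu>. (cmod (f x - (\<Sum>l\<in>F. a l * expo l x)))\<^sup>2) < \<epsilon>"
      using spec[unfolded is_spectrum_def, THEN conjunct2, THEN conjunct2, rule_format, OF sq] by simp
    with \<epsilon> obtain F a where F: "finite F" "F \<subseteq> \<Lambda>"
      "(LINT x|\<mu>. (cmod (f x - (\<Sum>l\<in>F. a l * expo l x)))\<^sup>2) < \<epsilon>"
      by blast
    moreover have "0 \<le> (\<Sum>l\<in>F. (cmod (a l - h l))\<^sup>2)" by (intro sum_nonneg) simp
    ultimately show ?thesis using id[OF F(1,2), of a] by (intro exI[of _ F]) linarith
  qed
  have bdd: "bdd_above (sum (\<lambda>l. (cmod (h l))\<^sup>2) ` {F. F \<subseteq> \<Lambda> \<and> finite F})"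
    by (intro bdd_aboveI2[of _ _ N] bessel) auto
  have "((\<lambda>l. (cmod (h l))\<^sup>2) has_sum (SUP F\<in>{F. finite F \<and> F \<subseteq> \<Lambda>}. \<Sum>l\<in>F. (cmod (h l))\<^sup>2)) \<Lambda>"
    by (rule nonneg_bdd_above_has_sum) (use bdd in auto)
  moreover have "(SUP F\<in>{F. finite F \<and> F \<subseteq> \<Lambda>}. \<Sum>l\<in>F. (cmod (h l))\<^sup>2) = N"
  proof (rule antisym)
    show "(SUP F\<in>{F. finite F \<and> F \<subseteq> \<Lambda>}. \<Sum>l\<in>F. (cmod (h l))\<^sup>2) \<le> N"
      by (rule cSUP_least) (auto intro: bessel)
    show "N \<le> (SUP F\<in>{F. finite F \<and> F \<subseteq> \<Lambda>}. \<Sum>l\<in>F. (cmod (h l))\<^sup>2)"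
    proof (rule field_le_epsilon)
      fix \<epsilon> :: real assume "0 < \<epsilon>"
      then obtain F where F: "finite F" "F \<subseteq> \<Lambda>" "N - \<epsilon> < (\<Sum>l\<in>F. (cmod (h l))\<^sup>2)" using approx by blast
      moreover have "(\<Sum>l\<in>F. (cmod (h l))\<^sup>2) \<le> (SUP F\<in>{F. finite F \<and> F \<subseteq> \<Lambda>}. \<Sum>l\<in>F. (cmod (h l))\<^sup>2)"
        using F by (intro cSUP_upper bdd_aboveI2[of _ _ N] bessel) auto
      ultimately show "N \<le> (SUP F\<in>{F. finite F \<and> F \<subseteq> \<Lambda>}. \<Sum>l\<in>F. (cmod (h l))\<^sup>2) + \<epsilon>" by linarith
    qed
  qed
  ultimately show ?thesis by (simp add: h_def N_def)
qed

section \<open>Spectra of two segments\<close>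

text \<open>The dimension is left open; in the plane, \<open>coords\<close> is a consequence of
  non-parallelism (\<open>plane_coordinates\<close>).\<close>

locale two_segments =
  fixes \<mu> :: "'a::euclidean_space measure" and a b u v :: 'a and p1 p2 :: real
  assumes p: "0 < p1" "0 < p2" "p1 + p2 = 1"
    and prob: "prob_space \<mu>" and sets: "sets \<mu> = sets borel"
    and u_nonzero: "u \<noteq> 0" and nonparallel: "\<And>t. v \<noteq> t *\<^sub>R u"
    and coords: "\<exists>\<alpha> \<beta>. b - a = \<alpha> *\<^sub>R u + \<beta> *\<^sub>R v"
    and integral_eq: "\<And>(f :: 'a \<Rightarrow> complex) B. f \<in> borel_measurable borel \<Longrightarrow> (\<And>x. cmod (f x) \<le> B) \<Longrightarrow>
      integral\<^sup>L \<mu> f = p1 * (LINT s:{0..1}|lborel. f (a + s *\<^sub>R u)) + p2 * (LINT s:{0..1}|lborel. f (b + s *\<^sub>R v))"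
begin

text \<open>Transfers the frame identity to the second segment and lets the heavier segment come
  first.\<close>

lemma swap: "two_segments \<mu> b a v u p2 p1"
proof (rule two_segments.intro)
  show "v \<noteq> 0" using nonparallel[of 0] by simp
  show "u \<noteq> t *\<^sub>R v" for t
  proof
    assume "u = t *\<^sub>R v"
    then have "v = inverse t *\<^sub>R u" using u_nonzero by (cases "t = 0") auto
    then show False using nonparallel by blast
  qed
  obtain \<alpha> \<beta> where "b - a = \<alpha> *\<^sub>R u + \<beta> *\<^sub>R v" using coords by blast
  then have "a - b = (- \<beta>) *\<^sub>R v + (- \<alpha>) *\<^sub>R u" by (simp add: algebra_simps)
  then show "\<exists>\<alpha> \<beta>. a - b = \<alpha> *\<^sub>R v + \<beta> *\<^sub>R u" by blast
  show "p2 + p1 = 1" using p by simp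
  show "integral\<^sup>L \<mu> f = p2 * (LINT s:{0..1}|lborel. f (b + s *\<^sub>R v)) + p1 * (LINT s:{0..1}|lborel. f (a + s *\<^sub>R u))"
    if "f \<in> borel_measurable borel" "\<And>x. cmod (f x) \<le> B" for f :: "'a \<Rightarrow> complex" and B
    by (subst add.commute) (rule integral_eq[OF that])
qed (fact p(1,2) prob sets)+

text \<open>Parseval for the function that is \<open>h\<close>, a combination of the exponentials of
  frequencies \<open>x\<close> and \<open>x + 1\<close>, along the line of the first segment, and 0
  elsewhere. Taking \<open>c = 0\<close> gives the frame identity; \<open>c = 1\<close> makes the
  mixed term available.\<close>

lemma spectrum_frame:
  assumes spec: "is_spectrum \<mu> \<Lambda>"
  shows "((\<lambda>l. (nsinc (l \<bullet> u - x) - c * nsinc (l \<bullet> u - x - 1))\<^sup>2) has_sum (1 + c\<^sup>2) / p1) \<Lambda>"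
proof -
  define h where "h s = cis (2 * pi * (x * s)) + c * cis (2 * pi * ((x + 1) * s))" for s
  \<comment> \<open>The coordinate along \<open>u\<close> of the orthogonal projection onto the line
    \<open>L\<close> of the first segment.\<close>
  define k where "k y = ((y - a) \<bullet> u) / (u \<bullet> u)" for y
  define L where "L = {y. y - a = k y *\<^sub>R u}"
  define f where "f y = indicator L y *\<^sub>R h (k y)" for y
  have contk: "continuous_on UNIV k" unfolding k_def by (intro continuous_intros) (use u_nonzero in auto)
  have conth: "continuous_on S h" for S unfolding h_def by (intro continuous_intros)
  have "closed L" unfolding L_def by (intro closed_Collect_eq continuous_intros contk)
  then have [measurable]: "L \<in> sets borel" by (rule borel_closed)
  have [measurable]: "k \<in> borel_measurable borel" "h \<in> borel_measurable borel"
    by (intro borel_measurable_continuous_onI contk conth)+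
  have f_meas[measurable]: "f \<in> borel_measurable borel" unfolding f_def[abs_def] by measurable
  have [measurable]: "cnj \<in> borel_measurable borel"
    by (intro borel_measurable_continuous_onI continuous_intros)
  have h_bdd: "cmod (h s) \<le> 1 + \<bar>c\<bar>" for s
    unfolding h_def by (rule order_trans[OF norm_triangle_ineq]) (simp add: norm_mult)
  have f_bdd: "cmod (f y) \<le> 1 + \<bar>c\<bar>" for y
    using h_bdd[of "k y"] by (auto simp: f_def indicator_def)
  have f1: "f (a + s *\<^sub>R u) = h s" for s
    using u_nonzero by (simp add: f_def k_def L_def)
  \<comment> \<open>The second segment, not being parallel to the first, meets \<open>L\<close> for
    at most one parameter.\<close>
  have f2: "AE s in lborel. f (b + s *\<^sub>R v) = 0"
  proof -
    have "s = t" if st: "b + s *\<^sub>R v \<in> L" "b + t *\<^sub>R v \<in> L" for s t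
    proof (rule ccontr)
      assume "s \<noteq> t"
      have "(s - t) *\<^sub>R v = (b + s *\<^sub>R v - a) - (b + t *\<^sub>R v - a)" by (simp add: algebra_simps)
      also have "\<dots> = (k (b + s *\<^sub>R v) - k (b + t *\<^sub>R v)) *\<^sub>R u"
        using st unfolding L_def by (simp add: scaleR_diff_left)
      finally have "inverse (s - t) *\<^sub>R ((s - t) *\<^sub>R v)
          = inverse (s - t) *\<^sub>R ((k (b + s *\<^sub>R v) - k (b + t *\<^sub>R v)) *\<^sub>R u)" by simp
      then have "v = (inverse (s - t) * (k (b + s *\<^sub>R v) - k (b + t *\<^sub>R v))) *\<^sub>R u"
        using \<open>s \<noteq> t\<close> by simp
      then show False using nonparallel by blast
    qed
    then obtain s0 where "\<And>s. b + s *\<^sub>R v \<in> L \<Longrightarrow> s = s0" by metis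
    then show ?thesis
      using AE_lborel_singleton[of s0] by (auto simp: f_def indicator_def elim!: eventually_mono)
  qed
  have zero2: "(LINT s:{0..1}|lborel. f (b + s *\<^sub>R v) * w s) = 0" for w :: "real \<Rightarrow> complex"
    unfolding set_lebesgue_integral_def using f2 by (intro integral_eq_zero_AE) auto
  have int: "set_integrable lborel {0..1} (\<lambda>s. cis (2 * pi * (z * s)))" for z
    by (intro borel_integrable_atLeastAtMost' continuous_intros)
  have coeff: "(cmod (LINT y|\<mu>. f y * cnj (expo l y)))\<^sup>2
      = p1\<^sup>2 * (nsinc (l \<bullet> u - x) - c * nsinc (l \<bullet> u - x - 1))\<^sup>2" for l
  proof -
    define \<xi> where "\<xi> = l \<bullet> u"
    have "(LINT y|\<mu>. f y * cnj (expo l y))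
        = p1 * (LINT s:{0..1}|lborel. h s * cnj (expo l (a + s *\<^sub>R u)))"
      using f_bdd by (subst integral_eq[of _ "1 + \<bar>c\<bar>"]) (auto simp: norm_mult f1 zero2)
    also have "(LINT s:{0..1}|lborel. h s * cnj (expo l (a + s *\<^sub>R u)))
        = (LINT s:{0..1}|lborel. cis (- (2 * pi * (l \<bullet> a))) *
            (cis (2 * pi * ((x - \<xi>) * s)) + c * cis (2 * pi * ((x + 1 - \<xi>) * s))))"
    proof (intro set_lebesgue_integral_cong allI impI)
      fix s
      show "h s * cnj (expo l (a + s *\<^sub>R u)) = cis (- (2 * pi * (l \<bullet> a))) *
            (cis (2 * pi * ((x - \<xi>) * s)) + c * cis (2 * pi * ((x + 1 - \<xi>) * s)))"
        by (simp add: h_def \<xi>_def expo_eq_cis cis_cnj distrib_left distrib_right cis_mult inner_add_right algebra_simps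
            mult.left_commute[of _ "complex_of_real c"])
    qed simp
    also have "\<dots> = cis (- (2 * pi * (l \<bullet> a))) *
        (cis (pi * (x - \<xi>)) * nsinc (x - \<xi>) + c * (cis (pi * (x + 1 - \<xi>)) * nsinc (x + 1 - \<xi>)))"
      using int by (simp add: set_integral_add integral_cis)
    \<comment> \<open>Raising the frequency by 1 turns the midpoint phase by \<open>pi\<close>;
      hence the minus sign before \<open>c\<close>.\<close>
    also have "cis (pi * (x + 1 - \<xi>)) = - cis (pi * (x - \<xi>))"
      by (simp add: complex_eq_iff algebra_simps cos_add sin_add cos_diff sin_diff)
    also have "p1 * (cis (- (2 * pi * (l \<bullet> a))) *
        (cis (pi * (x - \<xi>)) * nsinc (x - \<xi>) + c * (- cis (pi * (x - \<xi>)) * nsinc (x + 1 - \<xi>))))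
        = cis (- (2 * pi * (l \<bullet> a))) * cis (pi * (x - \<xi>)) * of_real (p1 * (nsinc (x - \<xi>) - c * nsinc (x + 1 - \<xi>)))"
      by (simp add: algebra_simps)
    finally have "cmod (LINT y|\<mu>. f y * cnj (expo l y)) = \<bar>p1 * (nsinc (x - \<xi>) - c * nsinc (x + 1 - \<xi>))\<bar>"
      by (simp only: norm_mult norm_cis norm_of_real mult_1_left)
    moreover have "nsinc (x - \<xi>) = nsinc (\<xi> - x)" "nsinc (x + 1 - \<xi>) = nsinc (\<xi> - x - 1)"
      using nsinc_minus[of "\<xi> - x"] nsinc_minus[of "\<xi> - x - 1"] by (simp_all add: algebra_simps)
    ultimately show ?thesis by (simp add: \<xi>_def power_mult_distrib)
  qed
  have norm: "(LINT y|\<mu>. (cmod (f y))\<^sup>2) = p1 * (1 + c\<^sup>2)"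
  proof -
    have "complex_of_real (LINT y|\<mu>. (cmod (f y))\<^sup>2) = (LINT y|\<mu>. f y * cnj (f y))"
      by (simp only: integral_complex_of_real[symmetric] complex_norm_square)
    also have "\<dots> = p1 * (LINT s:{0..1}|lborel. h s * cnj (h s))"
      using f_bdd h_bdd by (subst integral_eq[of _ "(1 + \<bar>c\<bar>) * (1 + \<bar>c\<bar>)"])
        (auto simp: norm_mult f1 zero2 intro!: mult_mono)
    also have "(LINT s:{0..1}|lborel. h s * cnj (h s))
        = (LINT s:{0..1}|lborel. of_real (1 + c\<^sup>2) * cis (2 * pi * (0 * s)) + c * cis (2 * pi * (1 * s)) + c * cis (2 * pi * (- 1 * s)))"
      by (intro set_lebesgue_integral_cong allI impI)
         (simp_all add: h_def cis_cnj distrib_left distrib_right cis_mult power2_eq_square algebra_simps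
            mult.left_commute[of _ "complex_of_real c"])
    also have "\<dots> = of_real (1 + c\<^sup>2) * (cis (pi * 0) * nsinc 0) + c * (cis (pi * 1) * nsinc 1)
        + c * (cis (pi * - 1) * nsinc (- 1))"
      by (simp only: set_integral_add set_integral_mult_right set_integrable_mult_right int integral_cis)
    also have "\<dots> = of_real (1 + c\<^sup>2)" by (simp add: nsinc_def)
    finally show ?thesis by (simp only: of_real_mult[symmetric] of_real_eq_iff)
  qed
  have scaled: "((\<lambda>l. p1\<^sup>2 * (nsinc (l \<bullet> u - x) - c * nsinc (l \<bullet> u - x - 1))\<^sup>2) has_sum p1 * (1 + c\<^sup>2)) \<Lambda>"
    using spectrum_parseval[OF prob sets spec f_meas f_bdd] unfolding coeff norm .
  have cancel: "1 / p1\<^sup>2 * (p1\<^sup>2 * q) = q" "1 / p1\<^sup>2 * (p1 * q) = q / p1" for q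
    using p by (simp_all add: power2_eq_square)
  from has_sum_cmult_right[OF scaled, of "1 / p1\<^sup>2"] show ?thesis by (simp only: cancel)
qed

text \<open>Polarisation of the frame identities for \<open>x\<close>, for \<open>x + 1\<close> and
  for the sum of the two exponentials.\<close>

lemma spectrum_shift:
  assumes spec: "is_spectrum \<mu> \<Lambda>"
  shows "((\<lambda>l. nsinc (l \<bullet> u - x) * nsinc (l \<bullet> u - x - 1)) has_sum 0) \<Lambda>"
proof -
  have A: "((\<lambda>l. (nsinc (l \<bullet> u - x))\<^sup>2) has_sum 1 / p1) \<Lambda>"
    using spectrum_frame[OF spec, of x 0] by simp
  have B: "((\<lambda>l. (nsinc (l \<bullet> u - x - 1))\<^sup>2) has_sum 1 / p1) \<Lambda>"
    using spectrum_frame[OF spec, of "x + 1" 0] by (simp add: diff_diff_eq)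
  have C: "((\<lambda>l. (nsinc (l \<bullet> u - x) - nsinc (l \<bullet> u - x - 1))\<^sup>2) has_sum 2 / p1) \<Lambda>"
    using spectrum_frame[OF spec, of x 1] by simp
  have "((\<lambda>l. 1/2 * (((nsinc (l \<bullet> u - x))\<^sup>2 + (nsinc (l \<bullet> u - x - 1))\<^sup>2)
      + - (nsinc (l \<bullet> u - x) - nsinc (l \<bullet> u - x - 1))\<^sup>2)) has_sum (1/2 * ((1 / p1 + 1 / p1) + - (2 / p1)))) \<Lambda>"
    by (intro has_sum_cmult_right has_sum_add has_sum_uminusI A B C)
  then show ?thesis by (simp add: power2_diff)
qed

text \<open>The exponential of frequency \<open>i - j\<close> integrates over each segment to its
  value at the midpoint times a sinc. The midpoints differ by \<open>b - a + (v - u) / 2\<close>,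
  whence the shifts of \<alpha> and \<beta> by 1/2.\<close>

lemma spectrum_orthogonal:
  assumes ba: "b - a = \<alpha> *\<^sub>R u + \<beta> *\<^sub>R v" and spec: "is_spectrum \<mu> \<Lambda>"
    and ij: "i \<in> \<Lambda>" "j \<in> \<Lambda>" "i \<noteq> j"
  shows "p1 * nsinc (i \<bullet> u - j \<bullet> u)
    + cis (2 * pi * ((\<alpha> - 1/2) * (i \<bullet> u - j \<bullet> u) + (\<beta> + 1/2) * (i \<bullet> v - j \<bullet> v)))
      * (p2 * nsinc (i \<bullet> v - j \<bullet> v)) = 0"
proof -
  define d where "d = i - j"
  define x y where "x = d \<bullet> u" and "y = d \<bullet> v"
  have seg: "(LINT s:{0..1}|lborel. expo d (e + s *\<^sub>R w))
      = cis (2 * pi * (d \<bullet> e)) * (cis (pi * (d \<bullet> w)) * nsinc (d \<bullet> w))" for e w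
  proof -
    have "(LINT s:{0..1}|lborel. expo d (e + s *\<^sub>R w))
        = (LINT s:{0..1}|lborel. cis (2 * pi * (d \<bullet> e)) * cis (2 * pi * ((d \<bullet> w) * s)))"
      by (intro set_lebesgue_integral_cong) (auto simp: expo_eq_cis cis_mult inner_add_right algebra_simps)
    then show ?thesis by (simp add: integral_cis)
  qed
  have "0 = (LINT z|\<mu>. expo i z * cnj (expo j z))"
    using spec ij unfolding is_spectrum_def by auto
  also have "\<dots> = (LINT z|\<mu>. expo d z)"
    by (intro Bochner_Integration.integral_cong refl)
       (simp add: expo_eq_cis cis_cnj cis_mult d_def inner_diff_left algebra_simps)
  also have "\<dots> = p1 * (cis (2 * pi * (d \<bullet> a)) * (cis (pi * x) * nsinc x))
      + p2 * (cis (2 * pi * (d \<bullet> b)) * (cis (pi * y) * nsinc y))"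
    by (subst integral_eq[of _ 1]) (auto simp: seg x_def y_def)
  finally have eq: "p1 * (cis (2 * pi * (d \<bullet> a)) * (cis (pi * x) * nsinc x))
      + p2 * (cis (2 * pi * (d \<bullet> b)) * (cis (pi * y) * nsinc y)) = 0" by simp
  \<comment> \<open>The phase at the midpoint of the first segment, to be divided out.\<close>
  define \<phi> where "\<phi> = 2 * pi * (d \<bullet> a) + pi * x"
  have "d \<bullet> (b - a) = \<alpha> * x + \<beta> * y" by (simp add: ba x_def y_def inner_add_right)
  then have db: "d \<bullet> b = d \<bullet> a + (\<alpha> * x + \<beta> * y)" by (simp add: inner_diff_right)
  have "2 * pi * (d \<bullet> b) + pi * y = \<phi> + 2 * pi * ((\<alpha> - 1/2) * x + (\<beta> + 1/2) * y)"
    by (simp add: db \<phi>_def algebra_simps)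
  moreover define C where "C = cis (2 * pi * ((\<alpha> - 1/2) * x + (\<beta> + 1/2) * y))"
  ultimately have b: "cis (2 * pi * (d \<bullet> b)) * cis (pi * y) = cis \<phi> * C"
    by (simp only: cis_mult)
  have a: "cis (2 * pi * (d \<bullet> a)) * cis (pi * x) = cis \<phi>" by (simp only: cis_mult \<phi>_def)
  have "cis \<phi> * (p1 * nsinc x + C * (p2 * nsinc y)) = p1 * (cis \<phi> * nsinc x) + p2 * (cis \<phi> * C * nsinc y)"
    by (simp add: distrib_left mult_ac)
  also have "\<dots> = 0"
    using eq by (simp only: a b mult.assoc[symmetric, of "cis (2 * pi * (d \<bullet> a))"]
      mult.assoc[symmetric, of "cis (2 * pi * (d \<bullet> b))"])
  finally have "p1 * nsinc x + C * (p2 * nsinc y) = 0" by simp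
  then show ?thesis by (simp only: x_def y_def d_def C_def inner_diff_left)
qed

lemma spectrum_collinear_coordinates:
  assumes spec: "is_spectrum \<mu> \<Lambda>" and le: "p2 \<le> p1"
  obtains k where "\<And>i j. i \<in> \<Lambda> \<Longrightarrow> j \<in> \<Lambda> \<Longrightarrow> i \<bullet> v - j \<bullet> v = k * (i \<bullet> u - j \<bullet> u)"
proof -
  obtain \<alpha> \<beta> where ba: "b - a = \<alpha> *\<^sub>R u + \<beta> *\<^sub>R v" using coords by blast
  interpret swapped: two_segments \<mu> b a v u p2 p1 by (rule swap)
  have "((\<lambda>i. (nsinc (i \<bullet> u - x))\<^sup>2) has_sum 1 / p1) \<Lambda>" "((\<lambda>i. (nsinc (i \<bullet> v - x))\<^sup>2) has_sum 1 / p2) \<Lambda>" for x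
    using spectrum_frame[OF spec, of x 0] swapped.spectrum_frame[OF spec, of x 0] by simp_all
  then interpret biframe \<Lambda> "\<lambda>i. i \<bullet> u" "\<lambda>i. i \<bullet> v" p1 p2 "\<alpha> - 1/2" "\<beta> + 1/2"
    by unfold_locales (use p le spectrum_shift[OF spec] spectrum_orthogonal[OF ba spec] in auto)
  show ?thesis using collinear that by blast
qed

text \<open>Proportional coordinate differences mean that all differences of spectrum points are
  orthogonal to \<open>w - k *\<^sub>R z\<close>, which is nonzero because the segments are not
  parallel.\<close>

lemma spectrum_in_hyperplane:
  assumes spec: "is_spectrum \<mu> \<Lambda>"
  obtains n c where "n \<noteq> 0" "\<Lambda> \<subseteq> {l. n \<bullet> l = c}"
proof -
  note finish = that
  have hyper: thesis if w: "w \<noteq> k *\<^sub>R z" and eq: "\<And>i j. i \<in> \<Lambda> \<Longrightarrow> j \<in> \<Lambda> \<Longrightarrow> i \<bullet> w - j \<bullet> w = k * (i \<bullet> z - j \<bullet> z)" for w z k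
  proof (rule finish[of "w - k *\<^sub>R z" "(w - k *\<^sub>R z) \<bullet> (SOME l. l \<in> \<Lambda>)"])
    show "\<Lambda> \<subseteq> {l. (w - k *\<^sub>R z) \<bullet> l = (w - k *\<^sub>R z) \<bullet> (SOME l. l \<in> \<Lambda>)}"
    proof safe
      fix l assume l: "l \<in> \<Lambda>"
      then have "(SOME l. l \<in> \<Lambda>) \<in> \<Lambda>" by (rule someI)
      from eq[OF l this] show "(w - k *\<^sub>R z) \<bullet> l = (w - k *\<^sub>R z) \<bullet> (SOME l. l \<in> \<Lambda>)"
        by (simp add: inner_diff_left inner_commute algebra_simps)
    qed
  qed (use w in simp)
  interpret swapped: two_segments \<mu> b a v u p2 p1 by (rule swap)
  show ?thesis
  proof (cases "p2 \<le> p1")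
    case True
    then obtain k where "\<And>i j. i \<in> \<Lambda> \<Longrightarrow> j \<in> \<Lambda> \<Longrightarrow> i \<bullet> v - j \<bullet> v = k * (i \<bullet> u - j \<bullet> u)"
      using spectrum_collinear_coordinates[OF spec] by blast
    then show ?thesis by (rule hyper[OF nonparallel])
  next
    case False
    then have "p1 \<le> p2" by simp
    then obtain k where "\<And>i j. i \<in> \<Lambda> \<Longrightarrow> j \<in> \<Lambda> \<Longrightarrow> i \<bullet> u - j \<bullet> u = k * (i \<bullet> v - j \<bullet> v)"
      using swapped.spectrum_collinear_coordinates[OF spec] by blast
    then show ?thesis by (rule hyper[OF swapped.nonparallel])
  qed
qed

end

text \<open>Cramer's rule; a vanishing determinant \<open>D\<close> would make \<open>v\<close> a
  multiple of \<open>u\<close>.\<close>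

lemma plane_coordinates:
  fixes u v w :: "real ^ 2"
  assumes "u \<noteq> 0" "\<And>t. v \<noteq> t *\<^sub>R u"
  shows "\<exists>\<alpha> \<beta>. w = \<alpha> *\<^sub>R u + \<beta> *\<^sub>R v"
proof -
  define D where "D = u $ 1 * v $ 2 - u $ 2 * v $ 1"
  have D: "D \<noteq> 0"
  proof
    assume D0: "D = 0"
    show False
    proof (cases "u $ 1 = 0")
      case True
      with assms(1) have "u $ 2 \<noteq> 0" by (auto simp: vec_eq_iff forall_2)
      then have "v = (v $ 2 / u $ 2) *\<^sub>R u"
        using D0 True by (simp add: vec_eq_iff forall_2 D_def)
      then show False using assms(2) by blast
    next
      case False
      then have "v = (v $ 1 / u $ 1) *\<^sub>R u"
        using D0 by (simp add: vec_eq_iff forall_2 D_def field_simps)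
      then show False using assms(2) by blast
    qed
  qed
  define A B where "A = w $ 1 * v $ 2 - w $ 2 * v $ 1" and "B = u $ 1 * w $ 2 - u $ 2 * w $ 1"
  have "D * w $ i = A * u $ i + B * v $ i" for i
    using exhaust_2[of i] by (auto simp: A_def B_def D_def algebra_simps)
  then have "w $ i = A / D * u $ i + B / D * v $ i" for i
    using D by (simp add: field_simps)
  then have "w = (A / D) *\<^sub>R u + (B / D) *\<^sub>R v"
    by (simp add: vec_eq_iff)
  then show ?thesis by blast
qed

text \<open>The existence conjunct on the right keeps the condition on all spectra from holding
  vacuously and gives the reverse direction. The substance is that any spectrum lies in a
  hyperplane, which in the plane is a line.\<close>

theorem theorem4:
  fixes a1 b1 a2 b2 :: "real ^ 2" and I1 I2 :: "(real ^ 2) set"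
    and c1 c2 :: real and \<mu> :: "(real ^ 2) measure"
  assumes "I1 = closed_segment a1 b1" and "a1 \<noteq> b1"
    and "I2 = closed_segment a2 b2" and "a2 \<noteq> b2"
    and nonparallel: "\<nexists>t. b2 - a2 = t *\<^sub>R (b1 - a1)"
    and "c1 > 0" and "c2 > 0"
    and "sets \<mu> = sets borel"
    and "\<And>E. E \<in> sets borel \<Longrightarrow>
           emeasure \<mu> E = ennreal c1 * hausdorff1 (E \<inter> I1) + ennreal c2 * hausdorff1 (E \<inter> I2)"
    and "prob_space \<mu>"
  shows "is_spectral_measure \<mu> \<longleftrightarrow>
           (\<exists>\<Lambda>. is_spectrum \<mu> \<Lambda>) \<and>
           (\<forall>\<Lambda>. is_spectrum \<mu> \<Lambda> \<longrightarrow> (\<exists>L. affine L \<and> aff_dim L = 1 \<and> \<Lambda> \<subseteq> L))"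
proof -
  define u v where "u = b1 - a1" and "v = b2 - a2"
  have uv: "u \<noteq> 0" "v \<noteq> 0" using assms(2,4) by (auto simp: u_def v_def)
  have np: "v \<noteq> t *\<^sub>R u" for t using nonparallel unfolding u_def v_def by blast
  have \<mu>: "emeasure \<mu> E = ennreal c1 * hausdorff1 (E \<inter> closed_segment a1 (a1 + u))
      + ennreal c2 * hausdorff1 (E \<inter> closed_segment a2 (a2 + v))" if "E \<in> sets borel" for E
    using assms(9)[OF that] by (simp add: assms(1,3) u_def v_def)
  have mass: "c1 * norm u + c2 * norm v = 1"
    by (rule two_segment_distr(1)[OF uv assms(6,7,8,10)]) (fact \<mu>)
  have distr: "\<mu> = distr (density lborel (two_segment_density (c1 * norm u) (c2 * norm v))) borel
      (two_segment_curve a1 u a2 v)"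
    by (rule two_segment_distr(2)[OF uv assms(6,7,8,10)]) (fact \<mu>)
  have pos: "0 < c1 * norm u" "0 < c2 * norm v" using assms(6,7) uv by auto
  interpret two_segments \<mu> a1 a2 u v "c1 * norm u" "c2 * norm v"
  proof (rule two_segments.intro)
    show "\<exists>\<alpha> \<beta>. a2 - a1 = \<alpha> *\<^sub>R u + \<beta> *\<^sub>R v" by (rule plane_coordinates[OF uv(1) np])
    show "integral\<^sup>L \<mu> f = (c1 * norm u) * (LINT s:{0..1}|lborel. f (a1 + s *\<^sub>R u))
        + (c2 * norm v) * (LINT s:{0..1}|lborel. f (a2 + s *\<^sub>R v))"
      if "f \<in> borel_measurable borel" "\<And>x. cmod (f x) \<le> B" for f :: "real ^ 2 \<Rightarrow> complex" and B
      by (subst distr) (rule two_segment_integral[OF pos that])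
  qed (fact mass pos assms(8,10) uv(1) np)+
  have "\<exists>L. affine L \<and> aff_dim L = 1 \<and> \<Lambda> \<subseteq> L" if spec: "is_spectrum \<mu> \<Lambda>" for \<Lambda>
  proof -
    obtain n c where "n \<noteq> 0" "\<Lambda> \<subseteq> {l. n \<bullet> l = c}" using spectrum_in_hyperplane[OF spec] by blast
    then show ?thesis
      by (intro exI[of _ "{l. n \<bullet> l = c}"]) (simp add: affine_hyperplane)
  qed
  then show ?thesis
    using assms(8,10) unfolding is_spectral_measure_def by blast
qed

end
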